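(* Let $\lambda$ be an $(m|n)$-hook partition of $r$ and let $K$ be a field of characteristic $p>2$. Let $A_{\lambda,\mathbb Z}$ be the $\mathbb Z$-span of all modified symmetrizers $T^\lambda\{i:j\}$, $i,j\in I(m|n,r)$, and let $A_{\lambda,K}=A_{\lambda,\mathbb Z}\otimes_{\mathbb Z}K$. Then $A_{\lambda,K}$ has a $K$-basis consisting of the (images $T^\lambda\{i:j\}\otimes 1_K$ of the) modified symmetrizers $T^{\lambda}\{i:j\}$ with $T_i$ and $T_j$ semistandard.
   Context: Symbols and multiindices. Fix $m,n,r$. The symbols $1,\dots,m$ are even and $m+1,\dots,m+n$ are odd; $|a|\in\{0,1\}$ denotes the parity of $a$. $I(m|n,r)$ is the set of multiindices $i=(i_1,\dots,i_r)$ with entries in $\{1,\dots,m+n\}$. The symmetric group $\Sigma_r$ acts on the right on multiindices by $(j\pi)_a=j_{\pi(a)}$. The signed action is $j*\pi=(-1)^{s(j,\pi)}\,j\pi$, where $s(j,\pi)$ is the number of pairs $a<b$ with $\pi(a)>\pi(b)$ and $j_{\pi(a)},j_{\pi(b)}>m$; expressions in signed multiindices are extended linearly, e.g. $\chi_{i,-j}=-\chi_{i,j}$ and $\chi_{-i,j}=-\chi_{i,j}$. The space $A(m|n,r)$ over $\mathbb Q$. $A(m|n)$ is the free supercommutative $\mathbb Q$-superalgebra on generators $c_{ab}$, $1\le a,b\le m+n$, of parity $|a|+|b|$, and $A(m|n,r)$ is its degree $r$ part. It is spanned by the elements $$\chi_{i,j}=(-1)^{\sum_{t=1}^r |i_t|(|i_{t+1}|+|j_{t+1}|+\dots+|i_r|+|j_r|)}c_{i_1j_1}c_{i_2j_2}\cdots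 c_{i_rj_r},$$ which satisfy $\chi_{i*\pi,j*\pi}=\chi_{i,j}$ for $\pi\in\Sigma_r$. Tableaux. $\lambda$ is an $(m|n)$-hook partition of $r$ if it is a partition of $r$ with $\lambda_{m+1}\le n$. Fix a basic tableau $T$, i.e. a bijection from the diagram $[\lambda]$ to $\{1,\dots,r\}$; $C(T)$ and $R(T)$ are the subgroups of $\Sigma_r$ preserving each column, respectively each row, of $T$. For $i\in I(m|n,r)$, $T_i$ is the tableau of shape $\lambda$ with entry $i_{T(b)}$ in box $b$. $T_i$ is semistandard if its entries weakly increase down columns and from left to right along rows, no even symbol is repeated in a column, and no odd symbol is repeated in a row. Symmetrizers. $T^\lambda[i:j]=\sum_{\rho\in R(T)}\sum_{\kappa\in C(T)}\mathrm{sgn}(\kappa)\,\chi_{i*\rho,\,j*\kappa}$. Modified symmetrizers. For a tableau $T_j$ let $m_{aq}(j)$ be the number of occurrences of the symbol $a$ ($1\le a\le m$) in the $q$-th row of $T_j$ and $n_{ad}(j)$ the number of occurrences of the symbol $a$ ($m+1\le a\le m+n$) in the $d$-th column of $T_j$. Put $r(T_j)=\prod_{a=1}^m\prod_q m_{aq}(j)!$ and $c(T_j)=\prod_{a=m+1}^{m+n}\prod_d n_{ad}(j)!$, and $$T^\lambda\{i:j\}=\frac{1}{r(T_i)\,c(T_j)}\,T^\lambda[i:j]\in A(m|n,r).$$ *)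

theory Defs
  imports
    "HOL-Algebra.QuotRing"
    "HOL-Algebra.Generated_Groups"
    "HOL-Algebra.Multiplicative_Group"
    "HOL-Algebra.Free_Abelian_Groups"
    "HOL-Combinatorics.Permutations"
    "Jordan_Normal_Form.Missing_VectorSpace"
begin

section \<open>The free supercommutative superalgebra\<close>

datatype 'a word = Word (letters: "'a list")

instantiation word :: (type) monoid_add
begin

definition zero_word :: "'a word"
  where "zero_word = Word []"

definition plus_word :: "'a word \<Rightarrow> 'a word \<Rightarrow> 'a word"
  where "plus_word v w = Word (letters v @ letters w)"

instance
  by standard (simp_all add: zero_word_def plus_word_def)

end

text \<open>Finitely supported functions on words form, under convolution, the free associative
  \<open>\<rat>\<close>-algebra.\<close>

definition free_algebra :: "'a set \<Rightarrow> ('a word \<Rightarrow>\<^sub>0 rat) ring"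
  where "free_algebra S =
    \<lparr>carrier = {f. \<forall>w \<in> Poly_Mapping.keys f. set (letters w) \<subseteq> S},
     monoid.mult = (*), one = 1, ring.zero = 0, add = (+)\<rparr>"

definition letter :: "'a \<Rightarrow> 'a word \<Rightarrow>\<^sub>0 rat"
  where "letter x = Poly_Mapping.single (Word [x]) 1"

definition parity :: "nat \<Rightarrow> nat \<Rightarrow> nat"
  where "parity m a = (if a \<le> m then 0 else 1)"

definition generators :: "nat \<Rightarrow> nat \<Rightarrow> (nat \<times> nat) set"
  where "generators m n = {1..m + n} \<times> {1..m + n}"

definition gen_parity :: "nat \<Rightarrow> nat \<times> nat \<Rightarrow> nat"
  where "gen_parity m x = parity m (fst x) + parity m (snd x)"

text \<open>For an odd generator \<open>x = y\<close> the relation reads \<open>2 x\<^sup>2 = 0\<close>, hence \<open>x\<^sup>2 = 0\<close>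
  since \<open>2\<close> is invertible.\<close>

definition supercomm_ideal :: "nat \<Rightarrow> nat \<Rightarrow> ((nat \<times> nat) word \<Rightarrow>\<^sub>0 rat) set"
  where "supercomm_ideal m n = Idl\<^bsub>free_algebra (generators m n)\<^esub>
    {letter x * letter y - (- 1) ^ (gen_parity m x * gen_parity m y) * (letter y * letter x) | x y.
       x \<in> generators m n \<and> y \<in> generators m n}"

definition superalgebra :: "nat \<Rightarrow> nat \<Rightarrow> ((nat \<times> nat) word \<Rightarrow>\<^sub>0 rat) set ring"
  where "superalgebra m n = free_algebra (generators m n) Quot supercomm_ideal m n"

definition gen :: "nat \<Rightarrow> nat \<Rightarrow> nat \<Rightarrow> nat \<Rightarrow> ((nat \<times> nat) word \<Rightarrow>\<^sub>0 rat) set"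
  where "gen m n a b = supercomm_ideal m n +>\<^bsub>free_algebra (generators m n)\<^esub> letter (a, b)"

text \<open>Scalars act as multiples of the empty word, the unit of the free algebra.\<close>

definition scale_super ::
    "nat \<Rightarrow> nat \<Rightarrow> rat \<Rightarrow> ((nat \<times> nat) word \<Rightarrow>\<^sub>0 rat) set \<Rightarrow> ((nat \<times> nat) word \<Rightarrow>\<^sub>0 rat) set"
  where "scale_super m n q f =
    (supercomm_ideal m n +>\<^bsub>free_algebra (generators m n)\<^esub> Poly_Mapping.single 0 q)
      \<otimes>\<^bsub>superalgebra m n\<^esub> f"


section \<open>Multiindices\<close>

definition multiindices :: "nat \<Rightarrow> nat \<Rightarrow> nat \<Rightarrow> (nat \<Rightarrow> nat) set"
  where "multiindices m n r = {1..r} \<rightarrow>\<^sub>E {1..m + n}"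

text \<open>A signed multiindex \<open>(s, j)\<close> stands for \<open>s \<cdot> j\<close> with \<open>s = \<plusminus>1\<close>.\<close>

definition signed_act :: "nat \<Rightarrow> nat \<Rightarrow> (nat \<Rightarrow> nat) \<Rightarrow> (nat \<Rightarrow> nat) \<Rightarrow> rat \<times> (nat \<Rightarrow> nat)"
  where "signed_act m r j \<pi> =
    ((- 1) ^ card {(a, b). a \<in> {1..r} \<and> b \<in> {1..r} \<and> a < b \<and> \<pi> a > \<pi> b
                         \<and> j (\<pi> a) > m \<and> j (\<pi> b) > m},
     j \<circ> \<pi>)"

definition chi ::
    "nat \<Rightarrow> nat \<Rightarrow> nat \<Rightarrow> (nat \<Rightarrow> nat) \<Rightarrow> (nat \<Rightarrow> nat) \<Rightarrow> ((nat \<times> nat) word \<Rightarrow>\<^sub>0 rat) set"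
  where "chi m n r i j =
    scale_super m n
      ((- 1) ^ (\<Sum>t = 1..r. parity m (i t) * (\<Sum>u = t + 1..r. parity m (i u) + parity m (j u))))
      (foldr (\<lambda>t x. gen m n (i t) (j t) \<otimes>\<^bsub>superalgebra m n\<^esub> x) [1..<r + 1] \<one>\<^bsub>superalgebra m n\<^esub>)"

definition signed_chi ::
    "nat \<Rightarrow> nat \<Rightarrow> nat \<Rightarrow> rat \<times> (nat \<Rightarrow> nat) \<Rightarrow> rat \<times> (nat \<Rightarrow> nat)
       \<Rightarrow> ((nat \<times> nat) word \<Rightarrow>\<^sub>0 rat) set"
  where "signed_chi m n r i j = scale_super m n (fst i * fst j) (chi m n r (snd i) (snd j))"


section \<open>Partitions and tableaux\<close>

text \<open>A partition is the function \<open>q \<mapsto> \<lambda>\<^sub>q\<close> for \<open>q \<ge> 1\<close>; its value at \<open>0\<close> is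
  irrelevant.\<close>

definition is_partition :: "(nat \<Rightarrow> nat) \<Rightarrow> nat \<Rightarrow> bool"
  where "is_partition lam r \<longleftrightarrow>
    (\<forall>q \<ge> 1. lam (q + 1) \<le> lam q) \<and> finite {q. 1 \<le> q \<and> lam q \<noteq> 0} \<and>
    (\<Sum>q \<in> {q. 1 \<le> q \<and> lam q \<noteq> 0}. lam q) = r"

definition hook_partition :: "nat \<Rightarrow> nat \<Rightarrow> nat \<Rightarrow> (nat \<Rightarrow> nat) \<Rightarrow> bool"
  where "hook_partition m n r lam \<longleftrightarrow> is_partition lam r \<and> lam (m + 1) \<le> n"

text \<open>Boxes are pairs (row, column).\<close>

definition diagram :: "(nat \<Rightarrow> nat) \<Rightarrow> (nat \<times> nat) set"
  where "diagram lam = {(q, d). 1 \<le> q \<and> 1 \<le> d \<and> d \<le> lam q}"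

definition basic_tableau :: "(nat \<Rightarrow> nat) \<Rightarrow> nat \<Rightarrow> (nat \<times> nat \<Rightarrow> nat) \<Rightarrow> bool"
  where "basic_tableau lam r T \<longleftrightarrow> bij_betw T (diagram lam) {1..r}"

definition row_group :: "(nat \<Rightarrow> nat) \<Rightarrow> nat \<Rightarrow> (nat \<times> nat \<Rightarrow> nat) \<Rightarrow> (nat \<Rightarrow> nat) set"
  where "row_group lam r T =
    {\<pi>. \<pi> permutes {1..r} \<and>
        (\<forall>q. \<pi> ` T ` {b \<in> diagram lam. fst b = q} = T ` {b \<in> diagram lam. fst b = q})}"

definition column_group :: "(nat \<Rightarrow> nat) \<Rightarrow> nat \<Rightarrow> (nat \<times> nat \<Rightarrow> nat) \<Rightarrow> (nat \<Rightarrow> nat) set"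
  where "column_group lam r T =
    {\<pi>. \<pi> permutes {1..r} \<and>
        (\<forall>d. \<pi> ` T ` {b \<in> diagram lam. snd b = d} = T ` {b \<in> diagram lam. snd b = d})}"

text \<open>In the following, \<open>i (T b)\<close> is the entry of \<open>T\<^sub>i\<close> in box \<open>b\<close>.\<close>

definition semistandard :: "nat \<Rightarrow> (nat \<Rightarrow> nat) \<Rightarrow> (nat \<times> nat \<Rightarrow> nat) \<Rightarrow> (nat \<Rightarrow> nat) \<Rightarrow> bool"
  where "semistandard m lam T i \<longleftrightarrow>
    (\<forall>q q' d. (q, d) \<in> diagram lam \<and> (q', d) \<in> diagram lam \<and> q < q' \<longrightarrow>
       i (T (q, d)) \<le> i (T (q', d)) \<and>
       (i (T (q, d)) = i (T (q', d)) \<longrightarrow> i (T (q, d)) > m)) \<and>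
    (\<forall>q d d'. (q, d) \<in> diagram lam \<and> (q, d') \<in> diagram lam \<and> d < d' \<longrightarrow>
       i (T (q, d)) \<le> i (T (q, d')) \<and>
       (i (T (q, d)) = i (T (q, d')) \<longrightarrow> i (T (q, d)) \<le> m))"


section \<open>Symmetrizers\<close>

definition symmetrizer ::
    "nat \<Rightarrow> nat \<Rightarrow> nat \<Rightarrow> (nat \<Rightarrow> nat) \<Rightarrow> (nat \<times> nat \<Rightarrow> nat) \<Rightarrow> (nat \<Rightarrow> nat) \<Rightarrow> (nat \<Rightarrow> nat)
       \<Rightarrow> ((nat \<times> nat) word \<Rightarrow>\<^sub>0 rat) set"
  where "symmetrizer m n r lam T i j =
    (\<Oplus>\<^bsub>superalgebra m n\<^esub> \<rho> \<in> row_group lam r T.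
      \<Oplus>\<^bsub>superalgebra m n\<^esub> \<kappa> \<in> column_group lam r T.
        scale_super m n (of_int (sign \<kappa>))
          (signed_chi m n r (signed_act m r i \<rho>) (signed_act m r j \<kappa>)))"

definition row_mult :: "(nat \<Rightarrow> nat) \<Rightarrow> (nat \<times> nat \<Rightarrow> nat) \<Rightarrow> (nat \<Rightarrow> nat) \<Rightarrow> nat \<Rightarrow> nat \<Rightarrow> nat"
  where "row_mult lam T j a q = card {b \<in> diagram lam. fst b = q \<and> j (T b) = a}"

definition column_mult :: "(nat \<Rightarrow> nat) \<Rightarrow> (nat \<times> nat \<Rightarrow> nat) \<Rightarrow> (nat \<Rightarrow> nat) \<Rightarrow> nat \<Rightarrow> nat \<Rightarrow> nat"
  where "column_mult lam T j a d = card {b \<in> diagram lam. snd b = d \<and> j (T b) = a}"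

definition row_factor :: "nat \<Rightarrow> (nat \<Rightarrow> nat) \<Rightarrow> (nat \<times> nat \<Rightarrow> nat) \<Rightarrow> (nat \<Rightarrow> nat) \<Rightarrow> nat"
  where "row_factor m lam T j = (\<Prod>a = 1..m. \<Prod>q \<in> fst ` diagram lam. fact (row_mult lam T j a q))"

definition column_factor :: "nat \<Rightarrow> nat \<Rightarrow> (nat \<Rightarrow> nat) \<Rightarrow> (nat \<times> nat \<Rightarrow> nat) \<Rightarrow> (nat \<Rightarrow> nat) \<Rightarrow> nat"
  where "column_factor m n lam T j =
    (\<Prod>a = m + 1..m + n. \<Prod>d \<in> snd ` diagram lam. fact (column_mult lam T j a d))"

definition modified_symmetrizer ::
    "nat \<Rightarrow> nat \<Rightarrow> nat \<Rightarrow> (nat \<Rightarrow> nat) \<Rightarrow> (nat \<times> nat \<Rightarrow> nat) \<Rightarrow> (nat \<Rightarrow> nat) \<Rightarrow> (nat \<Rightarrow> nat)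
       \<Rightarrow> ((nat \<times> nat) word \<Rightarrow>\<^sub>0 rat) set"
  where "modified_symmetrizer m n r lam T i j =
    scale_super m n (1 / (of_nat (row_factor m lam T i) * of_nat (column_factor m n lam T j)))
      (symmetrizer m n r lam T i j)"

text \<open>\<open>A\<^sub>\<lambda>\<^sub>,\<^sub>\<int>\<close> as an abelian group, written multiplicatively.\<close>

definition A_int ::
    "nat \<Rightarrow> nat \<Rightarrow> nat \<Rightarrow> (nat \<Rightarrow> nat) \<Rightarrow> (nat \<times> nat \<Rightarrow> nat)
       \<Rightarrow> ((nat \<times> nat) word \<Rightarrow>\<^sub>0 rat) set monoid"
  where "A_int m n r lam T =
    (add_monoid (superalgebra m n))
      \<lparr>carrier := generate (add_monoid (superalgebra m n))
        {modified_symmetrizer m n r lam T i j | i j.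
           i \<in> multiindices m n r \<and> j \<in> multiindices m n r}\<rparr>"


section \<open>Extension of scalars\<close>

text \<open>The tensor product \<open>G \<otimes>\<^sub>\<int> K\<close> of a (multiplicatively written) abelian group with a ring: the
  free abelian group on \<open>G \<times> K\<close> modulo biadditivity, with \<open>K\<close> acting on the right factor.\<close>

definition tensor_free ::
    "('a, 'c) monoid_scheme \<Rightarrow> ('k, 'd) ring_scheme \<Rightarrow> ('a \<times> 'k \<Rightarrow>\<^sub>0 int) monoid"
  where "tensor_free G K = free_Abelian_group (carrier G \<times> carrier K)"

definition tensor_rels ::
    "('a, 'c) monoid_scheme \<Rightarrow> ('k, 'd) ring_scheme \<Rightarrow> ('a \<times> 'k \<Rightarrow>\<^sub>0 int) set"
  where "tensor_rels G K = generate (tensor_free G K)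
    ({frag_of (x \<otimes>\<^bsub>G\<^esub> y, k) - frag_of (x, k) - frag_of (y, k) | x y k.
        x \<in> carrier G \<and> y \<in> carrier G \<and> k \<in> carrier K} \<union>
     {frag_of (x, k \<oplus>\<^bsub>K\<^esub> l) - frag_of (x, k) - frag_of (x, l) | x k l.
        x \<in> carrier G \<and> k \<in> carrier K \<and> l \<in> carrier K})"

text \<open>The fields \<open>mult\<close> and \<open>one\<close> belong to the record type but play no role in a module.\<close>

definition tensor_module ::
    "('a, 'c) monoid_scheme \<Rightarrow> ('k, 'd) ring_scheme \<Rightarrow> ('k, ('a \<times> 'k \<Rightarrow>\<^sub>0 int) set) module"
  where "tensor_module G K =
    \<lparr>carrier = carrier (tensor_free G K Mod tensor_rels G K),
     monoid.mult = (\<lambda>_ _. undefined),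
     one = undefined,
     ring.zero = \<one>\<^bsub>tensor_free G K Mod tensor_rels G K\<^esub>,
     add = (\<lambda>U V. U \<otimes>\<^bsub>tensor_free G K Mod tensor_rels G K\<^esub> V),
     smult = (\<lambda>k U. \<Union>f \<in> U. tensor_rels G K #>\<^bsub>tensor_free G K\<^esub>
                frag_extend (\<lambda>(x, l). frag_of (x, k \<otimes>\<^bsub>K\<^esub> l)) f)\<rparr>"

definition pure_tensor ::
    "('a, 'c) monoid_scheme \<Rightarrow> ('k, 'd) ring_scheme \<Rightarrow> 'a \<Rightarrow> 'k \<Rightarrow> ('a \<times> 'k \<Rightarrow>\<^sub>0 int) set"
  where "pure_tensor G K x k = tensor_rels G K #>\<^bsub>tensor_free G K\<^esub> frag_of (x, k)"

text \<open>The additive order of \<open>\<one>\<close>, which is \<open>0\<close> if that order is infinite.\<close>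

definition characteristic :: "('k, 'd) ring_scheme \<Rightarrow> nat"
  where "characteristic K = group.ord (add_monoid K) \<one>\<^bsub>K\<^esub>"

end

(* Tensors are functions on multiindices, so T{i:j} is the pairing <xi_i, eta_j> of xi_i, the orbit sum of
   i under R(T), with eta_j, the alternating orbit sum of j under C(T), where <x, y> is the sum of the
   x pi (x) y pi over all permutations pi. The product <x, y> with y alternating under C(T) depends only on
   the alternating column sum C x of x.

   Straightening: if row-sorted T_i violates the column condition at boxes a0 above b0, let H shuffle the
   entries >= i(a0) of the row of a0 with the entries <= i(b0) of the next row. By the pigeonhole principle
   the row symmetrization z of the H-orbit sum of i has C z = 0. Normalized by the order of R(T) inter H, z is
   integral, contains xi_i with coefficient 1, and all other row-sorted k in it have larger weight
   sum_a row(a) k(a). Hence C xi_i is an integral combination of the semistandard C xi_s. The statement for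
   eta_j follows by exchanging rows with columns and even with odd symbols.

   Independence: the coefficient of C xi_i at a semistandard k vanishes unless i = k or wt i < wt k, so the
   C xi_s are independent. Applying C to the left factor of <xi_i, eta_j> kills, by von Neumann's lemma, all pi
   outside C(T) R(T) and leaves (C xi_i) (x) (C R eta_j); by positivity C R v = 0 implies R v = 0 for
   alternating v, and the R eta_s are independent by duality.

   In the superalgebra a combination of the chi_{i,j} vanishes iff its pairing does: the pairing gives
   functionals on the free algebra that vanish on the defining ideal, and averaging over the permutations
   recovers chi_{i,j} from its pairing. So the semistandard T{i:j} are a Z-basis of the lattice that they and
   all other modified symmetrizers span, and a Z-basis remains a basis after extension of scalars. *)

theory Submission
  imports Defs
begin

section \<open>Extension of scalars of a free abelian group\<close>

text \<open>Spanning must be integral while independence may be rational, so the normalizing factors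
  matter for spanning. If xi_i is nonzero, r(T_i) is the order of the stabilizer of i in R(T); then
  xi_i is an orbit sum with coefficients 0, 1 and -1. The same holds for eta_j and c(T_j). In the
  Garnir relation a sum over a whole group has multiplicities; equal summands fill cosets of one
  subgroup, and division by its order keeps all coefficients integral and makes the leading one 1.
  The exchange of even and odd rests on the sign character: transposing two equal symbols gives 1
  for even and -1 for odd ones, and multiplying by the sign of the permutation reverses this. The
  order of the symbols must survive the exchange, so the tableau arguments keep parity as a
  predicate \<open>Bos\<close> apart from the order. The pairing can replace \<chi> because it too
  depends on two multiindices only up to the simultaneous signed action, but it is evaluated
  coefficient by coefficient. Nothing is lost, as r! is invertible in the rationals.\<close>

locale free_tensor = G: comm_group G + K: field K
  for G :: "('a, 'c) monoid_scheme" and K :: "('k, 'd) ring_scheme" +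
  fixes X :: "'x set" and b :: "'x \<Rightarrow> 'a" and coord :: "'a \<Rightarrow> 'x \<Rightarrow> int"
  assumes fin: "finite X"
    and b_closed: "s \<in> X \<Longrightarrow> b s \<in> carrier G"
    and coord_mult: "x \<in> carrier G \<Longrightarrow> y \<in> carrier G \<Longrightarrow> s \<in> X \<Longrightarrow> coord (x \<otimes>\<^bsub>G\<^esub> y) s = coord x s + coord y s"
    and coord_b: "s \<in> X \<Longrightarrow> t \<in> X \<Longrightarrow> coord (b s) t = (if s = t then 1 else 0)"
    and gen: "carrier G = generate G (b ` X)"
begin

abbreviation "F \<equiv> tensor_free G K"
abbreviation "N \<equiv> tensor_rels G K"
abbreviation "M \<equiv> tensor_module G K"
abbreviation "gens \<equiv> carrier G \<times> carrier K"

definition q :: "('a \<times> 'k \<Rightarrow>\<^sub>0 int) \<Rightarrow> ('a \<times> 'k \<Rightarrow>\<^sub>0 int) set"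
  where "q f = N #>\<^bsub>F\<^esub> f"

text \<open>Lifts scalar multiplication to the free group. It preserves the relations
  (\<open>ext_N\<close>), but is additive in the scalar only modulo them
  (\<open>ext_add_left\<close>).\<close>

definition ext :: "'k \<Rightarrow> ('a \<times> 'k \<Rightarrow>\<^sub>0 int) \<Rightarrow> 'a \<times> 'k \<Rightarrow>\<^sub>0 int"
  where "ext k f = frag_extend (\<lambda>(x, l). frag_of (x, k \<otimes>\<^bsub>K\<^esub> l)) f"

section \<open>The free abelian group and the relations of the tensor product\<close>

lemma F_carrier: "f \<in> carrier F \<longleftrightarrow> Poly_Mapping.keys f \<subseteq> gens"
  by (simp add: tensor_free_def)

lemma F_mult: "f \<otimes>\<^bsub>F\<^esub> g = f + g"
  by (simp add: tensor_free_def)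

lemma F_one: "\<one>\<^bsub>F\<^esub> = 0"
  by (simp add: tensor_free_def)

lemma F_comm_group: "comm_group F"
  by (simp add: tensor_free_def abelian_free_Abelian_group)

lemma F_inv: "f \<in> carrier F \<Longrightarrow> inv\<^bsub>F\<^esub> f = - f"
  by (simp add: tensor_free_def)

lemma F_of: "frag_of (x, k) \<in> carrier F \<longleftrightarrow> x \<in> carrier G \<and> k \<in> carrier K"
  by (simp add: F_carrier)

lemma F_diff: "f \<in> carrier F \<Longrightarrow> g \<in> carrier F \<Longrightarrow> f - g \<in> carrier F"
  unfolding F_carrier using keys_diff[of f g] by blast

lemma F_add: "f \<in> carrier F \<Longrightarrow> g \<in> carrier F \<Longrightarrow> f + g \<in> carrier F"
  unfolding F_carrier using keys_add[of f g] by blast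

lemma F_induct [consumes 1, case_names zero of diff]:
  assumes "f \<in> carrier F" "P 0" "\<And>x k. x \<in> carrier G \<Longrightarrow> k \<in> carrier K \<Longrightarrow> P (frag_of (x, k))"
    "\<And>f g. f \<in> carrier F \<Longrightarrow> g \<in> carrier F \<Longrightarrow> P f \<Longrightarrow> P g \<Longrightarrow> P (f - g)"
  shows "P f"
  using assms(1) unfolding F_carrier
  by (rule free_Abelian_group_induct) (use assms(2-4) in \<open>auto simp: F_carrier\<close>)

definition rel_gens where
  "rel_gens = {frag_of (x \<otimes>\<^bsub>G\<^esub> y, k) - frag_of (x, k) - frag_of (y, k) | x y k.
        x \<in> carrier G \<and> y \<in> carrier G \<and> k \<in> carrier K} \<union>
     {frag_of (x, k \<oplus>\<^bsub>K\<^esub> l) - frag_of (x, k) - frag_of (x, l) | x k l.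
        x \<in> carrier G \<and> k \<in> carrier K \<and> l \<in> carrier K}"

lemma N_eq: "N = generate F rel_gens"
  by (simp add: tensor_rels_def rel_gens_def)

lemma rel_gens_carrier: "rel_gens \<subseteq> carrier F"
proof
  fix f assume "f \<in> rel_gens"
  then consider x y k where "f = frag_of (x \<otimes>\<^bsub>G\<^esub> y, k) - frag_of (x, k) - frag_of (y, k)"
      "x \<in> carrier G" "y \<in> carrier G" "k \<in> carrier K"
    | x k l where "f = frag_of (x, k \<oplus>\<^bsub>K\<^esub> l) - frag_of (x, k) - frag_of (x, l)"
      "x \<in> carrier G" "k \<in> carrier K" "l \<in> carrier K"
    unfolding rel_gens_def by blast
  then show "f \<in> carrier F" by cases (auto simp: F_of intro!: F_diff)
qed

lemma N_subgroup: "subgroup N F"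
  unfolding N_eq by (rule group.generate_is_subgroup[OF comm_group.axioms(2)[OF F_comm_group] rel_gens_carrier])

lemma N_carrier: "f \<in> N \<Longrightarrow> f \<in> carrier F"
  using subgroup.subset[OF N_subgroup] by blast

lemma N_zero: "0 \<in> N"
  using subgroup.one_closed[OF N_subgroup] by (simp add: F_one)

lemma N_add: "f \<in> N \<Longrightarrow> g \<in> N \<Longrightarrow> f + g \<in> N"
  using subgroup.m_closed[OF N_subgroup] by (simp add: F_mult)

lemma N_minus: "f \<in> N \<Longrightarrow> - f \<in> N"
  using subgroup.m_inv_closed[OF N_subgroup] by (simp add: F_inv N_carrier)

lemma N_diff: "f \<in> N \<Longrightarrow> g \<in> N \<Longrightarrow> f - g \<in> N"
  using N_add[OF _ N_minus] by simp

lemma N_rel1: "x \<in> carrier G \<Longrightarrow> y \<in> carrier G \<Longrightarrow> k \<in> carrier K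
    \<Longrightarrow> frag_of (x \<otimes>\<^bsub>G\<^esub> y, k) - frag_of (x, k) - frag_of (y, k) \<in> N"
  unfolding N_eq by (rule generate.incl) (auto simp: rel_gens_def)

lemma N_rel2: "x \<in> carrier G \<Longrightarrow> k \<in> carrier K \<Longrightarrow> l \<in> carrier K
    \<Longrightarrow> frag_of (x, k \<oplus>\<^bsub>K\<^esub> l) - frag_of (x, k) - frag_of (x, l) \<in> N"
  unfolding N_eq by (rule generate.incl) (auto simp: rel_gens_def)

lemma N_induct [consumes 1, case_names rel1 rel2 zero minus add]:
  assumes "f \<in> N"
    and rel1: "\<And>x y k. x \<in> carrier G \<Longrightarrow> y \<in> carrier G \<Longrightarrow> k \<in> carrier K
      \<Longrightarrow> P (frag_of (x \<otimes>\<^bsub>G\<^esub> y, k) - frag_of (x, k) - frag_of (y, k))"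
    and rel2: "\<And>x k l. x \<in> carrier G \<Longrightarrow> k \<in> carrier K \<Longrightarrow> l \<in> carrier K
      \<Longrightarrow> P (frag_of (x, k \<oplus>\<^bsub>K\<^esub> l) - frag_of (x, k) - frag_of (x, l))"
    and "P 0" and minus: "\<And>f. f \<in> carrier F \<Longrightarrow> P f \<Longrightarrow> P (- f)"
    and add: "\<And>f g. f \<in> N \<Longrightarrow> g \<in> N \<Longrightarrow> P f \<Longrightarrow> P g \<Longrightarrow> P (f + g)"
  shows "P f"
proof -
  have gens: "P f" if "f \<in> rel_gens" for f using that rel1 rel2 by (auto simp: rel_gens_def)
  show ?thesis
    using assms(1) unfolding N_eq
  proof (induction rule: generate.induct)
    case one
    then show ?case using \<open>P 0\<close> by (simp add: F_one)
  next
    case (incl h)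
    then show ?case by (rule gens)
  next
    case (inv h)
    then have "h \<in> carrier F" using rel_gens_carrier by blast
    then show ?case using minus gens inv by (simp add: F_inv)
  next
    case (eng h1 h2)
    then show ?case using add unfolding N_eq F_mult by blast
  qed
qed

lemma q_eq: "q f = {h + f | h. h \<in> N}"
  by (auto simp: q_def r_coset_def F_mult)

lemma q_eq_iff: "q f = q g \<longleftrightarrow> f - g \<in> N"
proof
  assume "q f = q g"
  moreover have "0 + f \<in> q f" unfolding q_eq using N_zero by blast
  ultimately obtain h where "h \<in> N" "f = h + g" unfolding q_eq by auto
  then show "f - g \<in> N" by simp
next
  assume *: "f - g \<in> N"
  have "h + f \<in> q g" if "h \<in> N" for h
  proof -
    have "h + f = (h + (f - g)) + g" by simp
    then show ?thesis using N_add[OF that *] unfolding q_eq by blast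
  qed
  moreover have "h + g \<in> q f" if "h \<in> N" for h
  proof -
    have "h + g = (h - (f - g)) + f" by simp
    then show ?thesis using N_diff[OF that *] unfolding q_eq by blast
  qed
  ultimately show "q f = q g" unfolding q_eq by blast
qed

lemma ext_zero: "ext k 0 = 0"
  by (simp add: ext_def)

lemma ext_diff: "ext k (f - g) = ext k f - ext k g"
  by (simp add: ext_def frag_extend_diff)

lemma ext_add: "ext k (f + g) = ext k f + ext k g"
  by (simp add: ext_def frag_extend_add)

lemma ext_of: "ext k (frag_of (x, l)) = frag_of (x, k \<otimes>\<^bsub>K\<^esub> l)"
  by (simp add: ext_def)

lemma ext_carrier: "f \<in> carrier F \<Longrightarrow> k \<in> carrier K \<Longrightarrow> ext k f \<in> carrier F"
proof (induction rule: F_induct)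
  case zero
  then show ?case by (simp add: ext_zero F_carrier)
next
  case (diff f g)
  then show ?case unfolding ext_diff by (intro F_diff)
qed (simp add: ext_of F_of)

lemma ext_N:
  assumes "f \<in> N" "k \<in> carrier K"
  shows "ext k f \<in> N"
  using assms(1)
proof (induction rule: N_induct)
  case (rel1 x y l)
  then show ?case using assms(2) by (simp add: ext_diff ext_of N_rel1)
next
  case (rel2 x l l')
  then show ?case using assms(2) by (simp add: ext_diff ext_of K.r_distr N_rel2)
next
  case (minus f)
  then show ?case using N_minus[of "ext k f"] ext_diff[of k 0 f] by (simp add: ext_zero)
qed (simp_all add: ext_zero N_zero ext_add N_add)

section \<open>The vector space structure of the quotient\<close>

lemma M_carrier: "U \<in> carrier M \<longleftrightarrow> (\<exists>f\<in>carrier F. U = q f)"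
  by (auto simp: tensor_module_def FactGroup_def RCOSETS_def q_def)

lemma q_closed: "f \<in> carrier F \<Longrightarrow> q f \<in> carrier M"
  using M_carrier by blast

lemma M_zero: "\<zero>\<^bsub>M\<^esub> = q 0"
  by (simp add: tensor_module_def FactGroup_def q_eq)

lemma M_add: "f \<in> carrier F \<Longrightarrow> g \<in> carrier F \<Longrightarrow> q f \<oplus>\<^bsub>M\<^esub> q g = q (f + g)"
  using normal.rcos_sum[OF comm_group.subgroup_imp_normal[OF F_comm_group N_subgroup]]
  by (simp add: tensor_module_def FactGroup_def q_def F_mult)

text \<open>The product is defined as a union over all representatives of the class. By
  \<open>ext_N\<close> each of them contributes the same class, so the union is that class.\<close>

lemma M_smult:
  assumes "f \<in> carrier F" "k \<in> carrier K"
  shows "k \<odot>\<^bsub>M\<^esub> q f = q (ext k f)"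
proof -
  have "q (ext k g) = q (ext k f)" if g: "g \<in> q f" for g
  proof -
    obtain h where h: "h \<in> N" "g = h + f" using g by (auto simp: q_eq)
    show ?thesis unfolding q_eq_iff h ext_add using ext_N[OF h(1) assms(2)] by simp
  qed
  moreover have "f \<in> q f" using N_zero by (force simp: q_eq)
  ultimately have "(\<Union>g\<in>q f. q (ext k g)) = q (ext k f)" by blast
  then show ?thesis by (simp add: tensor_module_def q_def ext_def)
qed

lemma M_abelian_group: "abelian_group M"
proof (rule abelian_groupI)
  have F_zero: "0 \<in> carrier F" by (simp add: F_carrier)
  show "\<zero>\<^bsub>M\<^esub> \<in> carrier M" unfolding M_zero by (rule q_closed[OF F_zero])
  fix U assume "U \<in> carrier M"
  then obtain f where f: "f \<in> carrier F" "U = q f" using M_carrier by blast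
  show "\<zero>\<^bsub>M\<^esub> \<oplus>\<^bsub>M\<^esub> U = U" using f F_zero by (simp add: M_zero M_add)
  show "\<exists>V\<in>carrier M. V \<oplus>\<^bsub>M\<^esub> U = \<zero>\<^bsub>M\<^esub>"
  proof
    have mf: "- f \<in> carrier F" using F_diff[OF F_zero f(1)] by simp
    then show "q (- f) \<in> carrier M" by (rule q_closed)
    show "q (- f) \<oplus>\<^bsub>M\<^esub> U = \<zero>\<^bsub>M\<^esub>" using f mf by (simp add: M_add M_zero)
  qed
  fix V assume "V \<in> carrier M"
  then obtain g where g: "g \<in> carrier F" "V = q g" using M_carrier by blast
  show "U \<oplus>\<^bsub>M\<^esub> V \<in> carrier M" using f g by (simp add: M_add q_closed F_add)
  show "U \<oplus>\<^bsub>M\<^esub> V = V \<oplus>\<^bsub>M\<^esub> U" using f g by (simp add: M_add add.commute)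
  fix W assume "W \<in> carrier M"
  then obtain h where h: "h \<in> carrier F" "W = q h" using M_carrier by blast
  show "U \<oplus>\<^bsub>M\<^esub> V \<oplus>\<^bsub>M\<^esub> W = U \<oplus>\<^bsub>M\<^esub> (V \<oplus>\<^bsub>M\<^esub> W)" using f g h by (simp add: M_add F_add add.assoc)
qed

lemma ext_add_left:
  assumes "f \<in> carrier F" "k \<in> carrier K" "l \<in> carrier K"
  shows "ext (k \<oplus>\<^bsub>K\<^esub> l) f - (ext k f + ext l f) \<in> N"
  using assms(1)
proof (induction rule: F_induct)
  case (of x j)
  then show ?case using assms N_rel2[of x "k \<otimes>\<^bsub>K\<^esub> j" "l \<otimes>\<^bsub>K\<^esub> j"]
    by (simp add: ext_of K.l_distr diff_diff_add)
next
  case (diff f g)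
  from N_diff[OF diff(3,4)] show ?case by (simp add: ext_diff algebra_simps)
qed (simp add: ext_zero N_zero)

lemma ext_assoc:
  assumes "f \<in> carrier F" "k \<in> carrier K" "l \<in> carrier K"
  shows "ext (k \<otimes>\<^bsub>K\<^esub> l) f = ext k (ext l f)"
  using assms(1) by (induction rule: F_induct) (use assms in \<open>simp_all add: ext_zero ext_of ext_diff K.m_assoc\<close>)

lemma ext_one: "f \<in> carrier F \<Longrightarrow> ext \<one>\<^bsub>K\<^esub> f = f"
  by (induction rule: F_induct) (simp_all add: ext_zero ext_of ext_diff)

lemma M_module: "module K M"
proof (rule module.intro[OF K.is_cring M_abelian_group], unfold_locales)
  fix k U assume k: "k \<in> carrier K" and "U \<in> carrier M"
  then obtain f where f: "f \<in> carrier F" "U = q f" using M_carrier by blast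
  show "k \<odot>\<^bsub>M\<^esub> U \<in> carrier M" using k f by (simp add: M_smult q_closed ext_carrier)
next
  fix k l U assume k: "k \<in> carrier K" "l \<in> carrier K" and "U \<in> carrier M"
  then obtain f where f: "f \<in> carrier F" "U = q f" using M_carrier by blast
  show "(k \<oplus>\<^bsub>K\<^esub> l) \<odot>\<^bsub>M\<^esub> U = k \<odot>\<^bsub>M\<^esub> U \<oplus>\<^bsub>M\<^esub> l \<odot>\<^bsub>M\<^esub> U"
    using k f by (simp add: M_smult M_add ext_carrier q_eq_iff ext_add_left)
  show "(k \<otimes>\<^bsub>K\<^esub> l) \<odot>\<^bsub>M\<^esub> U = k \<odot>\<^bsub>M\<^esub> (l \<odot>\<^bsub>M\<^esub> U)"
    using k f by (simp add: M_smult ext_carrier ext_assoc)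
next
  fix k U V assume k: "k \<in> carrier K" and U: "U \<in> carrier M" and V: "V \<in> carrier M"
  obtain f where "f \<in> carrier F" "U = q f" using U M_carrier by blast
  moreover obtain g where "g \<in> carrier F" "V = q g" using V M_carrier by blast
  ultimately show "k \<odot>\<^bsub>M\<^esub> (U \<oplus>\<^bsub>M\<^esub> V) = k \<odot>\<^bsub>M\<^esub> U \<oplus>\<^bsub>M\<^esub> k \<odot>\<^bsub>M\<^esub> V"
    using k by (simp add: M_smult M_add ext_carrier ext_add F_add)
next
  fix U assume "U \<in> carrier M"
  then obtain f where "f \<in> carrier F" "U = q f" using M_carrier by blast
  then show "\<one>\<^bsub>K\<^esub> \<odot>\<^bsub>M\<^esub> U = U" by (simp add: M_smult ext_one)
qed

lemma M_vectorspace: "vectorspace K M"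
  by (rule vectorspace.intro[OF M_module K.field_axioms])

sublocale M: vectorspace K M
  by (rule M_vectorspace)

section \<open>Generation and independence of the images of the lattice basis\<close>

definition v :: "'x \<Rightarrow> ('a \<times> 'k \<Rightarrow>\<^sub>0 int) set"
  where "v s = q (frag_of (b s, \<one>\<^bsub>K\<^esub>))"

lemma v_closed: "s \<in> X \<Longrightarrow> v s \<in> carrier M"
  unfolding v_def by (rule q_closed) (simp add: F_of b_closed)

text \<open>Pure tensors suffice, since differences of the generators \<open>frag_of (x, k)\<close>
  exhaust the free group. For a pure tensor, induct on how x arises from the lattice basis.\<close>

lemma v_gen: "M.span (v ` X) = carrier M"
proof -
  interpret W: submodule K "M.span (v ` X)" M
    by (rule M.span_is_submodule) (use v_closed in blast)
  have W_diff: "q f \<in> M.span (v ` X)" if "q (f + g) \<in> M.span (v ` X)" "q g \<in> M.span (v ` X)"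
    "f \<in> carrier F" "g \<in> carrier F" for f g
  proof -
    have "\<ominus>\<^bsub>M\<^esub> q g \<in> M.span (v ` X)"
      using W.smult_closed[OF _ that(2), of "\<ominus>\<^bsub>K\<^esub> \<one>\<^bsub>K\<^esub>"] q_closed[OF that(4)] by (simp add: M.smult_l_minus)
    then have "q (f + g) \<oplus>\<^bsub>M\<^esub> \<ominus>\<^bsub>M\<^esub> q g \<in> M.span (v ` X)" using W.m_closed[OF that(1)] by simp
    moreover have "q (f + g) \<oplus>\<^bsub>M\<^esub> \<ominus>\<^bsub>M\<^esub> q g = q f"
      using q_closed[OF that(3)] q_closed[OF that(4)] by (simp add: M_add[OF that(3,4), symmetric] M.M.a_assoc M.M.r_neg)
    ultimately show ?thesis by simp
  qed
  have v_in: "v s \<in> M.span (v ` X)" if "s \<in> X" for s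
    using M.in_own_span[of "v ` X"] v_closed that by blast
  have pure: "q (frag_of (x, k)) \<in> M.span (v ` X)" if "x \<in> generate G (b ` X)" and k: "k \<in> carrier K" for x k
    using that(1)
  proof (induction rule: generate.induct)
    case one
    \<comment> \<open>With both group elements equal to the unit, the left additivity relation is
      minus the generator itself.\<close>
    have "frag_of (\<one>\<^bsub>G\<^esub>, k) - 0 \<in> N" using N_minus[OF N_rel1[of "\<one>\<^bsub>G\<^esub>" "\<one>\<^bsub>G\<^esub>" k]] k by simp
    then have "q (frag_of (\<one>\<^bsub>G\<^esub>, k)) = q 0" by (simp only: q_eq_iff)
    then show ?case using W.zero_closed by (simp add: M_zero)
  next
    case (incl x)
    then obtain s where s: "s \<in> X" "x = b s" by blast
    have "k \<odot>\<^bsub>M\<^esub> v s = q (frag_of (x, k))"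
      using s k b_closed by (simp add: v_def M_smult F_of ext_of)
    then show ?case using W.smult_closed[OF k v_in[OF s(1)]] by simp
  next
    case (inv x)
    then obtain s where s: "s \<in> X" "x = b s" by blast
    have x: "x \<in> carrier G" using s b_closed by simp
    have "frag_of (\<one>\<^bsub>G\<^esub>, k) - 0 \<in> N" using N_minus[OF N_rel1[of "\<one>\<^bsub>G\<^esub>" "\<one>\<^bsub>G\<^esub>" k]] k by simp
    from N_diff[OF this N_rel1[of "inv\<^bsub>G\<^esub> x" x k]] have "frag_of (inv\<^bsub>G\<^esub> x, k) + frag_of (x, k) - 0 \<in> N"
      using x k by (simp add: add.commute)
    then have "q (frag_of (inv\<^bsub>G\<^esub> x, k) + frag_of (x, k)) = q 0" by (simp only: q_eq_iff)
    then have "q (frag_of (inv\<^bsub>G\<^esub> x, k) + frag_of (x, k)) \<in> M.span (v ` X)" using W.zero_closed by (simp add: M_zero)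
    moreover have "q (frag_of (x, k)) \<in> M.span (v ` X)"
      using W.smult_closed[OF k v_in[OF s(1)]] s k b_closed by (simp add: v_def M_smult F_of ext_of)
    ultimately show ?case by (rule W_diff) (use x k in \<open>auto simp: F_of\<close>)
  next
    case (eng x y)
    then have xy: "x \<in> carrier G" "y \<in> carrier G" using gen by auto
    have "q (frag_of (x \<otimes>\<^bsub>G\<^esub> y, k)) = q (frag_of (x, k) + frag_of (y, k))"
      unfolding q_eq_iff using N_rel1[OF xy k] by (simp add: diff_diff_add)
    also have "\<dots> = q (frag_of (x, k)) \<oplus>\<^bsub>M\<^esub> q (frag_of (y, k))" using xy k by (simp add: M_add F_of)
    finally show ?case using W.m_closed eng by simp
  qed
  have "q f \<in> M.span (v ` X)" if "f \<in> carrier F" for f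
    using that
  proof (induction rule: F_induct)
    case zero
    then show ?case using W.zero_closed by (simp add: M_zero)
  next
    case (of x k)
    then show ?case using pure gen by blast
  next
    case (diff f g)
    then show ?case using W_diff[of "f - g" g] F_diff by simp
  qed
  then have "carrier M \<subseteq> M.span (v ` X)" by (auto simp: M_carrier)
  then show ?thesis using W.subset by (rule equalityI[rotated])
qed

text \<open>The integer coordinate acts on K as a multiple in its additive group; this turns a
  coordinate over the integers into one over K.\<close>

lemma ex_functional:
  assumes "s \<in> X"
  shows "\<exists>h. h \<in> hom F (add_monoid K) \<and> (\<forall>x\<in>carrier G. \<forall>k\<in>carrier K. h (frag_of (x, k)) = ([coord x s] \<cdot>\<^bsub>K\<^esub> k))"
proof -
  have "(\<lambda>(x, k). ([coord x s] \<cdot>\<^bsub>K\<^esub> k)) ` gens \<subseteq> carrier (add_monoid K)" by auto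
  from comm_group.free_Abelian_group_universal[OF K.a_comm_group this]
  obtain h where "h \<in> hom (free_Abelian_group gens) (add_monoid K)"
    "\<And>x. x \<in> gens \<Longrightarrow> h (frag_of x) = (case x of (x, k) \<Rightarrow> ([coord x s] \<cdot>\<^bsub>K\<^esub> k))" by blast
  then show ?thesis by (intro exI[of _ h]) (auto simp: tensor_free_def)
qed

definition coordinate_map where
  "coordinate_map s \<psi> \<longleftrightarrow> \<psi> \<in> carrier M \<rightarrow> carrier K
    \<and> (\<forall>U\<in>carrier M. \<forall>V\<in>carrier M. \<psi> (U \<oplus>\<^bsub>M\<^esub> V) = \<psi> U \<oplus>\<^bsub>K\<^esub> \<psi> V)
    \<and> (\<forall>k\<in>carrier K. \<forall>U\<in>carrier M. \<psi> (k \<odot>\<^bsub>M\<^esub> U) = k \<otimes>\<^bsub>K\<^esub> \<psi> U)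
    \<and> (\<forall>t\<in>X. \<psi> (v t) = (if t = s then \<one>\<^bsub>K\<^esub> else \<zero>\<^bsub>K\<^esub>))"

text \<open>The functional kills both kinds of relations, one by additivity of \<open>coord\<close>,
  the other by additivity of integer multiples in K, so it descends to the quotient.\<close>

lemma ex_coordinate_map:
  assumes s: "s \<in> X"
  shows "\<exists>\<psi>. coordinate_map s \<psi>"
proof -
  obtain h where h: "h \<in> hom F (add_monoid K)"
    and h_of: "\<And>x k. x \<in> carrier G \<Longrightarrow> k \<in> carrier K \<Longrightarrow> h (frag_of (x, k)) = ([coord x s] \<cdot>\<^bsub>K\<^esub> k)"
    using ex_functional[OF s] by blast
  have h_closed: "h f \<in> carrier K" if "f \<in> carrier F" for f using h that by (auto simp: hom_def)
  have h_add: "h (f + g) = h f \<oplus>\<^bsub>K\<^esub> h g" if "f \<in> carrier F" "g \<in> carrier F" for f g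
    using h that by (auto simp: hom_def F_mult)
  have F_zero: "0 \<in> carrier F" by (simp add: F_carrier)
  have h_zero: "h 0 = \<zero>\<^bsub>K\<^esub>"
    using h_add[OF F_zero F_zero] h_closed[OF F_zero] K.add.l_cancel_one' by simp
  have h_diff: "h (f - g) = h f \<ominus>\<^bsub>K\<^esub> h g" if fg: "f \<in> carrier F" "g \<in> carrier F" for f g
  proof -
    have "h f = h (f - g) \<oplus>\<^bsub>K\<^esub> h g" using h_add[OF F_diff[OF fg] fg(2)] by simp
    then show ?thesis using h_closed[OF fg(2)] h_closed[OF F_diff[OF fg]]
      by (simp add: K.minus_eq K.a_assoc K.r_neg)
  qed
  have cancel: "a \<oplus>\<^bsub>K\<^esub> c \<ominus>\<^bsub>K\<^esub> a \<ominus>\<^bsub>K\<^esub> c = \<zero>\<^bsub>K\<^esub>" if "a \<in> carrier K" "c \<in> carrier K" for a c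
  proof -
    have "a \<oplus>\<^bsub>K\<^esub> c \<ominus>\<^bsub>K\<^esub> a \<ominus>\<^bsub>K\<^esub> c = (a \<oplus>\<^bsub>K\<^esub> c) \<oplus>\<^bsub>K\<^esub> (\<ominus>\<^bsub>K\<^esub> a \<oplus>\<^bsub>K\<^esub> \<ominus>\<^bsub>K\<^esub> c)"
      using that by (simp add: K.minus_eq K.a_assoc)
    also have "\<dots> = (a \<oplus>\<^bsub>K\<^esub> c) \<oplus>\<^bsub>K\<^esub> \<ominus>\<^bsub>K\<^esub> (a \<oplus>\<^bsub>K\<^esub> c)" using that by (simp add: K.minus_add)
    also have "\<dots> = \<zero>\<^bsub>K\<^esub>" using that by (intro K.r_neg) simp
    finally show ?thesis .
  qed
  have h_N: "h f = \<zero>\<^bsub>K\<^esub>" if "f \<in> N" for f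
    using that
  proof (induction rule: N_induct)
    case (rel1 x y k)
    then have "h (frag_of (x \<otimes>\<^bsub>G\<^esub> y, k) - frag_of (x, k) - frag_of (y, k))
        = ([(coord x s + coord y s)] \<cdot>\<^bsub>K\<^esub> k) \<ominus>\<^bsub>K\<^esub> ([coord x s] \<cdot>\<^bsub>K\<^esub> k) \<ominus>\<^bsub>K\<^esub> ([coord y s] \<cdot>\<^bsub>K\<^esub> k)"
      by (simp add: h_diff h_of F_diff F_of coord_mult s)
    also have "([(coord x s + coord y s)] \<cdot>\<^bsub>K\<^esub> k) = ([coord x s] \<cdot>\<^bsub>K\<^esub> k) \<oplus>\<^bsub>K\<^esub> ([coord y s] \<cdot>\<^bsub>K\<^esub> k)"
      using rel1 by (simp add: K.add.int_pow_mult)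
    finally show ?case using rel1 by (simp add: cancel)
  next
    case (rel2 x k l)
    then have "h (frag_of (x, k \<oplus>\<^bsub>K\<^esub> l) - frag_of (x, k) - frag_of (x, l))
        = ([coord x s] \<cdot>\<^bsub>K\<^esub> (k \<oplus>\<^bsub>K\<^esub> l)) \<ominus>\<^bsub>K\<^esub> ([coord x s] \<cdot>\<^bsub>K\<^esub> k) \<ominus>\<^bsub>K\<^esub> ([coord x s] \<cdot>\<^bsub>K\<^esub> l)"
      by (simp add: h_diff h_of F_diff F_of)
    also have "([coord x s] \<cdot>\<^bsub>K\<^esub> (k \<oplus>\<^bsub>K\<^esub> l)) = ([coord x s] \<cdot>\<^bsub>K\<^esub> k) \<oplus>\<^bsub>K\<^esub> ([coord x s] \<cdot>\<^bsub>K\<^esub> l)"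
      using rel2 by (simp add: K.add.int_pow_distrib)
    finally show ?case using rel2 by (simp add: cancel)
  next
    case (minus f)
    then show ?case using h_diff[OF F_zero, of f] h_zero by (simp add: K.minus_eq)
  qed (simp_all add: h_zero h_add N_carrier)
  define \<psi> where "\<psi> U = h (SOME f. f \<in> U)" for U
  have \<psi>_q: "\<psi> (q f) = h f" if f: "f \<in> carrier F" for f
  proof -
    have "f \<in> q f" using N_zero by (force simp: q_eq)
    then have "(SOME g. g \<in> q f) \<in> q f" by (rule someI)
    then obtain g where "g \<in> N" "(SOME g. g \<in> q f) = g + f" by (auto simp: q_eq)
    then show ?thesis using f h_closed[OF f] by (simp add: \<psi>_def h_add N_carrier h_N)
  qed
  have h_ext: "h (ext k f) = k \<otimes>\<^bsub>K\<^esub> h f" if "f \<in> carrier F" "k \<in> carrier K" for f k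
    using that
  proof (induction rule: F_induct)
    case (of x l)
    then show ?case by (simp add: ext_of h_of K.add_pow_rdistr_int)
  next
    case (diff f g)
    then show ?case
      using h_closed by (simp add: ext_diff h_diff ext_carrier K.minus_eq K.r_distr K.r_minus)
  qed (simp add: ext_zero h_zero)
  have "coordinate_map s \<psi>"
    unfolding coordinate_map_def
  proof (intro conjI ballI)
    show "\<psi> \<in> carrier M \<rightarrow> carrier K" using h_closed by (auto simp: M_carrier \<psi>_q)
    show "\<psi> (U \<oplus>\<^bsub>M\<^esub> V) = \<psi> U \<oplus>\<^bsub>K\<^esub> \<psi> V" if "U \<in> carrier M" "V \<in> carrier M" for U V
      using that by (auto simp: M_carrier M_add \<psi>_q F_add h_add)
    show "\<psi> (k \<odot>\<^bsub>M\<^esub> U) = k \<otimes>\<^bsub>K\<^esub> \<psi> U" if "k \<in> carrier K" "U \<in> carrier M" for k U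
      using that by (auto simp: M_carrier M_smult \<psi>_q ext_carrier h_ext)
    show "\<psi> (v t) = (if t = s then \<one>\<^bsub>K\<^esub> else \<zero>\<^bsub>K\<^esub>)" if "t \<in> X" for t
      using that s by (simp add: v_def \<psi>_q F_of b_closed h_of coord_b add_pow_int_ge)
  qed
  then show ?thesis by blast
qed

lemma v_inj: "inj_on v X"
proof (rule inj_onI)
  fix s t assume st: "s \<in> X" "t \<in> X" "v s = v t"
  obtain \<psi> where "coordinate_map s \<psi>"
    using ex_coordinate_map[OF st(1)] by blast
  then have "\<psi> (v s) = \<one>\<^bsub>K\<^esub>" "\<psi> (v t) = (if t = s then \<one>\<^bsub>K\<^esub> else \<zero>\<^bsub>K\<^esub>)"
    using st(1,2) by (simp_all add: coordinate_map_def)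
  then have "\<one>\<^bsub>K\<^esub> = (if t = s then \<one>\<^bsub>K\<^esub> else \<zero>\<^bsub>K\<^esub>)" using st(3) by simp
  then show "s = t" using K.one_not_zero by (metis (full_types))
qed

lemma v_independent: "M.lin_indpt (v ` X)"
proof (rule M.finite_lin_indpt2)
  show "finite (v ` X)" using fin by simp
  show sub: "v ` X \<subseteq> carrier M" using v_closed by blast
  fix a assume a: "a \<in> v ` X \<rightarrow> carrier K" and zero: "M.lincomb a (v ` X) = \<zero>\<^bsub>M\<^esub>"
  show "\<forall>w\<in>v ` X. a w = \<zero>\<^bsub>K\<^esub>"
  proof clarify
    fix s assume s: "s \<in> X"
    obtain \<psi> where "coordinate_map s \<psi>"
      using ex_coordinate_map[OF s] by blast
    then have \<psi>: "\<psi> \<in> carrier M \<rightarrow> carrier K"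
      "\<And>U V. U \<in> carrier M \<Longrightarrow> V \<in> carrier M \<Longrightarrow> \<psi> (U \<oplus>\<^bsub>M\<^esub> V) = \<psi> U \<oplus>\<^bsub>K\<^esub> \<psi> V"
      "\<And>k U. k \<in> carrier K \<Longrightarrow> U \<in> carrier M \<Longrightarrow> \<psi> (k \<odot>\<^bsub>M\<^esub> U) = k \<otimes>\<^bsub>K\<^esub> \<psi> U"
      "\<And>t. t \<in> X \<Longrightarrow> \<psi> (v t) = (if t = s then \<one>\<^bsub>K\<^esub> else \<zero>\<^bsub>K\<^esub>)"
      by (simp_all add: coordinate_map_def)
    have \<psi>0: "\<psi> \<zero>\<^bsub>M\<^esub> = \<zero>\<^bsub>K\<^esub>"
    proof -
      have "\<psi> (\<zero>\<^bsub>K\<^esub> \<odot>\<^bsub>M\<^esub> \<zero>\<^bsub>M\<^esub>) = \<zero>\<^bsub>K\<^esub> \<otimes>\<^bsub>K\<^esub> \<psi> \<zero>\<^bsub>M\<^esub>" by (rule \<psi>(3)) auto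
      moreover have "\<psi> \<zero>\<^bsub>M\<^esub> \<in> carrier K" using \<psi>(1) M.M.zero_closed by blast
      ultimately show ?thesis by (simp add: M.smult_l_null)
    qed
    have aK: "a (v t) \<in> carrier K" if "t \<in> X" for t using a that by blast
    have "\<psi> (M.lincomb a (v ` Y)) = (if s \<in> Y then a (v s) else \<zero>\<^bsub>K\<^esub>)" if "finite Y" "Y \<subseteq> X" for Y
      using that
    proof (induction Y rule: finite_induct)
      case empty
      then show ?case by (simp add: M.lincomb_def \<psi>0)
    next
      case (insert t Y)
      have t: "t \<in> X" and Y: "Y \<subseteq> X" using insert.prems by auto
      have notin: "v t \<notin> v ` Y" using insert v_inj by (auto dest: inj_onD)
      have closed: "M.lincomb a (v ` Y) \<in> carrier M"
        by (rule M.lincomb_closed) (use sub a Y in blast)+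
      have "M.lincomb a (v ` insert t Y) = a (v t) \<odot>\<^bsub>M\<^esub> v t \<oplus>\<^bsub>M\<^esub> M.lincomb a (v ` Y)"
        using M.lincomb_insert[of "v ` Y" a "v t"] insert sub a t notin v_closed[OF t] by auto
      then have "\<psi> (M.lincomb a (v ` insert t Y)) = a (v t) \<otimes>\<^bsub>K\<^esub> \<psi> (v t) \<oplus>\<^bsub>K\<^esub> \<psi> (M.lincomb a (v ` Y))"
        using closed aK[OF t] v_closed[OF t] by (simp add: \<psi>(2,3))
      then show ?case using insert aK[OF t] aK[OF s] \<psi>(4)[OF t] t by auto
    qed
    from this[OF fin] show "a (v s) = \<zero>\<^bsub>K\<^esub>" using s zero \<psi>0 by simp
  qed
qed

theorem pure_tensor_basis:
  "inj_on (\<lambda>s. pure_tensor G K (b s) \<one>\<^bsub>K\<^esub>) X"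
  "M.basis ((\<lambda>s. pure_tensor G K (b s) \<one>\<^bsub>K\<^esub>) ` X)"
proof -
  have v: "(\<lambda>s. pure_tensor G K (b s) \<one>\<^bsub>K\<^esub>) = v" by (simp add: fun_eq_iff v_def q_def pure_tensor_def)
  show "inj_on (\<lambda>s. pure_tensor G K (b s) \<one>\<^bsub>K\<^esub>) X" unfolding v by (rule v_inj)
  show "M.basis ((\<lambda>s. pure_tensor G K (b s) \<one>\<^bsub>K\<^esub>) ` X)"
    unfolding v M.basis_def using v_independent v_gen v_closed by blast
qed

end


unbundle no m_inv_syntax

section \<open>Young subgroups\<close>

text \<open>The blocks are the fibres of f. Suitable labels give the row and column groups,
  stabilizers inside them (pairs as labels), the whole symmetric group (a constant label) and the
  shuffles of the Garnir relation.\<close>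

definition young :: "'s set \<Rightarrow> ('s \<Rightarrow> 'b) \<Rightarrow> ('s \<Rightarrow> 's) set"
  where "young S f = {\<pi>. \<pi> permutes S \<and> (\<forall>a\<in>S. f (\<pi> a) = f a)}"

lemma young_permutes: "\<pi> \<in> young S f \<Longrightarrow> \<pi> permutes S"
  by (simp add: young_def)

lemma young_apply: "\<pi> \<in> young S f \<Longrightarrow> a \<in> S \<Longrightarrow> f (\<pi> a) = f a"
  by (simp add: young_def)

lemma young_in: "\<pi> \<in> young S f \<Longrightarrow> a \<in> S \<Longrightarrow> \<pi> a \<in> S"
  by (simp add: young_def permutes_in_image)

lemma young_id: "id \<in> young S f"
  by (simp add: young_def permutes_id)

lemma young_comp: "\<pi> \<in> young S f \<Longrightarrow> \<sigma> \<in> young S f \<Longrightarrow> \<pi> \<circ> \<sigma> \<in> young S f"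
  by (auto simp: young_def permutes_compose permutes_in_image)

lemma young_inv: "\<pi> \<in> young S f \<Longrightarrow> inv \<pi> \<in> young S f"
proof -
  assume p: "\<pi> \<in> young S f"
  have "f (inv \<pi> a) = f a" if "a \<in> S" for a
    using young_apply[OF p, of "inv \<pi> a"] that permutes_inverses(1)[OF young_permutes[OF p]]
      permutes_in_image[OF permutes_inv[OF young_permutes[OF p]]] by simp
  then show ?thesis using permutes_inv[OF young_permutes[OF p]] by (simp add: young_def)
qed

lemma young_transpose:
  assumes "a \<in> S" "b \<in> S" "f a = f b"
  shows "transpose a b \<in> young S f"
  using assms by (auto simp: young_def permutes_swap_id transpose_def)

lemma young_mono:
  assumes "\<And>a b. a \<in> S \<Longrightarrow> b \<in> S \<Longrightarrow> f a = f b \<Longrightarrow> g a = g b"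
  shows "young S f \<subseteq> young S g"
proof
  fix \<pi> assume p: "\<pi> \<in> young S f"
  have "g (\<pi> a) = g a" if "a \<in> S" for a
    using assms[OF young_in[OF p that] that young_apply[OF p that]] .
  then show "\<pi> \<in> young S g" using young_permutes[OF p] by (simp add: young_def)
qed

lemma finite_young: "finite S \<Longrightarrow> finite (young S f)"
  by (rule finite_subset[OF _ finite_permutations]) (auto simp: young_def)

lemma inv_o_young:
  assumes "\<pi> \<in> young S f"
  shows "inv \<pi> \<circ> \<pi> = id" "\<pi> \<circ> inv \<pi> = id"
  using permutes_inv_o[OF young_permutes[OF assms]] by auto

lemma sum_young_left:
  assumes "\<sigma> \<in> young S f"
  shows "(\<Sum>\<pi>\<in>young S f. F (\<sigma> \<circ> \<pi>)) = (\<Sum>\<pi>\<in>young S f. F \<pi>)"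
  by (rule sum.reindex_bij_witness[where i = "\<lambda>\<pi>. inv \<sigma> \<circ> \<pi>" and j = "\<lambda>\<pi>. \<sigma> \<circ> \<pi>"])
    (auto simp: o_assoc assms young_comp young_inv inv_o_young[OF assms])

lemma sum_young_right:
  assumes "\<sigma> \<in> young S f"
  shows "(\<Sum>\<pi>\<in>young S f. F (\<pi> \<circ> \<sigma>)) = (\<Sum>\<pi>\<in>young S f. F \<pi>)"
  by (rule sum.reindex_bij_witness[where i = "\<lambda>\<pi>. \<pi> \<circ> inv \<sigma>" and j = "\<lambda>\<pi>. \<pi> \<circ> \<sigma>"])
    (auto simp: o_assoc[symmetric] assms young_comp young_inv inv_o_young[OF assms])

lemma sum_young_inv: "(\<Sum>\<pi>\<in>young S f. F (inv \<pi>)) = (\<Sum>\<pi>\<in>young S f. F \<pi>)"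
  by (rule sum.reindex_bij_witness[where i = inv and j = inv])
    (auto simp: young_inv permutes_inv_inv[OF young_permutes])

text \<open>A permutation of the larger set is uniquely a permutation of S followed by the
  transposition of a with the image b of a, and b must lie in the block of a.\<close>

lemma card_young_insert:
  assumes "finite S" "a \<notin> S"
  shows "card (young (insert a S) f) = card {b \<in> insert a S. f b = f a} * card (young S f)"
proof -
  let ?h = "\<lambda>(b, p). transpose a b \<circ> p" and ?X = "{b \<in> insert a S. f b = f a} \<times> young S f"
  have fix_a: "p a = a" if "p \<in> young S f" for p
    using that assms by (auto simp: young_def permutes_def)
  have "young (insert a S) f = ?h ` ?X"
  proof (intro equalityI subsetI)
    fix q assume q: "q \<in> young (insert a S) f"
    then have "q \<in> {p. p permutes (insert a S)}" by (simp add: young_def)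
    then obtain b p where bp: "q = transpose a b \<circ> p" "b \<in> insert a S" "p permutes S"
      unfolding permutes_insert by auto
    have pa: "p a = a" using bp(3) assms by (auto simp: permutes_def)
    have fb: "f b = f a" using q pa bp by (auto simp: young_def)
    have "f (p c) = f c" if "c \<in> S" for c
    proof -
      have "f (q c) = f c" using q that by (auto simp: young_def)
      then show ?thesis using bp fb by (auto simp: transpose_def split: if_splits)
    qed
    then show "q \<in> ?h ` ?X" using bp fb by (auto simp: young_def image_iff intro!: bexI[of _ "(b, p)"])
  next
    fix q assume "q \<in> ?h ` ?X"
    then obtain b p where bp: "q = transpose a b \<circ> p" "b \<in> insert a S" "f b = f a" "p \<in> young S f"
      by auto
    have "p permutes insert a S" using bp(4) by (meson permutes_imp_permutes_insert young_permutes)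
    moreover have "transpose a b permutes insert a S" using bp(2) by (intro permutes_swap_id) auto
    ultimately have "q permutes insert a S" unfolding bp(1) by (rule permutes_compose)
    moreover have "f (q c) = f c" if "c \<in> insert a S" for c
      using bp fix_a[OF bp(4)] young_apply[OF bp(4), of c] that
      by (auto simp: transpose_def)
    ultimately show "q \<in> young (insert a S) f" by (simp add: young_def)
  qed
  moreover have "inj_on ?h ?X"
  proof (rule inj_onI, clarsimp)
    fix b p b' p' assume p: "p \<in> young S f" and p': "p' \<in> young S f"
      and eq: "transpose a b \<circ> p = transpose a b' \<circ> p'"
    have "b = b'" using fun_cong[OF eq, of a] fix_a[OF p] fix_a[OF p'] by simp
    moreover have "p c = p' c" for c
      using fun_cong[OF eq, of c] \<open>b = b'\<close> by (metis comp_apply transpose_involutory)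
    ultimately have "p = p'" by auto
    then show "b = b' \<and> p = p'" using \<open>b = b'\<close> by simp
  qed
  ultimately show ?thesis by (simp add: card_image card_cartesian_product)
qed

lemma card_young:
  assumes "finite S"
  shows "card (young S f) = (\<Prod>y\<in>f ` S. fact (card {b \<in> S. f b = y}))"
  using assms
proof (induction S rule: finite_induct)
  case empty
  then show ?case by (simp add: young_def permutes_empty)
next
  case (insert a S)
  let ?n = "\<lambda>y. card {b \<in> S. f b = y}" and ?m = "\<lambda>y. card {b \<in> insert a S. f b = y}"
  have ma: "?m (f a) = Suc (?n (f a))"
  proof -
    have "{b \<in> insert a S. f b = f a} = insert a {b \<in> S. f b = f a}" by auto
    then show ?thesis using insert by simp
  qed
  have my: "?m y = ?n y" if "y \<noteq> f a" for y
    using that by (metis (mono_tags, lifting) insert_iff)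
  \<comment> \<open>If the label of a is new, its block in S is empty and contributes
    \<open>fact 0 = 1\<close>, so it may be added to the product.\<close>
  have n0: "(\<Prod>y\<in>f ` S. fact (?n y) :: nat) = (\<Prod>y\<in>insert (f a) (f ` S). fact (?n y))"
  proof (cases "f a \<in> f ` S")
    case False
    then have "{b \<in> S. f b = f a} = {}" by (metis (mono_tags, lifting) Collect_empty_eq image_eqI)
    then have "fact (?n (f a)) = (1::nat)" by (metis card.empty fact_0)
    then show ?thesis using False insert by simp
  qed (simp add: insert_absorb)
  have "(\<Prod>y\<in>f ` insert a S. fact (?m y) :: nat)
      = fact (?m (f a)) * (\<Prod>y\<in>f ` S - {f a}. fact (?m y))"
    using insert by (simp add: prod.insert_remove)
  also have "(\<Prod>y\<in>f ` S - {f a}. fact (?m y) :: nat) = (\<Prod>y\<in>f ` S - {f a}. fact (?n y))"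
    by (rule prod.cong) (use my in auto)
  also have "fact (?m (f a)) * (\<Prod>y\<in>f ` S - {f a}. fact (?n y))
      = ?m (f a) * (fact (?n (f a)) * (\<Prod>y\<in>f ` S - {f a}. fact (?n y)) :: nat)"
    unfolding ma by (simp add: algebra_simps)
  also have "fact (?n (f a)) * (\<Prod>y\<in>f ` S - {f a}. fact (?n y)) = (\<Prod>y\<in>f ` S. fact (?n y) :: nat)"
    using insert unfolding n0 by (simp add: prod.insert_remove)
  finally show ?case using insert card_young_insert[of S a f] by simp
qed

text \<open>Lagrange's theorem for a set that is only a union of left cosets: distinct cosets are
  disjoint, and each has the size of the subgroup.\<close>

lemma card_young_dvd:
  assumes S: "finite S" and A: "A \<subseteq> young S g" and closed: "\<And>\<pi> \<sigma>. \<pi> \<in> A \<Longrightarrow> \<sigma> \<in> young S f \<Longrightarrow> \<pi> \<circ> \<sigma> \<in> A"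
  shows "card (young S f) dvd card A"
proof -
  let ?c = "\<lambda>\<pi>. (\<lambda>\<sigma>. \<pi> \<circ> \<sigma>) ` young S f"
  have finA: "finite A" using A finite_young[OF S] finite_subset by blast
  have U: "A = \<Union> (?c ` A)"
  proof (intro equalityI subsetI)
    fix \<pi> assume "\<pi> \<in> A"
    moreover have "\<pi> \<in> ?c \<pi>" using imageI[OF young_id[of S f], of "\<lambda>\<sigma>. \<pi> \<circ> \<sigma>"] by simp
    ultimately show "\<pi> \<in> \<Union> (?c ` A)" by blast
  next
    fix \<pi> assume "\<pi> \<in> \<Union> (?c ` A)"
    then show "\<pi> \<in> A" using closed by blast
  qed
  have "card (young S f) dvd card (\<Union> (?c ` A))"
  proof (rule dvd_partition)
    show "finite (\<Union> (?c ` A))" using U finA by simp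
    show "\<forall>c\<in>?c ` A. card (young S f) dvd card c"
    proof safe
      fix \<pi> assume "\<pi> \<in> A"
      then have inj: "inj (\<lambda>\<sigma>. \<pi> \<circ> \<sigma>)"
        using A by (intro injI) (metis inv_o_young(1) o_assoc id_comp subsetD)
      have "card (?c \<pi>) = card (young S f)" by (rule card_image[OF inj_on_subset[OF inj subset_UNIV]])
      then show "card (young S f) dvd card (?c \<pi>)" by simp
    qed
    show "\<forall>c1\<in>?c ` A. \<forall>c2\<in>?c ` A. c1 \<noteq> c2 \<longrightarrow> c1 \<inter> c2 = {}"
    proof (intro ballI impI, rule ccontr)
      fix c1 c2 assume "c1 \<in> ?c ` A" "c2 \<in> ?c ` A" "c1 \<noteq> c2" "c1 \<inter> c2 \<noteq> {}"
      then obtain \<pi> \<pi>' \<sigma> \<sigma>' where *: "c1 = ?c \<pi>" "c2 = ?c \<pi>'" "\<pi> \<circ> \<sigma> = \<pi>' \<circ> \<sigma>'" "\<sigma> \<in> young S f" "\<sigma>' \<in> young S f"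
        by auto
      have "\<pi> = \<pi>' \<circ> (\<sigma>' \<circ> inv \<sigma>)" and "\<pi>' = \<pi> \<circ> (\<sigma> \<circ> inv \<sigma>')"
        using *(3) inv_o_young[OF *(4)] inv_o_young[OF *(5)] by (metis comp_id o_assoc)+
      moreover have "?c (\<tau> \<circ> \<upsilon>) \<subseteq> ?c \<tau>" if "\<upsilon> \<in> young S f" for \<tau> \<upsilon>
        using that by (auto simp: o_assoc[symmetric] intro!: imageI young_comp)
      ultimately have "?c \<pi> \<subseteq> ?c \<pi>'" "?c \<pi>' \<subseteq> ?c \<pi>"
        using *(4,5) by (metis young_comp young_inv)+
      then show False using \<open>c1 \<noteq> c2\<close> * by auto
    qed
  qed
  then show ?thesis using U by simp
qed

text \<open>No coset representatives are chosen. F is constant on left cosets of the smaller group,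
  so each of its level sets is a union of cosets and has size divisible by the order of that
  group.\<close>

lemma sum_young_cosets:
  fixes F :: "('s \<Rightarrow> 's) \<Rightarrow> rat"
  assumes S: "finite S" and inv: "\<And>\<pi> \<sigma>. \<pi> \<in> young S g \<Longrightarrow> \<sigma> \<in> young S f \<Longrightarrow> F (\<pi> \<circ> \<sigma>) = F \<pi>"
    and sub: "young S f \<subseteq> young S g" and int: "\<And>\<pi>. \<pi> \<in> young S g \<Longrightarrow> F \<pi> \<in> \<int>"
  shows "(\<Sum>\<pi>\<in>young S g. F \<pi>) / of_nat (card (young S f)) \<in> \<int>"
proof -
  let ?G = "young S g"
  have fin: "finite ?G" by (rule finite_young[OF S])
  have "(\<Sum>\<pi>\<in>?G. F \<pi>) = (\<Sum>v\<in>F ` ?G. \<Sum>\<pi>\<in>{\<pi>\<in>?G. F \<pi> = v}. F \<pi>)"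
    by (rule sum.group[symmetric]) (use fin in auto)
  also have "\<dots> = (\<Sum>v\<in>F ` ?G. v * of_nat (card {\<pi>\<in>?G. F \<pi> = v}))"
  proof (rule sum.cong[OF refl])
    fix v
    have "(\<Sum>\<pi>\<in>{\<pi>\<in>?G. F \<pi> = v}. F \<pi>) = (\<Sum>\<pi>\<in>{\<pi>\<in>?G. F \<pi> = v}. v)" by (rule sum.cong) auto
    then show "(\<Sum>\<pi>\<in>{\<pi>\<in>?G. F \<pi> = v}. F \<pi>) = v * of_nat (card {\<pi>\<in>?G. F \<pi> = v})"
      by (simp add: mult.commute)
  qed
  finally have "(\<Sum>\<pi>\<in>?G. F \<pi>) / of_nat (card (young S f))
      = (\<Sum>v\<in>F ` ?G. v * (of_nat (card {\<pi>\<in>?G. F \<pi> = v}) / of_nat (card (young S f))))"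
    by (simp add: sum_divide_distrib)
  also have "\<dots> \<in> \<int>"
  proof (rule Ints_sum, rule Ints_mult)
    fix v assume v: "v \<in> F ` ?G"
    show "v \<in> \<int>" using v int by auto
    have "card (young S f) dvd card {\<pi>\<in>?G. F \<pi> = v}"
    proof (rule card_young_dvd[OF S, of _ g])
      fix \<pi> \<sigma> assume "\<pi> \<in> {\<pi> \<in> ?G. F \<pi> = v}" "\<sigma> \<in> young S f"
      then have "\<pi> \<in> ?G" "F \<pi> = v" "\<sigma> \<in> young S f" "\<sigma> \<in> ?G" using sub by auto
      then show "\<pi> \<circ> \<sigma> \<in> {\<pi> \<in> ?G. F \<pi> = v}"
        using inv[of \<pi> \<sigma>] young_comp[of \<pi> S g \<sigma>] by simp
    qed auto
    then obtain q where q: "card {\<pi>\<in>?G. F \<pi> = v} = card (young S f) * q" by blast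
    show "rat_of_nat (card {\<pi>\<in>?G. F \<pi> = v}) / of_nat (card (young S f)) \<in> \<int>"
      unfolding q by (cases "card (young S f) = 0") auto
  qed
  finally show ?thesis .
qed


section \<open>Sorting within the blocks of a Young subgroup\<close>

lemma card_young_fibre:
  assumes "\<kappa> \<in> young S g"
  shows "card {a\<in>S. g a = q \<and> Q (\<kappa> a)} = card {a\<in>S. g a = q \<and> Q a}"
proof (rule bij_betw_same_card)
  have p: "\<kappa> permutes S" by (rule young_permutes[OF assms])
  show "bij_betw \<kappa> {a\<in>S. g a = q \<and> Q (\<kappa> a)} {a\<in>S. g a = q \<and> Q a}"
    unfolding bij_betw_def
  proof (intro conjI equalityI subsetI)
    show "inj_on \<kappa> {a\<in>S. g a = q \<and> Q (\<kappa> a)}" using permutes_inj_on[OF p] .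
    fix b assume "b \<in> \<kappa> ` {a\<in>S. g a = q \<and> Q (\<kappa> a)}"
    then show "b \<in> {a\<in>S. g a = q \<and> Q a}"
      using young_apply[OF assms] young_in[OF assms] by auto
  next
    fix b assume b: "b \<in> {a\<in>S. g a = q \<and> Q a}"
    then have "inv \<kappa> b \<in> {a\<in>S. g a = q \<and> Q (\<kappa> a)}"
      using young_apply[OF young_inv[OF assms]] young_in[OF young_inv[OF assms]] permutes_inverses(1)[OF p]
      by auto
    then show "b \<in> \<kappa> ` {a\<in>S. g a = q \<and> Q (\<kappa> a)}"
      using permutes_inverses(1)[OF p] by (metis imageI)
  qed
qed

text \<open>Suppose l a > l' a and count the entries \<le> l' a in the block of a. In l they all lie
  strictly before a; in l' they include a and everything before it. So the counts differ.\<close>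

lemma sorted_unique:
  fixes k k' w :: "'s \<Rightarrow> nat"
  assumes S: "finite S" and inj: "\<And>a b. a \<in> S \<Longrightarrow> b \<in> S \<Longrightarrow> g a = g b \<Longrightarrow> w a = w b \<Longrightarrow> a = b"
    and cnt: "\<And>q x. card {a\<in>S. g a = q \<and> k a \<le> x} = card {a\<in>S. g a = q \<and> k' a \<le> x}"
    and k: "\<And>a b. a \<in> S \<Longrightarrow> b \<in> S \<Longrightarrow> g a = g b \<Longrightarrow> w a < w b \<Longrightarrow> k a \<le> k b"
    and k': "\<And>a b. a \<in> S \<Longrightarrow> b \<in> S \<Longrightarrow> g a = g b \<Longrightarrow> w a < w b \<Longrightarrow> k' a \<le> k' b"
    and a: "a \<in> S"
  shows "k a = k' a"
proof -
  have *: "l a \<le> l' a" if cnt: "\<And>q x. card {a\<in>S. g a = q \<and> l a \<le> x} = card {a\<in>S. g a = q \<and> l' a \<le> x}"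
    and l: "\<And>a b. a \<in> S \<Longrightarrow> b \<in> S \<Longrightarrow> g a = g b \<Longrightarrow> w a < w b \<Longrightarrow> l a \<le> l b"
    and l': "\<And>a b. a \<in> S \<Longrightarrow> b \<in> S \<Longrightarrow> g a = g b \<Longrightarrow> w a < w b \<Longrightarrow> l' a \<le> l' b"
  for l l' :: "'s \<Rightarrow> nat"
  proof (rule ccontr)
    assume less: "\<not> l a \<le> l' a"
    have "{b\<in>S. g b = g a \<and> l b \<le> l' a} \<subseteq> {b\<in>S. g b = g a \<and> w b < w a}"
    proof clarify
      fix b assume b: "b \<in> S" "g b = g a" "l b \<le> l' a"
      show "w b < w a"
      proof (rule ccontr)
        assume "\<not> w b < w a"
        then have "l a \<le> l b" using l[OF a b(1)] b inj[OF a b(1)] by (cases "w a = w b") auto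
        then show False using b less by simp
      qed
    qed
    then have "card {b\<in>S. g b = g a \<and> l b \<le> l' a} \<le> card {b\<in>S. g b = g a \<and> w b < w a}"
      using S by (intro card_mono) auto
    also have "\<dots> < card {b\<in>S. g b = g a \<and> w b \<le> w a}"
      using S a by (intro psubset_card_mono) auto
    also have "\<dots> \<le> card {b\<in>S. g b = g a \<and> l' b \<le> l' a}"
    proof (rule card_mono)
      show "{b\<in>S. g b = g a \<and> w b \<le> w a} \<subseteq> {b\<in>S. g b = g a \<and> l' b \<le> l' a}"
      proof clarify
        fix b assume b: "b \<in> S" "g b = g a" "w b \<le> w a"
        then show "l' b \<le> l' a" using l'[OF b(1) a] inj[OF b(1) a] by (cases "w b = w a") auto
      qed
    qed (use S in auto)
    finally show False using cnt by simp
  qed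
  have "k a \<le> k' a" by (rule *) (use cnt k k' in auto)
  moreover have "k' a \<le> k a" by (rule *) (use cnt[symmetric] k k' in auto)
  ultimately show ?thesis by simp
qed

text \<open>Exchanging an inverted pair would raise the weighted sum by the product of two positive
  differences, that of the weights and that of the entries.\<close>

lemma maximal_imp_sorted:
  fixes k w :: "'s \<Rightarrow> nat"
  assumes S: "finite S" and \<kappa>: "\<kappa> \<in> young S g"
    and max: "\<And>\<sigma>. \<sigma> \<in> young S g \<Longrightarrow> (\<Sum>a\<in>S. w a * k (\<sigma> a)) \<le> (\<Sum>a\<in>S. w a * k (\<kappa> a))"
    and ab: "a \<in> S" "b \<in> S" "g a = g b" "w a < w b"
  shows "k (\<kappa> a) \<le> k (\<kappa> b)"
proof (rule ccontr)
  assume "\<not> k (\<kappa> a) \<le> k (\<kappa> b)"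
  then have less: "k (\<kappa> b) < k (\<kappa> a)" by simp
  let ?\<sigma> = "\<kappa> \<circ> transpose a b"
  have neq: "a \<noteq> b" using ab by auto
  have split: "(\<Sum>c\<in>S. F c) = F a + (F b + (\<Sum>c\<in>S - {a, b}. F c))" for F :: "'s \<Rightarrow> nat"
    using S ab neq by (simp add: sum.remove[of S a] sum.remove[of "S - {a}" b] Diff_insert2[symmetric] insert_commute)
  have "(\<Sum>c\<in>S. w c * k (?\<sigma> c)) \<le> (\<Sum>c\<in>S. w c * k (\<kappa> c))"
    by (intro max young_comp \<kappa> young_transpose) (use ab in auto)
  moreover have "(\<Sum>c\<in>S - {a, b}. w c * k (?\<sigma> c)) = (\<Sum>c\<in>S - {a, b}. w c * k (\<kappa> c))"
    by (rule sum.cong) auto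
  ultimately have le: "w a * k (\<kappa> b) + w b * k (\<kappa> a) \<le> w a * k (\<kappa> a) + w b * k (\<kappa> b)"
    unfolding split by simp
  obtain d where d: "w b = w a + d" "d > 0" using less_imp_add_positive[OF ab(4)] by metis
  obtain e where e: "k (\<kappa> a) = k (\<kappa> b) + e" "e > 0" using less_imp_add_positive[OF less] by metis
  have "d * e = 0" using le unfolding d(1) e(1) by (simp add: distrib_left distrib_right)
  then show False using d e by simp
qed

lemma ex_maximal_young:
  fixes k w :: "'s \<Rightarrow> nat"
  assumes "finite S"
  obtains \<kappa> where "\<kappa> \<in> young S g"
    "\<And>\<sigma>. \<sigma> \<in> young S g \<Longrightarrow> (\<Sum>a\<in>S. w a * k (\<sigma> a)) \<le> (\<Sum>a\<in>S. w a * k (\<kappa> a))"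
proof -
  have fin: "finite ((\<lambda>\<sigma>. \<Sum>a\<in>S. w a * k (\<sigma> a)) ` young S g)" (is "finite ?A")
    using finite_young[OF assms] by blast
  have "?A \<noteq> {}" using young_id by blast
  then have "Max ?A \<in> ?A" using fin by (rule Max_in[rotated])
  then obtain \<kappa> where \<kappa>: "\<kappa> \<in> young S g" and max: "Max ?A = (\<Sum>a\<in>S. w a * k (\<kappa> a))" by blast
  show thesis
  proof (rule that[OF \<kappa>])
    fix \<sigma> assume "\<sigma> \<in> young S g"
    then have "(\<Sum>a\<in>S. w a * k (\<sigma> a)) \<in> ?A" by (rule imageI)
    then show "(\<Sum>a\<in>S. w a * k (\<sigma> a)) \<le> (\<Sum>a\<in>S. w a * k (\<kappa> a))"
      using Max_ge[OF fin] unfolding max by blast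
  qed
qed

text \<open>A maximizer exists, is sorted and has the same block contents as k, so it agrees with k
  by uniqueness. Hence k attains the maximum, and so does no other filling of the same
  contents.\<close>

lemma sorted_maximal:
  fixes k w :: "'s \<Rightarrow> nat"
  assumes S: "finite S" and inj: "\<And>a b. a \<in> S \<Longrightarrow> b \<in> S \<Longrightarrow> g a = g b \<Longrightarrow> w a = w b \<Longrightarrow> a = b"
    and k: "\<And>a b. a \<in> S \<Longrightarrow> b \<in> S \<Longrightarrow> g a = g b \<Longrightarrow> w a < w b \<Longrightarrow> k a \<le> k b"
    and \<sigma>: "\<sigma> \<in> young S g"
  shows "(\<Sum>a\<in>S. w a * k (\<sigma> a)) \<le> (\<Sum>a\<in>S. w a * k a)"
    and "(\<Sum>a\<in>S. w a * k (\<sigma> a)) = (\<Sum>a\<in>S. w a * k a) \<Longrightarrow> a \<in> S \<Longrightarrow> k (\<sigma> a) = k a"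
proof -
  obtain \<kappa> where \<kappa>: "\<kappa> \<in> young S g"
    and max: "\<And>\<sigma>. \<sigma> \<in> young S g \<Longrightarrow> (\<Sum>a\<in>S. w a * k (\<sigma> a)) \<le> (\<Sum>a\<in>S. w a * k (\<kappa> a))"
    using ex_maximal_young[OF S] by blast
  have eq: "k (\<tau> a) = k a" if \<tau>: "\<tau> \<in> young S g"
    and mx: "\<And>\<sigma>. \<sigma> \<in> young S g \<Longrightarrow> (\<Sum>a\<in>S. w a * k (\<sigma> a)) \<le> (\<Sum>a\<in>S. w a * k (\<tau> a))"
    and a: "a \<in> S" for \<tau> a
  proof (rule sorted_unique[where k = "\<lambda>a. k (\<tau> a)" and w = w and g = g, OF S inj _ _ k a])
    show "card {a\<in>S. g a = q \<and> k (\<tau> a) \<le> x} = card {a\<in>S. g a = q \<and> k a \<le> x}" for q x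
      by (rule card_young_fibre[OF \<tau>])
    show "k (\<tau> a) \<le> k (\<tau> b)" if "a \<in> S" "b \<in> S" "g a = g b" "w a < w b" for a b
      using maximal_imp_sorted[OF S \<tau> mx that] .
  qed auto
  have Wk: "(\<Sum>a\<in>S. w a * k (\<kappa> a)) = (\<Sum>a\<in>S. w a * k a)"
    using eq[OF \<kappa> max] by simp
  show "(\<Sum>a\<in>S. w a * k (\<sigma> a)) \<le> (\<Sum>a\<in>S. w a * k a)"
    using max[OF \<sigma>] Wk by simp
  show "k (\<sigma> a) = k a" if "(\<Sum>a\<in>S. w a * k (\<sigma> a)) = (\<Sum>a\<in>S. w a * k a)" "a \<in> S"
    by (rule eq[OF \<sigma> _ that(2)]) (use max that(1) Wk in simp)
qed


section \<open>Signed actions on tensors\<close>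

text \<open>A tensor is given by its coefficients at the multiindices, and \<open>act eps \<pi>\<close> is the left action
  corresponding to the right action \<open>j * inv \<pi>\<close> on multiindices.\<close>

type_synonym 's tensor = "('s \<Rightarrow> nat) \<Rightarrow> rat"
type_synonym 's cocycle = "('s \<Rightarrow> nat) \<Rightarrow> ('s \<Rightarrow> 's) \<Rightarrow> rat"

definition act :: "'s cocycle \<Rightarrow> ('s \<Rightarrow> 's) \<Rightarrow> 's tensor \<Rightarrow> 's tensor"
  where "act eps \<pi> x = (\<lambda>k. eps k \<pi> * x (k \<circ> \<pi>))"

definition gsum :: "'s cocycle \<Rightarrow> ('s \<Rightarrow> 's) set \<Rightarrow> 's tensor \<Rightarrow> 's tensor"
  where "gsum eps G x = (\<lambda>k. \<Sum>\<pi>\<in>G. act eps \<pi> x k)"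

definition delta :: "('s \<Rightarrow> nat) \<Rightarrow> 's tensor"
  where "delta i = (\<lambda>k. if k = i then 1 else 0)"

lemma act_sum: "act eps \<pi> (\<lambda>k. \<Sum>i\<in>I. c i * x i k) = (\<lambda>k. \<Sum>i\<in>I. c i * act eps \<pi> (x i) k)"
  by (simp add: act_def sum_distrib_left mult.left_commute)

lemma act_scale: "act eps \<pi> (\<lambda>k. c * x k) = (\<lambda>k. c * act eps \<pi> x k)"
  by (simp add: act_def mult.left_commute)

lemma gsum_sum: "gsum eps G (\<lambda>k. \<Sum>i\<in>I. c i * x i k) = (\<lambda>k. \<Sum>i\<in>I. c i * gsum eps G (x i) k)"
  unfolding gsum_def act_sum sum_distrib_left by (subst sum.swap) simp

lemma gsum_scale: "gsum eps G (\<lambda>k. c * x k) = (\<lambda>k. c * gsum eps G x k)"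
  by (simp add: gsum_def act_scale sum_distrib_left)

text \<open>\<open>eps\<close> is the sign of permuting the entries of a multiindex; its cocycle law
  makes \<open>act\<close> a left action. \<open>Bos\<close> singles out the symbols whose copies
  commute; copies of any other symbol anticommute.\<close>

locale signed_action =
  fixes S :: "'s set" and eps :: "'s cocycle" and Bos :: "nat \<Rightarrow> bool"
  assumes fin: "finite S"
    and eps_sq: "\<pi> permutes S \<Longrightarrow> eps k \<pi> * eps k \<pi> = 1"
    and eps_comp: "\<pi> permutes S \<Longrightarrow> \<sigma> permutes S \<Longrightarrow> eps k (\<pi> \<circ> \<sigma>) = eps k \<pi> * eps (k \<circ> \<pi>) \<sigma>"
    and eps_transpose: "a \<in> S \<Longrightarrow> b \<in> S \<Longrightarrow> a \<noteq> b \<Longrightarrow> k a = k b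
      \<Longrightarrow> eps k (transpose a b) = (if Bos (k a) then 1 else - 1)"
begin

text \<open>The Pauli principle: tensors invariant under \<open>young S g\<close> vanish at all
  other multiindices (\<open>invariant_noferm\<close>).\<close>

definition noferm :: "('s \<Rightarrow> 'b) \<Rightarrow> ('s \<Rightarrow> nat) \<Rightarrow> bool"
  where "noferm g k \<longleftrightarrow> (\<forall>a\<in>S. \<forall>b\<in>S. a \<noteq> b \<and> g a = g b \<and> k a = k b \<longrightarrow> Bos (k a))"

text \<open>The divisor is the order of the stabilizer of i. It leaves coefficients 0, 1 and -1 if
  \<open>noferm g i\<close> holds; otherwise the sum itself vanishes.\<close>

definition osum :: "('s \<Rightarrow> 'b) \<Rightarrow> ('s \<Rightarrow> nat) \<Rightarrow> 's tensor"
  where "osum g i = (\<lambda>k. gsum eps (young S g) (delta i) k / of_nat (card (young S (\<lambda>a. (g a, i a)))))"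

lemma eps_cases: "\<pi> permutes S \<Longrightarrow> eps k \<pi> = 1 \<or> eps k \<pi> = - 1"
  using eps_sq[of \<pi> k] by (simp add: square_eq_1_iff)

lemma eps_id: "eps k id = 1"
  using eps_sq[OF permutes_id, of k] eps_comp[OF permutes_id permutes_id, of k] by simp

lemma act_comp: "\<pi> permutes S \<Longrightarrow> \<sigma> permutes S \<Longrightarrow> act eps (\<pi> \<circ> \<sigma>) x = act eps \<pi> (act eps \<sigma> x)"
  by (simp add: act_def eps_comp o_assoc mult.assoc)

lemma act_id: "act eps id x = x"
  by (simp add: act_def eps_id)

lemma act_delta:
  assumes "\<pi> permutes S"
  shows "act eps \<pi> (delta (i \<circ> \<pi>)) = (\<lambda>k. eps i \<pi> * delta i k)"
proof -
  have "k \<circ> \<pi> = i \<circ> \<pi> \<longleftrightarrow> k = i" for k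
    using permutes_surj[OF assms] by (metis comp_surj surj_fun_eq)
  then show ?thesis by (intro ext) (simp add: act_def delta_def)
qed

text \<open>Induction on the number of moved points: splitting off the transposition of a with
  \<open>\<pi> a\<close>, where k has the same entry, leaves a stabilizing permutation that also
  fixes a.\<close>

lemma eps_stab:
  assumes "\<pi> permutes S" "k \<circ> \<pi> = k" "\<And>a. a \<in> S \<Longrightarrow> \<pi> a \<noteq> a \<Longrightarrow> Bos (k a)"
  shows "eps k \<pi> = 1"
  using assms
proof (induction "card {a\<in>S. \<pi> a \<noteq> a}" arbitrary: \<pi> rule: less_induct)
  case less
  show ?case
  proof (cases "\<exists>a\<in>S. \<pi> a \<noteq> a")
    case False
    then have "\<pi> = id" using less.prems(1) by (intro ext) (metis id_apply permutes_not_in)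
    then show ?thesis by (simp add: eps_id)
  next
    case True
    then obtain a where a: "a \<in> S" "\<pi> a \<noteq> a" by blast
    let ?b = "\<pi> a"
    let ?t = "transpose a ?b"
    let ?\<sigma> = "?t \<circ> \<pi>"
    have b: "?b \<in> S" using a less.prems(1) by (simp add: permutes_in_image)
    have kb: "k ?b = k a" using less.prems(2) by (metis comp_apply)
    have inj: "\<pi> x = \<pi> y \<longleftrightarrow> x = y" for x y using permutes_inj[OF less.prems(1)] by (auto dest: injD)
    have kt: "k \<circ> ?t = k" using kb by (auto simp: fun_eq_iff transpose_def)
    have t: "?t permutes S" by (rule permutes_swap_id[OF a(1) b])
    have \<sigma>: "?\<sigma> permutes S" by (rule permutes_compose[OF less.prems(1) t])
    have moved: "\<pi> c \<noteq> c \<and> c \<noteq> a" if "?\<sigma> c \<noteq> c" for c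
      using that a inj[of c a] inj[of a ?b] by (auto simp: transpose_def split: if_splits)
    have "{c\<in>S. ?\<sigma> c \<noteq> c} \<subset> {c\<in>S. \<pi> c \<noteq> c}" using moved a by auto
    then have "card {c\<in>S. ?\<sigma> c \<noteq> c} < card {c\<in>S. \<pi> c \<noteq> c}" using fin by (intro psubset_card_mono) auto
    moreover have "k \<circ> ?\<sigma> = k" using kt less.prems(2) by (simp add: o_assoc)
    ultimately have "eps k ?\<sigma> = 1"
      using less.hyps \<sigma> moved less.prems(3) by blast
    moreover have "\<pi> = ?t \<circ> ?\<sigma>" by (simp add: o_assoc)
    moreover have "eps k ?t = 1" using eps_transpose[OF a(1) b] a kb less.prems(3) by simp
    ultimately show ?thesis using eps_comp[OF t \<sigma>, of k] kt by simp
  qed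
qed

lemma act_gsum: "act eps \<pi> (gsum eps G x) = (\<lambda>k. \<Sum>\<sigma>\<in>G. act eps \<pi> (act eps \<sigma> x) k)"
  by (simp add: gsum_def act_def sum_distrib_left)

lemma act_gsum_young:
  assumes "\<sigma> \<in> young S g"
  shows "act eps \<sigma> (gsum eps (young S g) x) = gsum eps (young S g) x"
proof
  fix k
  have "act eps \<sigma> (gsum eps (young S g) x) k = (\<Sum>\<pi>\<in>young S g. act eps (\<sigma> \<circ> \<pi>) x k)"
    unfolding act_gsum by (rule sum.cong) (auto simp: act_comp young_permutes[OF assms] young_permutes)
  also have "\<dots> = gsum eps (young S g) x k" unfolding gsum_def by (rule sum_young_left[OF assms])
  finally show "act eps \<sigma> (gsum eps (young S g) x) k = gsum eps (young S g) x k" .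
qed

lemma gsum_act_young:
  assumes "\<sigma> \<in> young S g"
  shows "gsum eps (young S g) (act eps \<sigma> x) = gsum eps (young S g) x"
proof
  fix k
  have "gsum eps (young S g) (act eps \<sigma> x) k = (\<Sum>\<pi>\<in>young S g. act eps (\<pi> \<circ> \<sigma>) x k)"
    unfolding gsum_def by (rule sum.cong) (auto simp: act_comp young_permutes[OF assms] young_permutes)
  also have "\<dots> = gsum eps (young S g) x k" unfolding gsum_def by (rule sum_young_right[OF assms])
  finally show "gsum eps (young S g) (act eps \<sigma> x) k = gsum eps (young S g) x k" .
qed

lemma act_osum: "\<sigma> \<in> young S g \<Longrightarrow> act eps \<sigma> (osum g i) = osum g i"
  using act_gsum_young[of \<sigma> g "delta i"] by (simp add: osum_def act_def fun_eq_iff)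

lemma gsum_delta_support:
  assumes "gsum eps (young S g) (delta i) k \<noteq> 0"
  shows "\<exists>\<pi>\<in>young S g. k \<circ> \<pi> = i"
proof (rule ccontr)
  assume "\<not> ?thesis"
  then have "act eps \<pi> (delta i) k = 0" if "\<pi> \<in> young S g" for \<pi> using that by (auto simp: act_def delta_def)
  then show False using assms by (simp add: gsum_def)
qed

text \<open>Exchanging two equal anticommuting entries of one block fixes k but negates the
  coefficient.\<close>

lemma invariant_noferm:
  assumes inv: "\<And>\<sigma>. \<sigma> \<in> young S g \<Longrightarrow> act eps \<sigma> x = x" and "\<not> noferm g k"
  shows "x k = 0"
proof -
  obtain a b where ab: "a \<in> S" "b \<in> S" "a \<noteq> b" "g a = g b" "k a = k b" "\<not> Bos (k a)"
    using assms(2) by (auto simp: noferm_def)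
  have "k \<circ> transpose a b = k" using ab by (auto simp: fun_eq_iff transpose_def)
  moreover have "act eps (transpose a b) x k = x k" using inv[OF young_transpose] ab by metis
  ultimately show ?thesis using eps_transpose[of a b k] ab by (simp add: act_def)
qed

lemma invariant_orbit:
  assumes "\<And>\<sigma>. \<sigma> \<in> young S g \<Longrightarrow> act eps \<sigma> x = x" and "\<pi> \<in> young S g"
  shows "x k = eps k \<pi> * x (k \<circ> \<pi>)"
  using assms(1)[OF assms(2)] by (metis act_def)

text \<open>Invariance would carry a nonzero coefficient along the orbit to i itself, where it has
  to vanish.\<close>

lemma gsum_delta_ferm:
  assumes "\<not> noferm g i"
  shows "gsum eps (young S g) (delta i) k = 0"
proof (rule ccontr)
  assume "gsum eps (young S g) (delta i) k \<noteq> 0"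
  moreover obtain \<pi> where "\<pi> \<in> young S g" "k \<circ> \<pi> = i" using gsum_delta_support[OF calculation] by blast
  ultimately show False
    using invariant_orbit[of g "gsum eps (young S g) (delta i)" \<pi> k] act_gsum_young
      invariant_noferm[of g "gsum eps (young S g) (delta i)" i] assms by auto
qed

lemma stab_young: "{\<pi> \<in> young S g. i \<circ> \<pi> = i} = young S (\<lambda>a. (g a, i a))"
proof (intro equalityI subsetI)
  fix \<pi> assume "\<pi> \<in> young S (\<lambda>a. (g a, i a))"
  then have p: "\<pi> permutes S" "\<forall>a\<in>S. g (\<pi> a) = g a \<and> i (\<pi> a) = i a" by (auto simp: young_def)
  then have "i \<circ> \<pi> = i" by (intro ext) (metis comp_apply permutes_not_in)
  then show "\<pi> \<in> {\<pi> \<in> young S g. i \<circ> \<pi> = i}" using p by (auto simp: young_def)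
next
  fix \<pi> assume "\<pi> \<in> {\<pi> \<in> young S g. i \<circ> \<pi> = i}"
  then show "\<pi> \<in> young S (\<lambda>a. (g a, i a))" by (auto simp: young_def fun_eq_iff)
qed

lemma eps_stab_young:
  assumes "noferm g i" "\<pi> \<in> young S (\<lambda>a. (g a, i a))"
  shows "eps i \<pi> = 1"
proof (rule eps_stab)
  have \<pi>: "\<pi> \<in> young S g" "i \<circ> \<pi> = i" using assms(2) stab_young by blast+
  show "\<pi> permutes S" "i \<circ> \<pi> = i" using \<pi> young_permutes by blast+
  fix a assume "a \<in> S" "\<pi> a \<noteq> a"
  then show "Bos (i a)"
    using assms(1) young_in[OF assms(2), of a] young_apply[OF assms(2), of a] unfolding noferm_def
    by (metis prod.inject)
qed

lemma osum_self:
  assumes "noferm g i"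
  shows "osum g i i = 1"
proof -
  have "gsum eps (young S g) (delta i) i = (\<Sum>\<pi>\<in>{\<pi> \<in> young S g. i \<circ> \<pi> = i}. eps i \<pi>)"
    unfolding gsum_def act_def delta_def
    by (rule sum.mono_neutral_cong_right) (auto simp: finite_young[OF fin])
  also have "\<dots> = of_nat (card (young S (\<lambda>a. (g a, i a))))"
    unfolding stab_young using eps_stab_young[OF assms] by simp
  finally show ?thesis
    using finite_young[OF fin] young_id[of S "\<lambda>a. (g a, i a)"] by (auto simp: osum_def card_eq_0_iff)
qed

lemma osum_support: "osum g i k \<noteq> 0 \<Longrightarrow> \<exists>\<pi>\<in>young S g. k \<circ> \<pi> = i"
  by (rule gsum_delta_support) (auto simp: osum_def)

lemma osum_orbit: "noferm g i \<Longrightarrow> \<pi> \<in> young S g \<Longrightarrow> k \<circ> \<pi> = i \<Longrightarrow> osum g i k = eps k \<pi>"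
  using invariant_orbit[of g "osum g i" \<pi> k, OF act_osum] osum_self[of g i] by simp

lemma osum_Ints:
  assumes "noferm g i"
  shows "osum g i k \<in> \<int>"
proof (cases "osum g i k = 0")
  case False
  then obtain \<pi> where "\<pi> \<in> young S g" "k \<circ> \<pi> = i" using osum_support by blast
  then show ?thesis using osum_orbit[OF assms] eps_cases[OF young_permutes] by (metis Ints_1 Ints_minus)
qed simp

end


section \<open>Straightening\<close>

definition sst :: "(nat \<Rightarrow> bool) \<Rightarrow> 's set \<Rightarrow> ('s \<Rightarrow> nat) \<Rightarrow> ('s \<Rightarrow> nat) \<Rightarrow> ('s \<Rightarrow> nat) \<Rightarrow> bool"
  where "sst Bos S row col k \<longleftrightarrow>
    (\<forall>a\<in>S. \<forall>b\<in>S. col a = col b \<and> row a < row b \<longrightarrow> k a \<le> k b \<and> (k a = k b \<longrightarrow> \<not> Bos (k a))) \<and>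
    (\<forall>a\<in>S. \<forall>b\<in>S. row a = row b \<and> col a < col b \<longrightarrow> k a \<le> k b \<and> (k a = k b \<longrightarrow> Bos (k a)))"

lemma sst_dual: "sst (\<lambda>x. \<not> Bos x) S col row k \<longleftrightarrow> sst Bos S row col k"
  by (auto simp: sst_def)

text \<open>With \<open>Bos\<close> as evenness this is r(T_i); with columns in place of rows and
  \<open>Bos\<close> negated it is c(T_j).\<close>

definition rfac :: "(nat \<Rightarrow> bool) \<Rightarrow> 's set \<Rightarrow> nat \<Rightarrow> ('s \<Rightarrow> nat) \<Rightarrow> ('s \<Rightarrow> nat) \<Rightarrow> nat"
  where "rfac Bos S N row k =
    (\<Prod>x\<in>{x\<in>{1..N}. Bos x}. \<Prod>q\<in>row ` S. fact (card {a\<in>S. row a = q \<and> k a = x}))"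

definition xi :: "'s cocycle \<Rightarrow> (nat \<Rightarrow> bool) \<Rightarrow> 's set \<Rightarrow> nat \<Rightarrow> ('s \<Rightarrow> nat) \<Rightarrow> ('s \<Rightarrow> nat) \<Rightarrow> 's tensor"
  where "xi eps Bos S N row i = (\<lambda>k. gsum eps (young S row) (delta i) k / of_nat (rfac Bos S N row i))"

lemma PiE_comp_permutes:
  assumes "\<pi> permutes S"
  shows "k \<circ> \<pi> \<in> S \<rightarrow>\<^sub>E A \<longleftrightarrow> k \<in> S \<rightarrow>\<^sub>E A"
proof -
  have *: "l \<circ> \<sigma> \<in> S \<rightarrow>\<^sub>E A" if "\<sigma> permutes S" "l \<in> S \<rightarrow>\<^sub>E A" for l \<sigma>
    using that by (auto simp: PiE_iff permutes_in_image extensional_def permutes_def)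
  have "k = (k \<circ> \<pi>) \<circ> inv \<pi>" using permutes_inv_o(1)[OF assms] by (simp add: o_assoc[symmetric])
  then show ?thesis using *[OF assms] *[OF permutes_inv[OF assms], of "k \<circ> \<pi>"] by metis
qed

context signed_action
begin

text \<open>The stabilizer is a product of symmetric groups, one for each row and symbol. Symbols
  outside \<open>Bos\<close> occur at most once in a row and contribute 1, which leaves the factors
  in \<open>rfac\<close>.\<close>

lemma rfac_eq_card_stab:
  assumes "i \<in> S \<rightarrow>\<^sub>E {1..N}" "noferm row i"
  shows "rfac Bos S N row i = card (young S (\<lambda>a. (row a, i a)))"
proof -
  let ?c = "\<lambda>q x. card {b \<in> S. row b = q \<and> i b = x}"
  have "card (young S (\<lambda>a. (row a, i a)))
      = (\<Prod>y\<in>(\<lambda>a. (row a, i a)) ` S. fact (card {b \<in> S. (row b, i b) = y}))"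
    by (rule card_young[OF fin])
  also have "\<dots> = (\<Prod>y\<in>row ` S \<times> {1..N}. fact (card {b \<in> S. (row b, i b) = y}))"
  proof (rule prod.mono_neutral_left)
    show "(\<lambda>a. (row a, i a)) ` S \<subseteq> row ` S \<times> {1..N}" using assms(1) by auto
    show "\<forall>y\<in>row ` S \<times> {1..N} - (\<lambda>a. (row a, i a)) ` S. fact (card {b \<in> S. (row b, i b) = y}) = (1::nat)"
    proof
      fix y assume "y \<in> row ` S \<times> {1..N} - (\<lambda>a. (row a, i a)) ` S"
      then have "{b \<in> S. (row b, i b) = y} = {}" by blast
      then show "fact (card {b \<in> S. (row b, i b) = y}) = (1::nat)" by (metis card.empty fact_0)
    qed
  qed (use fin in auto)
  also have "\<dots> = (\<Prod>q\<in>row ` S. \<Prod>x\<in>{1..N}. fact (?c q x))"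
    by (simp add: prod.cartesian_product case_prod_beta prod_eq_iff)
  also have "\<dots> = (\<Prod>q\<in>row ` S. \<Prod>x\<in>{x\<in>{1..N}. Bos x}. fact (?c q x))"
  proof (rule prod.cong[OF refl], rule prod.mono_neutral_right)
    fix q
    show "\<forall>x\<in>{1..N} - {x \<in> {1..N}. Bos x}. fact (?c q x) = (1::nat)"
    proof
      fix x assume "x \<in> {1..N} - {x \<in> {1..N}. Bos x}"
      then have "\<forall>a\<in>{b \<in> S. row b = q \<and> i b = x}. \<forall>b\<in>{b \<in> S. row b = q \<and> i b = x}. a = b"
        using assms(2) by (auto simp: noferm_def)
      then have "?c q x \<le> 1" using fin by (simp add: card_le_Suc0_iff_eq)
      then show "fact (?c q x) = (1::nat)" by (cases "?c q x = 0") (auto simp: le_Suc_eq)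
    qed
  qed auto
  also have "\<dots> = rfac Bos S N row i" unfolding rfac_def by (rule prod.swap)
  finally show ?thesis by simp
qed

lemma xi_eq_osum:
  "i \<in> S \<rightarrow>\<^sub>E {1..N} \<Longrightarrow> noferm row i \<Longrightarrow> xi eps Bos S N row i = osum row i"
  by (simp add: xi_def osum_def rfac_eq_card_stab)

lemma xi_ferm: "\<not> noferm row i \<Longrightarrow> xi eps Bos S N row i = (\<lambda>_. 0)"
  by (simp add: xi_def gsum_delta_ferm)

lemma act_xi: "\<sigma> \<in> young S row \<Longrightarrow> act eps \<sigma> (xi eps Bos S N row i) = xi eps Bos S N row i"
  using act_gsum_young[of \<sigma> row "delta i"] by (simp add: xi_def act_def fun_eq_iff)

lemma xi_support: "xi eps Bos S N row i k \<noteq> 0 \<Longrightarrow> \<exists>\<pi>\<in>young S row. k \<circ> \<pi> = i"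
  by (rule gsum_delta_support) (auto simp: xi_def)

text \<open>Up to sign only the row orbit of i matters; this reduces straightening to row-sorted
  multiindices.\<close>

lemma xi_comp:
  assumes "\<rho> \<in> young S row"
  shows "xi eps Bos S N row (i \<circ> \<rho>) k = eps i \<rho> * xi eps Bos S N row i k"
proof -
  have "act eps \<rho> (delta (i \<circ> \<rho>)) = (\<lambda>k. eps i \<rho> * delta i k)"
    by (rule act_delta[OF young_permutes[OF assms]])
  then have "gsum eps (young S row) (delta (i \<circ> \<rho>)) = (\<lambda>k. eps i \<rho> * gsum eps (young S row) (delta i) k)"
    using gsum_act_young[OF assms, of "delta (i \<circ> \<rho>)"] by (simp add: gsum_scale)
  moreover have "rfac Bos S N row (i \<circ> \<rho>) = rfac Bos S N row i"
    unfolding rfac_def comp_apply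
    by (intro prod.cong refl arg_cong[where f = fact] card_young_fibre[OF assms, where Q = "\<lambda>a. i a = _"])
  ultimately show ?thesis by (simp add: xi_def)
qed

end

text \<open>Positions rather than boxes form the index set. \<open>down\<close> expresses that the
  shape is the diagram of a partition: with a box it contains every box weakly above and to the
  left.\<close>

locale tableau_action =
  I: signed_action S eps Bos + J: signed_action S eps' "\<lambda>x. \<not> Bos x"
  for S :: "'s set" and eps eps' :: "'s cocycle" and Bos :: "nat \<Rightarrow> bool" +
  fixes row col :: "'s \<Rightarrow> nat" and N :: nat
  assumes eps': "\<pi> permutes S \<Longrightarrow> eps' k \<pi> = of_int (sign \<pi>) * eps k \<pi>"
    and inj: "a \<in> S \<Longrightarrow> b \<in> S \<Longrightarrow> row a = row b \<Longrightarrow> col a = col b \<Longrightarrow> a = b"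
    and down: "a \<in> S \<Longrightarrow> 1 \<le> q \<Longrightarrow> q \<le> row a \<Longrightarrow> 1 \<le> d \<Longrightarrow> d \<le> col a \<Longrightarrow> \<exists>b\<in>S. row b = q \<and> col b = d"
    and pos: "a \<in> S \<Longrightarrow> 1 \<le> row a" "a \<in> S \<Longrightarrow> 1 \<le> col a"
begin

abbreviation "Rg \<equiv> young S row"
abbreviation "Cg \<equiv> young S col"
abbreviation "MI \<equiv> S \<rightarrow>\<^sub>E {1..N}"
abbreviation "Xi \<equiv> xi eps Bos S N row"
abbreviation "CM \<equiv> gsum eps' Cg"

section \<open>Row-sorted and semistandard multiindices and their weight\<close>

definition SST where "SST = {k \<in> MI. sst Bos S row col k}"

definition rsorted where
  "rsorted k \<longleftrightarrow> (\<forall>a\<in>S. \<forall>b\<in>S. row a = row b \<and> col a < col b \<longrightarrow> k a \<le> (k b :: nat))"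

text \<open>Large entries far down make the weight large. It is constant on row orbits, grows along
  the Garnir relation, and is maximal at a semistandard filling among its column
  rearrangements.\<close>

definition wt where "wt k = (\<Sum>a\<in>S. row a * (k a :: nat))"

lemma finite_MI: "finite MI"
  by (intro finite_PiE I.fin) auto

lemma finite_SST: "finite SST"
  using finite_MI by (auto simp: SST_def)

lemma SST_MI: "k \<in> SST \<Longrightarrow> k \<in> MI"
  by (simp add: SST_def)

lemma SST_col:
  "k \<in> SST \<Longrightarrow> a \<in> S \<Longrightarrow> b \<in> S \<Longrightarrow> col a = col b \<Longrightarrow> row a < row b
    \<Longrightarrow> k a \<le> k b \<and> (k a = k b \<longrightarrow> \<not> Bos (k a))"
  by (simp add: SST_def sst_def)

lemma SST_row:
  "k \<in> SST \<Longrightarrow> a \<in> S \<Longrightarrow> b \<in> S \<Longrightarrow> row a = row b \<Longrightarrow> col a < col b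
    \<Longrightarrow> k a \<le> k b \<and> (k a = k b \<longrightarrow> Bos (k a))"
  by (simp add: SST_def sst_def)

lemma SST_rsorted: "k \<in> SST \<Longrightarrow> rsorted k"
  by (auto simp: SST_def sst_def rsorted_def)

lemma SST_noferm:
  assumes "k \<in> SST"
  shows "I.noferm row k"
  unfolding I.noferm_def
proof (intro ballI impI)
  fix a b assume ab: "a \<in> S" "b \<in> S" "a \<noteq> b \<and> row a = row b \<and> k a = k b"
  then consider "col a < col b" | "col b < col a" using inj[of a b] by force
  then show "Bos (k a)"
  proof cases
    case 1 then show ?thesis using ab SST_row[OF assms, of a b] by simp
  next
    case 2 then show ?thesis using ab SST_row[OF assms, of b a] by simp
  qed
qed

lemma wt_young: "\<rho> \<in> Rg \<Longrightarrow> wt (k \<circ> \<rho>) = wt k"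
  unfolding wt_def
  by (subst (2) sum.permute[OF young_permutes]) (auto simp: young_apply intro!: sum.cong)

lemma card_permutes: "h permutes S \<Longrightarrow> card {b\<in>S. Q (h b)} = card {b\<in>S. Q b}"
  using card_young_fibre[of h S "\<lambda>_. ()" "()" Q] by (simp add: young_def)

lemma rsorted_unique:
  assumes "rsorted k" "rsorted k'" "k \<in> MI" "k' \<in> MI"
    and cnt: "\<And>q x. card {a\<in>S. row a = q \<and> k a \<le> x} = card {a\<in>S. row a = q \<and> k' a \<le> x}"
  shows "k = k'"
proof (rule PiE_ext[OF assms(3,4)])
  fix a assume "a \<in> S"
  show "k a = k' a"
    by (rule sorted_unique[where g = row and w = col, OF I.fin inj cnt _ _ \<open>a \<in> S\<close>])
      (use assms(1,2) in \<open>auto simp: rsorted_def\<close>)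
qed

lemma rsorted_orbit_unique:
  assumes "rsorted k" "rsorted (k \<circ> \<rho>)" "k \<in> MI" "\<rho> \<in> Rg"
  shows "k \<circ> \<rho> = k"
proof (rule rsorted_unique[OF assms(2,1) _ assms(3)])
  show "k \<circ> \<rho> \<in> MI" unfolding PiE_comp_permutes[OF young_permutes[OF assms(4)]] by (rule assms(3))
  show "card {a\<in>S. row a = q \<and> (k \<circ> \<rho>) a \<le> x} = card {a\<in>S. row a = q \<and> k a \<le> x}" for q x
    using card_young_fibre[OF assms(4), where Q = "\<lambda>a. k a \<le> x"] by simp
qed

lemma ex_rsorted:
  obtains \<rho> where "\<rho> \<in> Rg" "rsorted (k \<circ> \<rho>)"
proof -
  obtain \<rho> where \<rho>: "\<rho> \<in> Rg"
    and max: "\<And>\<sigma>. \<sigma> \<in> Rg \<Longrightarrow> (\<Sum>a\<in>S. col a * k (\<sigma> a)) \<le> (\<Sum>a\<in>S. col a * k (\<rho> a))"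
    using ex_maximal_young[OF I.fin] by blast
  have "rsorted (k \<circ> \<rho>)"
    using maximal_imp_sorted[OF I.fin \<rho> max] by (auto simp: rsorted_def)
  then show thesis using that \<rho> by blast
qed

section \<open>The Garnir relation\<close>

lemma CM_kill:
  assumes ab: "a \<in> S" "b \<in> S" "a \<noteq> b" "col a = col b" and fix_x: "act eps (transpose a b) x = x"
  shows "CM x = (\<lambda>_. 0)"
proof -
  have t: "transpose a b permutes S" by (rule permutes_swap_id[OF ab(1,2)])
  \<comment> \<open>Under the sign-twisted action the transposition negates x; absorbing it into the
    column sum then gives \<open>CM x = - CM x\<close>.\<close>
  have "act eps' (transpose a b) x = (\<lambda>k. - 1 * x k)"
    using eps'[OF t] fix_x ab(3) by (auto simp: act_def fun_eq_iff sign_swap_id)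
  then have "CM x = CM (\<lambda>k. - 1 * x k)"
    using J.gsum_act_young[OF young_transpose, OF ab(1,2,4), of x] by metis
  also have "\<dots> = (\<lambda>k. - 1 * CM x k)" by (rule gsum_scale)
  finally show ?thesis by (auto simp: fun_eq_iff)
qed

text \<open>As i is row-sorted, \<open>?A\<close> contains all boxes from a0 rightwards and
  \<open>?B\<close> all boxes up to b0. Together they outnumber the columns of the row of a0, and
  \<open>\<rho>\<close> moves them within their rows, the lower of which is no longer than the
  upper.\<close>

lemma pigeonhole:
  assumes i: "rsorted i" and ab: "a0 \<in> S" "b0 \<in> S" "col a0 = col b0" "row b0 = Suc (row a0)" and \<rho>: "\<rho> \<in> Rg"
  obtains x y where "x \<in> S" "y \<in> S" "row x = row a0" "row y = Suc (row a0)" "i a0 \<le> i x" "i y \<le> i b0"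
    "col (\<rho> x) = col (\<rho> y)"
proof (rule ccontr)
  assume no: "\<not> thesis"
  let ?A = "{a\<in>S. row a = row a0 \<and> i a0 \<le> i a}" and ?B = "{a\<in>S. row a = Suc (row a0) \<and> i a \<le> i b0}"
  let ?L = "col ` {a\<in>S. row a = row a0}" and ?f = "\<lambda>a. col (\<rho> a)" and ?d = "col a0"
  have finL: "finite ?L" using I.fin by simp
  have inj_f: "inj_on ?f {a\<in>S. row a = q}" for q
  proof (rule inj_onI)
    fix x y assume xy: "x \<in> {a\<in>S. row a = q}" "y \<in> {a\<in>S. row a = q}" "?f x = ?f y"
    then have "\<rho> x = \<rho> y" using young_in[OF \<rho>] young_apply[OF \<rho>] by (intro inj) auto
    then show "x = y" using permutes_inj[OF young_permutes[OF \<rho>]] by (auto dest: injD)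
  qed
  have "card (?f ` ?A) = card ?A" by (rule card_image[OF inj_on_subset[OF inj_f]]) auto
  moreover have "card (?f ` ?B) = card ?B" by (rule card_image[OF inj_on_subset[OF inj_f]]) auto
  moreover have "card (?f ` ?A \<union> ?f ` ?B) = card (?f ` ?A) + card (?f ` ?B)"
    by (rule card_Un_disjoint) (use I.fin no that in auto)
  moreover have "card (?f ` ?A \<union> ?f ` ?B) \<le> card ?L"
  proof (rule card_mono[OF finL], rule Un_least)
    show "?f ` ?A \<subseteq> ?L" using young_in[OF \<rho>] young_apply[OF \<rho>] by auto
    show "?f ` ?B \<subseteq> ?L"
    proof clarify
      fix a assume a: "a \<in> S" "row a = Suc (row a0)"
      have "\<exists>b\<in>S. row b = row a0 \<and> col b = col (\<rho> a)"
        by (rule down[of "\<rho> a"]) (use a young_in[OF \<rho>] young_apply[OF \<rho>] pos ab in auto)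
      then show "col (\<rho> a) \<in> ?L" by (metis (mono_tags, lifting) imageI mem_Collect_eq)
    qed
  qed
  moreover have "card ?L \<le> card {1..<?d} + card ?A"
  proof -
    have "c < ?d \<and> 1 \<le> c \<or> c \<in> col ` ?A" if c: "c \<in> ?L" for c
    proof -
      obtain a where a: "a \<in> S" "row a = row a0" "c = col a" using c by auto
      show ?thesis
      proof (cases "c < ?d")
        case False
        then have "i a0 \<le> i a" using i a ab inj[of a a0] by (cases "col a = ?d") (auto simp: rsorted_def)
        then show ?thesis using a by auto
      qed (use a pos in auto)
    qed
    then have "?L \<subseteq> {1..<?d} \<union> col ` ?A" by (intro subsetI) (simp only: Un_iff atLeastLessThan_iff, blast)
    then have "card ?L \<le> card ({1..<?d} \<union> col ` ?A)" using I.fin by (intro card_mono) auto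
    also have "\<dots> \<le> card {1..<?d} + card (col ` ?A)" by (rule card_Un_le)
    also have "card (col ` ?A) \<le> card ?A" using I.fin by (intro card_image_le) auto
    finally show ?thesis by simp
  qed
  moreover have "?d \<le> card ?B"
  proof -
    have "{1..?d} \<subseteq> col ` ?B"
    proof
      fix d assume "d \<in> {1..?d}"
      then obtain b where b: "b \<in> S" "row b = row b0" "col b = d"
        using down[OF ab(2), of "row b0" d] pos ab by auto
      then have "i b \<le> i b0" using i ab \<open>d \<in> {1..?d}\<close> inj[of b b0]
        by (cases "d = ?d") (auto simp: rsorted_def)
      then show "d \<in> col ` ?B" using b ab by auto
    qed
    then have "card {1..?d} \<le> card (col ` ?B)" using I.fin by (intro card_mono) auto
    also have "\<dots> \<le> card ?B" using I.fin by (intro card_image_le) auto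
    finally show ?thesis by simp
  qed
  moreover have "1 \<le> ?d" by (rule pos(2)[OF ab(1)])
  then have "card {1..<?d} < ?d" by simp
  ultimately show False by linarith
qed

text \<open>The Garnir relation: \<open>z\<close> is the row symmetrization of the orbit sum of \<open>i\<close> under the permutations that
  shuffle the entries \<open>\<ge> i a0\<close> of the row of \<open>a0\<close> with the entries \<open>\<le> i b0\<close> of the next row.\<close>

lemma garnir:
  assumes i: "i \<in> MI" "I.noferm row i" "rsorted i"
    and ab: "a0 \<in> S" "b0 \<in> S" "col a0 = col b0" "row b0 = Suc (row a0)"
    and viol: "i b0 \<le> i a0" "i a0 = i b0 \<longrightarrow> Bos (i a0)"
  obtains z :: "'s tensor" where "\<And>k. z k \<in> \<int>" "\<And>\<rho>. \<rho> \<in> Rg \<Longrightarrow> act eps \<rho> z = z"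
    "CM z = (\<lambda>_. 0)" "z i = 1" "\<And>k. z k \<noteq> 0 \<Longrightarrow> k \<in> MI"
    "\<And>k. z k \<noteq> 0 \<Longrightarrow> k \<noteq> i \<Longrightarrow> rsorted k \<Longrightarrow> wt i < wt k"
proof -
  define B where "B = {a\<in>S. row a = row a0 \<and> i a0 \<le> i a} \<union> {a\<in>S. row a = Suc (row a0) \<and> i a \<le> i b0}"
  \<comment> \<open>Rows are numbered from 1, so the label 0 is free for B: \<open>?H\<close>
    permutes B arbitrarily and preserves rows elsewhere.\<close>
  define blk where "blk a = (if a \<in> B then 0 else row a)" for a
  let ?H = "young S blk" and ?P = "young S (\<lambda>a. (row a, a \<in> B))"
  define u where "u = I.osum blk i"
  \<comment> \<open>\<open>?P\<close> is the intersection of the row group with \<open>?H\<close>.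
    As u is invariant under \<open>?H\<close>, the summands are constant on left cosets of
    \<open>?P\<close>, and division by its order stays integral.\<close>
  define z where "z k = gsum eps Rg u k / of_nat (card ?P)" for k
  have BS: "B \<subseteq> S" by (auto simp: B_def)
  have PR: "?P \<subseteq> Rg" by (rule young_mono) auto
  have PH: "?P \<subseteq> ?H" by (rule young_mono) (auto simp: blk_def)
  have P_ne: "card ?P \<noteq> 0" using finite_young[OF I.fin] young_id by (auto simp: card_eq_0_iff)
  have HB: "h a \<in> B \<longleftrightarrow> a \<in> B" if "h \<in> ?H" "a \<in> S" for h a
    using young_apply[OF that] young_in[OF that] pos(1)[of a] pos(1)[of "h a"] that(2)
    by (auto simp: blk_def split: if_splits)
  have Hrow: "row (h a) = row a" if "h \<in> ?H" "a \<in> S" "a \<notin> B" for h a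
    using young_apply[OF that(1,2)] HB[OF that(1,2)] that(3) by (simp add: blk_def)
  have nf: "I.noferm blk i"
    unfolding I.noferm_def
  proof (intro ballI impI)
    fix a b assume ab': "a \<in> S" "b \<in> S" "a \<noteq> b \<and> blk a = blk b \<and> i a = i b"
    have B_iff: "a \<in> B \<longleftrightarrow> b \<in> B"
      using ab' pos(1)[of a] pos(1)[of b] by (auto simp: blk_def split: if_splits)
    show "Bos (i a)"
    proof (cases "row a = row b")
      case True then show ?thesis using i(2) ab' by (auto simp: I.noferm_def)
    next
      case False
      then have "a \<in> B" "b \<in> B" using ab' B_iff by (auto simp: blk_def split: if_splits)
      \<comment> \<open>The upper entries of B are at least i a0, the lower ones at most i b0 \<le>
        i a0, so equal entries in different rows force equality throughout.\<close>
      then have "i a0 = i b0" "i a = i a0" using False ab' viol by (auto simp: B_def)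
      then show ?thesis using viol by simp
    qed
  qed
  have act_u: "act eps h u = u" if "h \<in> ?H" for h unfolding u_def by (rule I.act_osum[OF that])
  have u_i: "u i = 1" unfolding u_def by (rule I.osum_self[OF nf])
  have u_Int: "u k \<in> \<int>" for k unfolding u_def by (rule I.osum_Ints[OF nf])
  have act_\<rho>_u: "act eps (\<rho> \<circ> h) u = act eps \<rho> u" if "\<rho> \<in> Rg" "h \<in> ?H" for \<rho> h
    using I.act_comp[OF young_permutes[OF that(1)] young_permutes[OF that(2)]] act_u[OF that(2)] by simp
  have supp: "\<exists>\<rho>\<in>Rg. \<exists>h\<in>?H. k \<circ> \<rho> \<circ> h = i" if "z k \<noteq> 0" for k
  proof -
    have "gsum eps Rg u k \<noteq> 0" using that by (auto simp: z_def)
    then obtain \<rho> where "\<rho> \<in> Rg" "act eps \<rho> u k \<noteq> 0" unfolding gsum_def by (meson sum.not_neutral_contains_not_neutral)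
    moreover from this have "u (k \<circ> \<rho>) \<noteq> 0" by (simp add: act_def)
    ultimately show ?thesis using I.osum_support unfolding u_def by blast
  qed
  show thesis
  proof (rule that[of z])
    show "z k \<in> \<int>" for k
      unfolding z_def gsum_def
    proof (rule sum_young_cosets[OF I.fin _ PR])
      show "act eps (\<pi> \<circ> \<sigma>) u k = act eps \<pi> u k" if "\<pi> \<in> Rg" "\<sigma> \<in> ?P" for \<pi> \<sigma>
        using act_\<rho>_u[OF that(1)] that(2) PH by (simp add: subset_iff)
      show "act eps \<pi> u k \<in> \<int>" if "\<pi> \<in> Rg" for \<pi>
        using I.eps_cases[OF young_permutes[OF that], of k] u_Int by (auto simp: act_def)
    qed
    show "act eps \<rho> z = z" if "\<rho> \<in> Rg" for \<rho>
      using I.act_gsum_young[OF that, of u] by (simp add: z_def act_def fun_eq_iff)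
    show "CM z = (\<lambda>_. 0)"
    proof -
      have "CM (act eps \<rho> u) = (\<lambda>_. 0)" if \<rho>: "\<rho> \<in> Rg" for \<rho>
      proof -
        obtain x y where xy: "x \<in> S" "y \<in> S" "row x = row a0" "row y = Suc (row a0)" "i a0 \<le> i x" "i y \<le> i b0"
          "col (\<rho> x) = col (\<rho> y)" by (rule pigeonhole[OF i(3) ab \<rho>])
        then have "x \<in> B" "y \<in> B" "x \<noteq> y" by (auto simp: B_def)
        then have t: "transpose x y \<in> ?H" using xy by (intro young_transpose) (auto simp: blk_def)
        have injr: "inj \<rho>" by (rule permutes_inj[OF young_permutes[OF \<rho>]])
        then have neq: "\<rho> x \<noteq> \<rho> y" using \<open>x \<noteq> y\<close> by (auto dest: injD)
        \<comment> \<open>Conjugation by \<open>\<rho>\<close> turns the exchange of x and y, which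
          lies in \<open>?H\<close>, into the exchange of two positions of one column.\<close>
        have "transpose (\<rho> x) (\<rho> y) \<circ> \<rho> = \<rho> \<circ> transpose x y"
          using injr by (auto simp: fun_eq_iff transpose_def dest: injD)
        then have "act eps (transpose (\<rho> x) (\<rho> y)) (act eps \<rho> u) = act eps \<rho> u"
          using I.act_comp[of "transpose (\<rho> x) (\<rho> y)" \<rho> u] young_permutes[OF \<rho>] young_in[OF \<rho>] xy
            act_\<rho>_u[OF \<rho> t] by (simp add: permutes_swap_id)
        then show ?thesis using CM_kill neq xy young_in[OF \<rho>] by blast
      qed
      moreover have "z = (\<lambda>k. \<Sum>\<rho>\<in>Rg. (1 / of_nat (card ?P)) * act eps \<rho> u k)"
        by (simp add: z_def gsum_def fun_eq_iff sum_divide_distrib)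
      moreover have "CM (\<lambda>k. \<Sum>\<rho>\<in>Rg. (1 / of_nat (card ?P)) * act eps \<rho> u k)
          = (\<lambda>k. \<Sum>\<rho>\<in>Rg. (1 / of_nat (card ?P)) * CM (act eps \<rho> u) k)" by (rule gsum_sum)
      ultimately show ?thesis by simp
    qed
    show "z i = 1"
    proof -
      have 1: "act eps \<rho> u i = 1" if "\<rho> \<in> ?P" for \<rho>
        using act_u u_i that PH by (metis subsetD)
      have 0: "act eps \<rho> u i = 0" if \<rho>: "\<rho> \<in> Rg" "\<rho> \<notin> ?P" for \<rho>
      proof (rule ccontr)
        assume "act eps \<rho> u i \<noteq> 0"
        then have "u (i \<circ> \<rho>) \<noteq> 0" by (simp add: act_def)
        then obtain h where h: "h \<in> ?H" "i \<circ> \<rho> \<circ> h = i" using I.osum_support unfolding u_def by blast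
        \<comment> \<open>Outside B the shuffle h keeps rows, so the entry at
          \<open>\<rho> a\<close> also occurs outside B in the row of a; within one row the entry
          alone decides membership in B.\<close>
        have out: "\<rho> a \<in> S - B" if a: "a \<in> S - B" for a
        proof -
          define b where "b = inv h a"
          have hb: "h b = a" using permutes_inverses(1)[OF young_permutes[OF h(1)]] by (simp add: b_def)
          have b: "b \<in> S" using young_in[OF young_inv[OF h(1)]] a by (simp add: b_def)
          have bB: "b \<notin> B" using HB[OF h(1) b] hb a by simp
          have "row b = row a" using Hrow[OF h(1) b bB] hb by simp
          moreover have "i (\<rho> a) = i b" using fun_cong[OF h(2), of b] hb by simp
          moreover have "row (\<rho> a) = row a" "\<rho> a \<in> S" using young_apply[OF \<rho>(1)] young_in[OF \<rho>(1)] a by auto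
          ultimately show ?thesis using b bB by (auto simp: B_def)
        qed
        have "\<rho> ` (S - B) = S - B"
          by (rule endo_inj_surj) (use I.fin out permutes_inj_on[OF young_permutes[OF \<rho>(1)]] in auto)
        then have "\<rho> a \<in> B \<longleftrightarrow> a \<in> B" if "a \<in> S" for a
          using that out young_in[OF \<rho>(1) that] permutes_inj[OF young_permutes[OF \<rho>(1)]]
          by (metis Diff_iff imageE injD)
        then have "\<rho> \<in> ?P" using \<rho>(1) by (auto simp: young_def)
        then show False using \<rho>(2) by blast
      qed
      have "gsum eps Rg u i = (\<Sum>\<rho>\<in>?P. 1)"
        unfolding gsum_def using PR 0 1
        by (intro sum.mono_neutral_cong_right) (auto simp: finite_young[OF I.fin])
      then show ?thesis using P_ne by (simp add: z_def)
    qed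
    show "k \<in> MI" if "z k \<noteq> 0" for k
      using supp[OF that] i(1) PiE_comp_permutes[OF young_permutes] by metis
    show "wt i < wt k" if zk: "z k \<noteq> 0" and ki: "k \<noteq> i" and ks: "rsorted k" for k
    proof -
      obtain \<rho> h where \<rho>: "\<rho> \<in> Rg" and h: "h \<in> ?H" and khi: "k \<circ> \<rho> \<circ> h = i" using supp[OF zk] by blast
      have hp: "h permutes S" by (rule young_permutes[OF h])
      have kMI: "k \<in> MI" using khi i(1) PiE_comp_permutes young_permutes[OF \<rho>] hp by metis
      let ?w = "k \<circ> \<rho>" and ?c = "int (i a0)"
      \<comment> \<open>Subtracting the constant i a0 from the entries leaves the sum unchanged,
        since h permutes the row numbers. It makes every summand nonnegative: upper entries of B are
        \<ge> i a0 and can only move down, lower ones are \<le> i a0 and can only move up.\<close>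
      let ?t = "\<lambda>b. (int (row (h b)) - int (row b)) * (int (i b) - ?c)"
      have wi: "?w (h b) = i b" for b using fun_cong[OF khi, of b] by simp
      have wtk: "wt k = (\<Sum>b\<in>S. row (h b) * i b)"
      proof -
        have "wt k = wt ?w" by (simp add: wt_young[OF \<rho>])
        also have "\<dots> = (\<Sum>b\<in>S. row (h b) * ?w (h b))"
          unfolding wt_def by (subst sum.permute[OF hp]) simp
        finally show ?thesis by (simp only: wi)
      qed
      have row_h: "(\<Sum>b\<in>S. int (row (h b))) = (\<Sum>b\<in>S. int (row b))"
        by (subst (2) sum.permute[OF hp]) simp
      have "(\<Sum>b\<in>S. ?t b) = (\<Sum>b\<in>S. int (row (h b)) * int (i b)) - (\<Sum>b\<in>S. int (row b) * int (i b))
          - ((\<Sum>b\<in>S. int (row (h b))) - (\<Sum>b\<in>S. int (row b))) * ?c"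
        by (simp add: sum_subtractf sum.distrib sum_distrib_right sum_distrib_left algebra_simps)
      also have "\<dots> = int (wt k) - int (wt i)" unfolding wtk row_h by (simp add: wt_def)
      finally have sum_t: "(\<Sum>b\<in>S. ?t b) = int (wt k) - int (wt i)" .
      have t_pos: "0 \<le> ?t b" if b: "b \<in> S" for b
      proof (cases "b \<in> B")
        case True
        then have "h b \<in> B" using HB[OF h b] by simp
        then show ?thesis using True viol by (auto simp: B_def zero_le_mult_iff)
      qed (use Hrow[OF h b] in simp)
      have "wt i \<le> wt k" using sum_nonneg[of S ?t] t_pos sum_t by simp
      moreover have "wt k \<noteq> wt i"
      proof
        assume "wt k = wt i"
        then have "\<forall>b\<in>S. ?t b = 0" using sum_nonneg_eq_0_iff[OF I.fin, of ?t] t_pos sum_t by simp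
        then have t0: "row (h b) = row b \<or> i b = i a0" if "b \<in> S" for b using that by fastforce
        \<comment> \<open>Entries that change rows all equal i a0. For x below this value they are
          not counted; otherwise the complementary entries > x are compared, and the row lengths
          agree.\<close>
        have cnt: "card {b\<in>S. row (h b) = q \<and> i b \<le> x} = card {b\<in>S. row b = q \<and> i b \<le> x}" for q x
        proof (cases "x < i a0")
          case True
          then have "{b\<in>S. row (h b) = q \<and> i b \<le> x} = {b\<in>S. row b = q \<and> i b \<le> x}" using t0 by force
          then show ?thesis by simp
        next
          case False
          then have "{b\<in>S. row (h b) = q \<and> x < i b} = {b\<in>S. row b = q \<and> x < i b}" using t0 by force
          moreover have split: "card {b\<in>S. f b = q} = card {b\<in>S. f b = q \<and> i b \<le> x} + card {b\<in>S. f b = q \<and> x < i b}" for f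
          proof -
            have "{b\<in>S. f b = q} = {b\<in>S. f b = q \<and> i b \<le> x} \<union> {b\<in>S. f b = q \<and> x < i b}" by auto
            also have "card \<dots> = card {b\<in>S. f b = q \<and> i b \<le> x} + card {b\<in>S. f b = q \<and> x < i b}"
            proof (rule card_Un_disjoint)
              show "{b\<in>S. f b = q \<and> i b \<le> x} \<inter> {b\<in>S. f b = q \<and> x < i b} = {}"
                by (simp add: disjoint_iff not_less)
            qed (simp_all add: I.fin)
            finally show ?thesis .
          qed
          moreover have "card {b\<in>S. row (h b) = q} = card {b\<in>S. row b = q}" by (rule card_permutes[OF hp])
          ultimately show ?thesis using split[of "\<lambda>b. row (h b)"] split[of row] by simp
        qed
        have "k = i"
        proof (rule rsorted_unique[OF ks i(3) kMI i(1)])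
          fix q x
          have "card {a\<in>S. row a = q \<and> k a \<le> x} = card {a\<in>S. row a = q \<and> ?w a \<le> x}"
            using card_young_fibre[OF \<rho>, where Q = "\<lambda>a. k a \<le> x"] by simp
          also have "\<dots> = card {b\<in>S. row (h b) = q \<and> ?w (h b) \<le> x}"
            using card_permutes[OF hp, where Q = "\<lambda>a. row a = q \<and> ?w a \<le> x"] by simp
          also have "\<dots> = card {b\<in>S. row b = q \<and> i b \<le> x}" unfolding wi by (rule cnt)
          finally show "card {a\<in>S. row a = q \<and> k a \<le> x} = card {b\<in>S. row b = q \<and> i b \<le> x}" .
        qed
        then show False using ki by simp
      qed
      ultimately show ?thesis by simp
    qed
  qed
qed

text \<open>A row orbit in \<open>MI\<close> contains exactly one row-sorted multiindex, and an
  invariant tensor is determined by its values at these. Where the Pauli principle applies, both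
  sides vanish on the orbit.\<close>

lemma decompose:
  assumes inv: "\<And>\<rho>. \<rho> \<in> Rg \<Longrightarrow> act eps \<rho> z = z" and supp: "\<And>k. z k \<noteq> 0 \<Longrightarrow> k \<in> MI"
  shows "z k = (\<Sum>i\<in>{i\<in>MI. rsorted i}. z i * Xi i k)"
proof -
  obtain \<rho> where \<rho>: "\<rho> \<in> Rg" "rsorted (k \<circ> \<rho>)" by (rule ex_rsorted)
  have MI_iff: "k \<circ> \<pi> \<in> MI \<longleftrightarrow> k \<in> MI" if "\<pi> \<in> Rg" for \<pi>
    by (rule PiE_comp_permutes[OF young_permutes[OF that]])
  have other: "z i * Xi i k = 0" if i: "i \<in> MI" "rsorted i" "i \<noteq> k \<circ> \<rho>" for i
  proof (rule ccontr)
    assume "z i * Xi i k \<noteq> 0"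
    then obtain \<pi> where \<pi>: "\<pi> \<in> Rg" "k \<circ> \<pi> = i" using I.xi_support by fastforce
    have "k \<circ> \<rho> = i \<circ> (inv \<pi> \<circ> \<rho>)"
      using inv_o_young(2)[OF \<pi>(1)] by (simp add: \<pi>(2)[symmetric] o_assoc[symmetric]) (simp add: o_assoc)
    moreover have "inv \<pi> \<circ> \<rho> \<in> Rg" by (intro young_comp young_inv \<pi> \<rho>)
    ultimately show False using rsorted_orbit_unique[of i "inv \<pi> \<circ> \<rho>"] i \<rho> by simp
  qed
  show ?thesis
  proof (cases "k \<in> MI")
    case False
    then have "z k = 0" using supp by blast
    moreover have "k \<circ> \<rho> \<notin> MI" using False MI_iff[OF \<rho>(1)] by simp
    moreover have "(\<Sum>i\<in>{i\<in>MI. rsorted i}. z i * Xi i k) = 0"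
      by (rule sum.neutral) (use other calculation(2) in blast)
    ultimately show ?thesis by simp
  next
    case True
    let ?i = "k \<circ> \<rho>"
    have iMI: "?i \<in> MI" using True MI_iff[OF \<rho>(1)] by simp
    have "(\<Sum>i\<in>{i\<in>MI. rsorted i}. z i * Xi i k) = (\<Sum>i\<in>{?i}. z i * Xi i k)"
      by (rule sum.mono_neutral_right) (use finite_MI iMI \<rho> other in auto)
    also have "\<dots> = z ?i * Xi ?i k" by simp
    also have "\<dots> = z k"
    proof (cases "I.noferm row ?i")
      case True
      then have "Xi ?i k = eps k \<rho>" using I.xi_eq_osum[OF iMI] I.osum_orbit[OF _ \<rho>(1)] by metis
      then show ?thesis using I.invariant_orbit[OF inv \<rho>(1), of k] by simp
    next
      case False
      then have "z ?i = 0" using I.invariant_noferm[OF inv] by blast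
      then show ?thesis using I.invariant_orbit[OF inv \<rho>(1), of k] by simp
    qed
    finally show ?thesis by simp
  qed
qed

text \<open>Row-sortedness and \<open>noferm\<close> already give the row conditions, so a column
  condition fails. Chaining through the boxes in between, which exist by \<open>down\<close>, shows
  that it fails in two consecutive rows.\<close>

lemma sst_violation:
  assumes "i \<in> MI" "I.noferm row i" "rsorted i" "i \<notin> SST"
  obtains a b where "a \<in> S" "b \<in> S" "col a = col b" "row b = Suc (row a)" "i b \<le> i a" "i a = i b \<longrightarrow> Bos (i a)"
proof (rule ccontr)
  assume no: "\<not> thesis"
  note witness = that
  have adj: "i a \<le> i b \<and> (i a = i b \<longrightarrow> \<not> Bos (i a))" if ab: "a \<in> S" "b \<in> S" "col a = col b" "row b = Suc (row a)" for a b
    using no witness[OF ab] by fastforce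
  have col: "i a \<le> i b \<and> (i a = i b \<longrightarrow> \<not> Bos (i a))"
    if "a \<in> S" "b \<in> S" "col a = col b" "row b = row a + Suc n" for a b n
    using that
  proof (induction n arbitrary: b)
    case 0
    then show ?case using adj by simp
  next
    case (Suc n)
    obtain c where c: "c \<in> S" "row c = row a + Suc n" "col c = col b"
      using down[of b "row a + Suc n" "col b"] Suc.prems pos by auto
    have "i a \<le> i c \<and> (i a = i c \<longrightarrow> \<not> Bos (i a))" using Suc c by simp
    moreover have "i c \<le> i b \<and> (i c = i b \<longrightarrow> \<not> Bos (i c))" using adj[of c b] Suc.prems c by simp
    ultimately show ?case by auto
  qed
  have "sst Bos S row col i"
    unfolding sst_def
  proof (intro conjI ballI impI)
    fix a b assume "a \<in> S" "b \<in> S" and ab: "col a = col b \<and> row a < row b"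
    moreover obtain n where "row b = row a + Suc n" using ab less_imp_Suc_add by auto
    ultimately have *: "i a \<le> i b \<and> (i a = i b \<longrightarrow> \<not> Bos (i a))" using col by blast
    show "i a \<le> i b" using * by simp
    show "\<not> Bos (i a)" if "i a = i b" using * that by simp
  next
    fix a b assume "a \<in> S" "b \<in> S" "row a = row b \<and> col a < col b"
    then show "i a \<le> i b" "i a = i b \<Longrightarrow> Bos (i a)"
      using assms(2,3) by (auto simp: I.noferm_def rsorted_def)
  qed
  then show False using assms(1,4) by (simp add: SST_def)
qed

section \<open>Integral combinations of the semistandard column sums\<close>

definition inspan where
  "inspan x \<longleftrightarrow> (\<exists>n :: ('s \<Rightarrow> nat) \<Rightarrow> int. \<forall>k. x k = (\<Sum>s\<in>SST. of_int (n s) * CM (Xi s) k))"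

lemma inspan_sum:
  fixes A :: "'i set"
  assumes "\<And>i. i \<in> A \<Longrightarrow> inspan (x i)" "\<And>i. i \<in> A \<Longrightarrow> c i \<in> \<int>"
  shows "inspan (\<lambda>k. \<Sum>i\<in>A. c i * x i k)"
proof -
  have "\<forall>i\<in>A. \<exists>n :: ('s \<Rightarrow> nat) \<Rightarrow> int. \<forall>k. x i k = (\<Sum>s\<in>SST. of_int (n s) * CM (Xi s) k)"
    using assms(1) by (auto simp: inspan_def)
  then obtain n :: "'i \<Rightarrow> ('s \<Rightarrow> nat) \<Rightarrow> int"
    where n: "\<And>i k. i \<in> A \<Longrightarrow> x i k = (\<Sum>s\<in>SST. of_int (n i s) * CM (Xi s) k)" by metis
  have "\<forall>i\<in>A. \<exists>d. c i = of_int d" using assms(2) by (auto elim: Ints_cases)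
  then obtain d where d: "\<And>i. i \<in> A \<Longrightarrow> c i = of_int (d i)" by metis
  have "(\<Sum>i\<in>A. c i * x i k) = (\<Sum>s\<in>SST. of_int (\<Sum>i\<in>A. d i * n i s) * CM (Xi s) k)" for k
  proof -
    have "(\<Sum>i\<in>A. c i * x i k) = (\<Sum>i\<in>A. \<Sum>s\<in>SST. of_int (d i * n i s) * CM (Xi s) k)"
      using n d by (simp add: sum_distrib_left mult.assoc)
    then show ?thesis by (subst (asm) sum.swap) (simp add: sum_distrib_right)
  qed
  then show ?thesis unfolding inspan_def by (intro exI[of _ "\<lambda>s. \<Sum>i\<in>A. d i * n i s"]) simp
qed

lemma inspan_zero: "inspan (\<lambda>_. 0)"
  using inspan_sum[of "{}"] by simp

lemma inspan_SST:
  assumes "i \<in> SST"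
  shows "inspan (CM (Xi i))"
proof -
  have "(\<Sum>s\<in>SST. of_int (if s = i then 1 else 0) * CM (Xi s) k) = CM (Xi i) k" for k
    using assms finite_SST by (simp add: if_distrib[of of_int] if_distrib[of "\<lambda>x. x * _"] cong: if_cong)
  then show ?thesis unfolding inspan_def by (intro exI[of _ "\<lambda>s. if s = i then 1 else 0"]) simp
qed

lemma straighten_sorted:
  assumes "i \<in> MI" "rsorted i"
  shows "inspan (CM (Xi i))"
  using assms
proof (induction "(\<Sum>a\<in>S. row a * N) - wt i" arbitrary: i rule: less_induct)
  case less
  show ?case
  proof (cases "I.noferm row i \<and> i \<notin> SST")
    case False
    then consider "i \<in> SST" | "\<not> I.noferm row i" by blast
    then show ?thesis
    proof cases
      case 2
      then have "CM (Xi i) = (\<lambda>_. 0)" by (simp add: I.xi_ferm gsum_def act_def)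
      then show ?thesis using inspan_zero by simp
    qed (rule inspan_SST)
  next
    case True
    obtain a b where "a \<in> S" "b \<in> S" "col a = col b" "row b = Suc (row a)" "i b \<le> i a" "i a = i b \<longrightarrow> Bos (i a)"
      using sst_violation[of i] less.prems True by blast
    then obtain z :: "'s tensor" where z: "\<And>k. z k \<in> \<int>" "\<And>\<rho>. \<rho> \<in> Rg \<Longrightarrow> act eps \<rho> z = z"
      "CM z = (\<lambda>_. 0)" "z i = 1" "\<And>k. z k \<noteq> 0 \<Longrightarrow> k \<in> MI"
      "\<And>k. z k \<noteq> 0 \<Longrightarrow> k \<noteq> i \<Longrightarrow> rsorted k \<Longrightarrow> wt i < wt k"
      using garnir[of i a b] less.prems True by blast
    let ?A = "{i\<in>MI. rsorted i}"
    have fin: "finite ?A" using finite_MI by simp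
    have "z = (\<lambda>k. \<Sum>j\<in>?A. z j * Xi j k)" using decompose[OF z(2,5)] by (intro ext) blast
    then have "CM (\<lambda>k. \<Sum>j\<in>?A. z j * Xi j k) = (\<lambda>_. 0)" using z(3) by simp
    then have "(\<Sum>j\<in>?A. z j * CM (Xi j) k) = 0" for k unfolding gsum_sum by meson
    moreover have "(\<Sum>j\<in>?A. z j * CM (Xi j) k) = z i * CM (Xi i) k + (\<Sum>j\<in>?A - {i}. z j * CM (Xi j) k)" for k
      by (rule sum.remove) (use fin less.prems in auto)
    ultimately have eq: "CM (Xi i) = (\<lambda>k. \<Sum>j\<in>?A - {i}. - z j * CM (Xi j) k)"
      using z(4) by (auto simp: fun_eq_iff sum_negf add_eq_0_iff)
    have "inspan (\<lambda>k. \<Sum>j\<in>{j\<in>?A - {i}. z j \<noteq> 0}. - z j * CM (Xi j) k)"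
    proof (rule inspan_sum)
      fix j assume j: "j \<in> {j\<in>?A - {i}. z j \<noteq> 0}"
      \<comment> \<open>Entries are at most N, so weights are bounded and the truncated difference
        in the induction measure really decreases.\<close>
      have "wt j \<le> (\<Sum>a\<in>S. row a * N)" unfolding wt_def using j by (intro sum_mono mult_le_mono2) (auto simp: PiE_iff)
      then show "inspan (CM (Xi j))" using j z(6)[of j] by (intro less.hyps) auto
    qed (use z(1) in auto)
    moreover have "(\<lambda>k. \<Sum>j\<in>{j\<in>?A - {i}. z j \<noteq> 0}. - z j * CM (Xi j) k) = CM (Xi i)"
      unfolding eq by (intro ext sum.mono_neutral_left) (use fin in auto)
    ultimately show ?thesis by simp
  qed
qed

theorem straighten:
  assumes "i \<in> MI"
  shows "\<exists>n :: ('s \<Rightarrow> nat) \<Rightarrow> int. \<forall>k. CM (Xi i) k = (\<Sum>s\<in>SST. of_int (n s) * CM (Xi s) k)"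
proof -
  obtain \<rho> where \<rho>: "\<rho> \<in> Rg" "rsorted (i \<circ> \<rho>)" by (rule ex_rsorted)
  have p: "\<rho> permutes S" by (rule young_permutes[OF \<rho>(1)])
  have "inspan (CM (Xi (i \<circ> \<rho>)))"
    by (rule straighten_sorted[OF _ \<rho>(2)]) (unfold PiE_comp_permutes[OF p], rule assms)
  then have "inspan (\<lambda>k. \<Sum>_\<in>{()}. eps i \<rho> * CM (Xi (i \<circ> \<rho>)) k)"
    using I.eps_cases[OF p, of i] by (intro inspan_sum) auto
  moreover have "Xi (i \<circ> \<rho>) = (\<lambda>k. eps i \<rho> * Xi i k)" using I.xi_comp[OF \<rho>(1)] by blast
  ultimately have "inspan (CM (Xi i))"
    using I.eps_sq[OF p, of i] by (simp add: gsum_scale mult.assoc[symmetric])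
  then show ?thesis unfolding inspan_def .
qed


section \<open>Linear independence\<close>

text \<open>The columns of k increase weakly and \<open>wt\<close> weights each box by its row, so
  \<open>sorted_maximal\<close> applies with the columns as blocks.\<close>

lemma SST_column_maximal:
  assumes k: "k \<in> SST" and \<kappa>: "\<kappa> \<in> Cg"
  shows "wt (k \<circ> \<kappa>) \<le> wt k" "wt (k \<circ> \<kappa>) = wt k \<Longrightarrow> k \<circ> \<kappa> = k"
proof -
  have sorted: "k a \<le> k b" if "a \<in> S" "b \<in> S" "col a = col b" "row a < row b" for a b
    using SST_col[OF k that] by simp
  have inj': "a = b" if "a \<in> S" "b \<in> S" "col a = col b" "row a = row b" for a b
    using inj that by blast
  show "wt (k \<circ> \<kappa>) \<le> wt k"
    unfolding wt_def comp_def
    by (rule sorted_maximal(1)[where g = col and w = row, OF I.fin inj' sorted \<kappa>])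
  assume eq: "wt (k \<circ> \<kappa>) = wt k"
  have e: "(\<Sum>a\<in>S. row a * k (\<kappa> a)) = (\<Sum>a\<in>S. row a * k a)"
    using eq unfolding wt_def comp_def .
  show "k \<circ> \<kappa> = k"
  proof
    fix a
    show "(k \<circ> \<kappa>) a = k a"
    proof (cases "a \<in> S")
      case True
      have "k (\<kappa> a) = k a"
        by (rule sorted_maximal(2)[where g = col and w = row, OF I.fin inj' sorted \<kappa> e True])
      then show ?thesis by simp
    next
      case False then show ?thesis using permutes_not_in[OF young_permutes[OF \<kappa>]] by simp
    qed
  qed
qed

text \<open>Triangularity: a nonzero coefficient leads from k to i by a column and then a row
  permutation. The first cannot raise the weight and the second keeps it; equal weights leave only a
  row permutation between two row-sorted fillings.\<close>

lemma CM_Xi_semistandard: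
  assumes i: "i \<in> SST" and k: "k \<in> SST" and nz: "CM (Xi i) k \<noteq> 0"
  shows "wt i < wt k \<or> i = k"
proof -
  obtain \<kappa> where \<kappa>: "\<kappa> \<in> Cg" "act eps' \<kappa> (Xi i) k \<noteq> 0"
    using nz unfolding gsum_def by (meson sum.not_neutral_contains_not_neutral)
  then have "Xi i (k \<circ> \<kappa>) \<noteq> 0" by (simp add: act_def)
  then obtain \<rho> where \<rho>: "\<rho> \<in> Rg" "k \<circ> \<kappa> \<circ> \<rho> = i" using I.xi_support by blast
  have wti: "wt i = wt (k \<circ> \<kappa>)" using wt_young[OF \<rho>(1), of "k \<circ> \<kappa>"] \<rho>(2) by simp
  show ?thesis
  proof (cases "wt i = wt k")
    case True
    then have "k \<circ> \<kappa> = k" using SST_column_maximal(2)[OF k \<kappa>(1)] wti by simp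
    then have "k \<circ> \<rho> = i" using \<rho>(2) by simp
    then show ?thesis using rsorted_orbit_unique[of k \<rho>] SST_rsorted i k SST_MI \<rho>(1) by simp
  qed (use SST_column_maximal(1)[OF k \<kappa>(1)] wti in simp)
qed

lemma SST_noferm_col:
  assumes "k \<in> SST"
  shows "J.noferm col k"
  unfolding J.noferm_def
proof (intro ballI impI)
  fix a b assume ab: "a \<in> S" "b \<in> S" "a \<noteq> b \<and> col a = col b \<and> k a = k b"
  then consider "row a < row b" | "row b < row a" using inj[of a b] by force
  then show "\<not> Bos (k a)"
  proof cases
    case 1 then show ?thesis using ab SST_col[OF assms, of a b] by simp
  next
    case 2 then show ?thesis using ab SST_col[OF assms, of b a] by simp
  qed
qed

text \<open>Weights exclude all column permutations that change k. Those that stabilize it exchange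
  equal symbols outside \<open>Bos\<close>, which has sign 1 under \<open>eps'\<close>, so the terms
  add up without cancellation.\<close>

lemma CM_Xi_diagonal:
  assumes k: "k \<in> SST"
  shows "CM (Xi k) k \<noteq> 0"
proof -
  have Xk: "Xi k = I.osum row k" by (rule I.xi_eq_osum[OF SST_MI[OF k] SST_noferm[OF k]])
  have off: "act eps' \<kappa> (Xi k) k = 0" if \<kappa>: "\<kappa> \<in> Cg" "k \<circ> \<kappa> \<noteq> k" for \<kappa>
  proof (rule ccontr)
    assume "act eps' \<kappa> (Xi k) k \<noteq> 0"
    then have "Xi k (k \<circ> \<kappa>) \<noteq> 0" by (simp add: act_def)
    then obtain \<rho> where \<rho>: "\<rho> \<in> Rg" "k \<circ> \<kappa> \<circ> \<rho> = k" using I.xi_support by blast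
    have "wt (k \<circ> \<kappa>) = wt k" using wt_young[OF \<rho>(1), of "k \<circ> \<kappa>"] \<rho>(2) by simp
    then show False using SST_column_maximal(2)[OF k \<kappa>(1)] \<kappa>(2) by simp
  qed
  have "CM (Xi k) k = (\<Sum>\<kappa>\<in>{\<kappa> \<in> Cg. k \<circ> \<kappa> = k}. act eps' \<kappa> (Xi k) k)"
    unfolding gsum_def by (rule sum.mono_neutral_right) (use off finite_young[OF I.fin] in auto)
  also have "\<dots> = (\<Sum>\<kappa>\<in>{\<kappa> \<in> Cg. k \<circ> \<kappa> = k}. 1)"
  proof (rule sum.cong[OF refl])
    fix \<kappa> assume "\<kappa> \<in> {\<kappa> \<in> Cg. k \<circ> \<kappa> = k}"
    then have "k \<circ> \<kappa> = k" "\<kappa> \<in> young S (\<lambda>a. (col a, k a))" unfolding J.stab_young[symmetric] by simp_all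
    moreover from this have "eps' k \<kappa> = 1" using J.eps_stab_young[OF SST_noferm_col[OF k]] by blast
    ultimately show "act eps' \<kappa> (Xi k) k = 1" by (simp add: act_def Xk I.osum_self[OF SST_noferm[OF k]])
  qed
  also have "\<dots> = of_nat (card (young S (\<lambda>a. (col a, k a))))" unfolding J.stab_young by simp
  also have "\<dots> \<noteq> 0" using finite_young[OF I.fin] young_id[of S "\<lambda>a. (col a, k a)"] by (auto simp: card_eq_0_iff)
  finally show ?thesis .
qed

theorem CM_Xi_independent:
  assumes "\<And>k. (\<Sum>i\<in>SST. c i * CM (Xi i) k) = 0" and "i \<in> SST"
  shows "c i = 0"
  using assms(2)
proof (induction "wt i" arbitrary: i rule: less_induct)
  case less
  have "c j * CM (Xi j) i = 0" if "j \<in> SST - {i}" for j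
    using that CM_Xi_semistandard[of j i] less by (cases "CM (Xi j) i = 0") auto
  then have "(\<Sum>j\<in>SST - {i}. c j * CM (Xi j) i) = 0" by (intro sum.neutral ballI)
  then have "(\<Sum>j\<in>SST. c j * CM (Xi j) i) = c i * CM (Xi i) i"
    using sum.remove[OF finite_SST less.prems, of "\<lambda>j. c j * CM (Xi j) i"] by simp
  then show ?case using assms(1) CM_Xi_diagonal[OF less.prems] by simp
qed

end


subsection \<open>The pairing of tensors\<close>

text \<open>The constant label lets the sum run over all permutations of S. On deltas this models
  \<chi>: moving both arguments simultaneously changes nothing (\<open>pair_act\<close>).\<close>

definition pair :: "'s cocycle \<Rightarrow> 's set \<Rightarrow> 's tensor \<Rightarrow> 's tensor
    \<Rightarrow> ('s \<Rightarrow> nat) \<Rightarrow> 's tensor"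
  where "pair eps S x y k l = (\<Sum>\<pi>\<in>young S (\<lambda>_. ()). act eps \<pi> x k * act eps \<pi> y l)"

lemma pair_sum_left: "pair eps S (\<lambda>k. \<Sum>i\<in>A. c i * x i k) y k l = (\<Sum>i\<in>A. c i * pair eps S (x i) y k l)"
  unfolding pair_def act_sum sum_distrib_left sum_distrib_right by (subst sum.swap) (simp add: mult.assoc)

lemma pair_commute: "pair eps S x y k l = pair eps S y x l k"
  by (simp add: pair_def mult.commute)

lemma permutes_young: "\<pi> permutes S \<Longrightarrow> \<pi> \<in> young S (\<lambda>_. ())"
  by (simp add: young_def)

context signed_action
begin

lemma pair_act:
  assumes "\<sigma> permutes S"
  shows "pair eps S (act eps \<sigma> x) (act eps \<sigma> y) k l = pair eps S x y k l"
proof -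
  have "pair eps S (act eps \<sigma> x) (act eps \<sigma> y) k l
      = (\<Sum>\<pi>\<in>young S (\<lambda>_. ()). act eps (\<pi> \<circ> \<sigma>) x k * act eps (\<pi> \<circ> \<sigma>) y l)"
    unfolding pair_def by (rule sum.cong) (auto simp: act_comp assms young_permutes)
  also have "\<dots> = pair eps S x y k l"
    unfolding pair_def by (rule sum_young_right[OF permutes_young[OF assms]])
  finally show ?thesis .
qed

lemma pair_act_right:
  assumes "\<sigma> permutes S"
  shows "pair eps S x (act eps \<sigma> y) k l = pair eps S (act eps (inv \<sigma>) x) y k l"
proof -
  have "act eps \<sigma> (act eps (inv \<sigma>) x) = x"
    using act_comp[OF assms permutes_inv[OF assms], of x] permutes_inv_o(1)[OF assms] by (simp add: act_id)
  then show ?thesis using pair_act[OF assms, of "act eps (inv \<sigma>) x" y] by simp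
qed

lemma eps_inv:
  assumes "\<pi> permutes S"
  shows "eps (k \<circ> inv \<pi>) \<pi> = eps k (inv \<pi>)"
proof -
  have p: "inv \<pi> permutes S" by (rule permutes_inv[OF assms])
  have "eps k (inv \<pi>) * eps (k \<circ> inv \<pi>) \<pi> = 1"
    using eps_comp[OF p assms, of k] permutes_inv_o(2)[OF assms] by (simp add: eps_id)
  then show ?thesis using eps_cases[OF p, of k] by auto
qed

text \<open>All signs are 1 or -1, so the action is orthogonal for the standard inner product and
  the adjoint of \<open>\<pi>\<close> is its inverse.\<close>

lemma adjoint:
  assumes "\<pi> permutes S"
  shows "(\<Sum>l\<in>S \<rightarrow>\<^sub>E A. act eps \<pi> x l * y l) = (\<Sum>l\<in>S \<rightarrow>\<^sub>E A. x l * act eps (inv \<pi>) y l)"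
proof (rule sum.reindex_bij_witness[where i = "\<lambda>l. l \<circ> inv \<pi>" and j = "\<lambda>l. l \<circ> \<pi>"])
  fix l :: "'s \<Rightarrow> nat"
  show 1: "l \<circ> \<pi> \<circ> inv \<pi> = l" "l \<circ> inv \<pi> \<circ> \<pi> = l"
    using permutes_inv_o[OF assms] by (simp_all add: o_assoc[symmetric])
  show "x (l \<circ> \<pi>) * act eps (inv \<pi>) y (l \<circ> \<pi>) = act eps \<pi> x l * y l"
    using eps_inv[OF assms, of "l \<circ> \<pi>"] by (simp add: act_def 1)
qed (simp_all only: PiE_comp_permutes[OF assms] PiE_comp_permutes[OF permutes_inv[OF assms]])

text \<open>A subgroup is closed under inverses, so its symmetrization is self-adjoint.\<close>

lemma adjoint_gsum:
  "(\<Sum>l\<in>S \<rightarrow>\<^sub>E A. gsum eps (young S g) x l * y l) = (\<Sum>l\<in>S \<rightarrow>\<^sub>E A. x l * gsum eps (young S g) y l)"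
proof -
  have "(\<Sum>l\<in>S \<rightarrow>\<^sub>E A. gsum eps (young S g) x l * y l)
      = (\<Sum>\<pi>\<in>young S g. \<Sum>l\<in>S \<rightarrow>\<^sub>E A. act eps \<pi> x l * y l)"
    unfolding gsum_def sum_distrib_right by (rule sum.swap)
  also have "\<dots> = (\<Sum>\<pi>\<in>young S g. \<Sum>l\<in>S \<rightarrow>\<^sub>E A. x l * act eps (inv \<pi>) y l)"
    by (intro sum.cong refl adjoint young_permutes)
  also have "\<dots> = (\<Sum>\<pi>\<in>young S g. \<Sum>l\<in>S \<rightarrow>\<^sub>E A. x l * act eps \<pi> y l)"
    by (rule sum_young_inv)
  also have "\<dots> = (\<Sum>l\<in>S \<rightarrow>\<^sub>E A. x l * gsum eps (young S g) y l)"
    unfolding gsum_def sum_distrib_left by (rule sum.swap)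
  finally show ?thesis .
qed

lemma gsum_invariant:
  assumes "\<And>\<sigma>. \<sigma> \<in> young S g \<Longrightarrow> act eps \<sigma> x = x"
  shows "gsum eps (young S g) x = (\<lambda>k. of_nat (card (young S g)) * x k)"
  by (simp add: gsum_def assms)

lemma card_young_pos: "card (young S g) > 0"
  using finite_young[OF fin] young_id[of S g] by (auto simp: card_gt_0_iff)

end

section \<open>Duality, von Neumann's lemma and positivity\<close>

context tableau_action
begin

abbreviation "RM \<equiv> gsum eps Rg"
abbreviation "Eta \<equiv> xi eps' (\<lambda>x. \<not> Bos x) S N col"

text \<open>Exchanging rows with columns and even with odd symbols turns a statement about \<open>Xi\<close> into one
  about \<open>Eta\<close>.\<close>

lemma dual: "tableau_action S eps' eps (\<lambda>x. \<not> Bos x) col row"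
proof -
  have "eps k \<pi> = of_int (sign \<pi>) * eps' k \<pi>" if "\<pi> permutes S" for k \<pi>
    by (simp add: eps'[OF that] mult.assoc[symmetric] flip: of_int_mult)
  then show ?thesis
    using I.signed_action_axioms J.signed_action_axioms inj down pos
    by (simp add: tableau_action_def tableau_action_axioms_def) metis
qed

text \<open>All boxes above b exist, and down the column the entries rise by at least one per row,
  starting from at least 1.\<close>

lemma ex_above:
  assumes strict: "\<And>a b. a \<in> S \<Longrightarrow> b \<in> S \<Longrightarrow> col a = col b \<Longrightarrow> row a < row b \<Longrightarrow> k a < (k b :: nat)"
    and "\<And>a. a \<in> S \<Longrightarrow> 1 \<le> k a" and "b \<in> S"
  shows "row b \<le> k b"
  using assms(3)
proof (induction "row b" arbitrary: b)
  case (Suc n)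
  show ?case
  proof (cases "n = 0")
    case False
    then obtain a where "a \<in> S" "row a = n" "col a = col b"
      using down[of b n "col b"] Suc pos by auto
    then show ?thesis using Suc.hyps strict[of a b] Suc.prems by fastforce
  qed (use Suc assms(2) in \<open>simp flip: Suc.hyps(2)\<close>)
qed simp

text \<open>Sorting the row numbers \<open>row \<circ> inv \<pi>\<close> within the columns gives the column factor of \<open>\<pi>\<close>.\<close>

lemma row_column_factorization:
  assumes \<pi>: "\<pi> permutes S"
    and sep: "\<And>a b. a \<in> S \<Longrightarrow> b \<in> S \<Longrightarrow> row a = row b \<Longrightarrow> col (\<pi> a) = col (\<pi> b) \<Longrightarrow> a = b"
  obtains \<kappa> \<rho> where "\<kappa> \<in> Cg" "\<rho> \<in> Rg" "\<pi> = \<kappa> \<circ> \<rho>"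
proof -
  define k where "k = row \<circ> inv \<pi>"
  have \<pi>': "inv \<pi> permutes S" by (rule permutes_inv[OF \<pi>])
  obtain \<kappa> where \<kappa>: "\<kappa> \<in> Cg"
    and max: "\<And>\<sigma>. \<sigma> \<in> Cg \<Longrightarrow> (\<Sum>a\<in>S. row a * k (\<sigma> a)) \<le> (\<Sum>a\<in>S. row a * k (\<kappa> a))"
    using ex_maximal_young[OF I.fin] by blast
  have \<kappa>p: "\<kappa> permutes S" by (rule young_permutes[OF \<kappa>])
  define \<sigma> where "\<sigma> = inv \<pi> \<circ> \<kappa>"
  have \<sigma>: "\<sigma> permutes S" unfolding \<sigma>_def by (rule permutes_compose[OF \<kappa>p \<pi>'])
  have k\<kappa>: "k (\<kappa> a) = row (\<sigma> a)" for a by (simp add: k_def \<sigma>_def)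
  have \<pi>\<sigma>: "\<pi> (\<sigma> a) = \<kappa> a" for a using permutes_inverses(1)[OF \<pi>] by (simp add: \<sigma>_def)
  have strict: "row (\<sigma> a) < row (\<sigma> b)" if ab: "a \<in> S" "b \<in> S" "col a = col b" "row a < row b" for a b
  proof -
    have "row (\<sigma> a) \<le> row (\<sigma> b)"
      using maximal_imp_sorted[OF I.fin \<kappa> max ab] by (simp add: k\<kappa>)
    \<comment> \<open>Equality would give two positions of one row that \<open>\<pi>\<close> sends
      to one column, against \<open>sep\<close>.\<close>
    moreover have "row (\<sigma> a) \<noteq> row (\<sigma> b)"
    proof
      assume "row (\<sigma> a) = row (\<sigma> b)"
      then have "\<sigma> a = \<sigma> b"
        using ab young_apply[OF \<kappa>] permutes_in_image[OF \<sigma>] by (intro sep) (auto simp: \<pi>\<sigma>)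
      then have "a = b" using permutes_inj[OF \<sigma>] by (auto dest: injD)
      then show False using ab by simp
    qed
    ultimately show ?thesis by simp
  qed
  have le: "row a \<le> row (\<sigma> a)" if "a \<in> S" for a
    by (rule ex_above[where k = "\<lambda>a. row (\<sigma> a)", OF strict _ that])
      (use pos permutes_in_image[OF \<sigma>] in auto)
  \<comment> \<open>Equal sums turn the inequalities \<open>le\<close> into equalities, so
    \<open>\<sigma>\<close> preserves rows.\<close>
  have "(\<Sum>a\<in>S. row (\<sigma> a)) = (\<Sum>a\<in>S. row a)" by (subst (2) sum.permute[OF \<sigma>]) simp
  then have "row (\<sigma> a) = row a" if "a \<in> S" for a
    using sum_mono_inv[of row S "\<lambda>a. row (\<sigma> a)" a] le that I.fin by simp
  then have "\<sigma> \<in> Rg" using \<sigma> by (simp add: young_def)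
  then have "inv \<sigma> \<in> Rg" by (rule young_inv)
  moreover have "\<pi> = \<kappa> \<circ> inv \<sigma>"
  proof
    fix a
    show "\<pi> a = (\<kappa> \<circ> inv \<sigma>) a" using \<pi>\<sigma>[of "inv \<sigma> a"] permutes_inverses(1)[OF \<sigma>] by simp
  qed
  ultimately show thesis using that[OF \<kappa>] by blast
qed

text \<open>Without a factorization \<open>\<pi>\<close> sends two positions of one row to one
  column. Their exchange fixes x, so the exchange of the images fixes the moved tensor, and the
  column sum kills it.\<close>

lemma CM_act_zero:
  assumes \<pi>: "\<pi> permutes S" and no: "\<pi> \<notin> (\<lambda>(\<kappa>, \<rho>). \<kappa> \<circ> \<rho>) ` (Cg \<times> Rg)"
    and inv: "\<And>\<rho>. \<rho> \<in> Rg \<Longrightarrow> act eps \<rho> x = x"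
  shows "CM (act eps \<pi> x) = (\<lambda>_. 0)"
proof -
  have "\<exists>a b. a \<in> S \<and> b \<in> S \<and> row a = row b \<and> col (\<pi> a) = col (\<pi> b) \<and> a \<noteq> b"
  proof (rule ccontr)
    assume "\<not> ?thesis"
    then obtain \<kappa> \<rho> where "\<kappa> \<in> Cg" "\<rho> \<in> Rg" "\<pi> = \<kappa> \<circ> \<rho>"
      using row_column_factorization[OF \<pi>] by metis
    then show False using no by auto
  qed
  then obtain a b where ab: "a \<in> S" "b \<in> S" "row a = row b" "col (\<pi> a) = col (\<pi> b)" "a \<noteq> b" by blast
  have inj: "inj \<pi>" by (rule permutes_inj[OF \<pi>])
  have S: "\<pi> a \<in> S" "\<pi> b \<in> S" using ab permutes_in_image[OF \<pi>] by auto
  have t: "transpose a b \<in> Rg" by (rule young_transpose[OF ab(1-3)])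
  have "transpose (\<pi> a) (\<pi> b) \<circ> \<pi> = \<pi> \<circ> transpose a b"
    using inj by (auto simp: fun_eq_iff transpose_def dest: injD)
  then have "act eps (transpose (\<pi> a) (\<pi> b)) (act eps \<pi> x) = act eps \<pi> x"
    using I.act_comp[OF permutes_swap_id[OF S] \<pi>, of x] I.act_comp[OF \<pi> young_permutes[OF t], of x] inv[OF t]
    by simp
  then show ?thesis using CM_kill[OF S] ab inj by (auto dest: injD)
qed

lemma act_sign:
  assumes "\<kappa> permutes S"
  shows "act eps' \<kappa> x = (\<lambda>k. of_int (sign \<kappa>) * act eps \<kappa> x k)"
  by (simp add: act_def eps'[OF assms] mult.assoc)

lemma sign_sq: "of_int (sign \<kappa>) * (of_int (sign \<kappa>) * (c::rat)) = c"
  by (simp add: mult.assoc[symmetric] flip: of_int_mult)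

lemma CM_act_factor:
  assumes \<kappa>: "\<kappa> \<in> Cg" and \<rho>: "\<rho> \<in> Rg" and inv: "\<And>\<rho>. \<rho> \<in> Rg \<Longrightarrow> act eps \<rho> x = x"
  shows "CM (act eps (\<kappa> \<circ> \<rho>) x) = (\<lambda>k. of_int (sign \<kappa>) * CM x k)"
proof -
  have \<kappa>p: "\<kappa> permutes S" by (rule young_permutes[OF \<kappa>])
  have "act eps (\<kappa> \<circ> \<rho>) x = act eps \<kappa> x"
    using I.act_comp[OF \<kappa>p young_permutes[OF \<rho>], of x] inv[OF \<rho>] by simp
  also have "\<dots> = (\<lambda>k. of_int (sign \<kappa>) * act eps' \<kappa> x k)" by (simp add: act_sign[OF \<kappa>p] sign_sq)
  finally have "CM (act eps (\<kappa> \<circ> \<rho>) x) = (\<lambda>k. of_int (sign \<kappa>) * CM (act eps' \<kappa> x) k)" by (simp add: gsum_scale)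
  then show ?thesis by (simp add: J.gsum_act_young[OF \<kappa>])
qed

text \<open>A permutation in both groups preserves the row and the column of every position, hence
  is the identity.\<close>

lemma inj_factor: "inj_on (\<lambda>(\<kappa>, \<rho>). \<kappa> \<circ> \<rho>) (Cg \<times> Rg)"
proof (rule inj_onI, clarify)
  fix \<kappa> \<rho> \<kappa>' \<rho>' assume *: "\<kappa> \<in> Cg" "\<rho> \<in> Rg" "\<kappa>' \<in> Cg" "\<rho>' \<in> Rg" "\<kappa> \<circ> \<rho> = \<kappa>' \<circ> \<rho>'"
  have 1: "inv \<kappa>' \<circ> \<kappa> = \<rho>' \<circ> inv \<rho>"
  proof -
    have "inv \<kappa>' \<circ> (\<kappa> \<circ> \<rho>) \<circ> inv \<rho> = inv \<kappa>' \<circ> (\<kappa>' \<circ> \<rho>') \<circ> inv \<rho>" using * by simp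
    then have "inv \<kappa>' \<circ> \<kappa> \<circ> (\<rho> \<circ> inv \<rho>) = (inv \<kappa>' \<circ> \<kappa>') \<circ> \<rho>' \<circ> inv \<rho>" by (simp add: o_assoc)
    then show ?thesis using inv_o_young[OF *(2)] inv_o_young[OF *(3)] by simp
  qed
  let ?\<tau> = "inv \<kappa>' \<circ> \<kappa>"
  have C: "?\<tau> \<in> Cg" by (intro young_comp young_inv *)
  have R: "?\<tau> \<in> Rg" unfolding 1 by (intro young_comp young_inv *)
  have "?\<tau> a = a" for a
  proof (cases "a \<in> S")
    case True
    then show ?thesis using inj[OF young_in[OF C] _ young_apply[OF R] young_apply[OF C]] by blast
  qed (use permutes_not_in[OF young_permutes[OF C]] in blast)
  then have \<tau>: "?\<tau> = id" by auto
  have "\<kappa> = \<kappa>' \<circ> ?\<tau>" using inv_o_young(2)[OF *(3)] by (simp add: o_assoc)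
  then have "\<kappa> = \<kappa>'" unfolding \<tau> by simp
  moreover have "\<rho>' = \<rho>' \<circ> inv \<rho> \<circ> \<rho>" using inv_o_young(1)[OF *(2)] by (simp add: o_assoc[symmetric])
  then have "\<rho>' = \<rho>" using \<tau> 1 by simp
  ultimately show "\<kappa> = \<kappa>' \<and> \<rho> = \<rho>'" by simp
qed

text \<open>Only products of a column and a row permutation survive. The row part is absorbed by x,
  the column part leaves its sign, and this sign turns \<open>eps\<close> into \<open>eps'\<close>
  on the right, so the remaining double sum is \<open>CM\<close> after \<open>RM\<close>.\<close>

lemma CM_pair:
  assumes inv: "\<And>\<rho>. \<rho> \<in> Rg \<Longrightarrow> act eps \<rho> x = x"
  shows "CM (\<lambda>k. pair eps S x y k l) k = CM x k * CM (RM y) l"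
proof -
  let ?U = "young S (\<lambda>_. ())" and ?f = "\<lambda>(\<kappa>, \<rho>). \<kappa> \<circ> \<rho>"
  have finU: "finite ?U" by (rule finite_young[OF I.fin])
  have "CM (\<lambda>k. pair eps S x y k l) k = (\<Sum>\<pi>\<in>?U. act eps \<pi> y l * CM (act eps \<pi> x) k)"
    unfolding pair_def by (subst mult.commute) (simp only: gsum_sum)
  also have "\<dots> = (\<Sum>\<pi>\<in>?f ` (Cg \<times> Rg). act eps \<pi> y l * CM (act eps \<pi> x) k)"
  proof (rule sum.mono_neutral_right[OF finU])
    show "?f ` (Cg \<times> Rg) \<subseteq> ?U"
      by (auto intro!: permutes_young permutes_compose dest: young_permutes)
    show "\<forall>\<pi>\<in>?U - ?f ` (Cg \<times> Rg). act eps \<pi> y l * CM (act eps \<pi> x) k = 0"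
      using CM_act_zero[OF young_permutes _ inv] by (metis DiffD1 DiffD2 mult_zero_right)
  qed
  also have "\<dots> = (\<Sum>(\<kappa>, \<rho>)\<in>Cg \<times> Rg. act eps (\<kappa> \<circ> \<rho>) y l * CM (act eps (\<kappa> \<circ> \<rho>) x) k)"
    by (subst sum.reindex[OF inj_factor]) (simp add: case_prod_unfold)
  also have "\<dots> = (\<Sum>(\<kappa>, \<rho>)\<in>Cg \<times> Rg. CM x k * act eps' \<kappa> (act eps \<rho> y) l)"
  proof (rule sum.cong[OF refl], clarify)
    fix \<kappa> \<rho> assume "\<kappa> \<in> Cg" "\<rho> \<in> Rg"
    then show "act eps (\<kappa> \<circ> \<rho>) y l * CM (act eps (\<kappa> \<circ> \<rho>) x) k = CM x k * act eps' \<kappa> (act eps \<rho> y) l"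
      using CM_act_factor[OF _ _ inv] by (simp add: act_sign I.act_comp young_permutes)
  qed
  also have "\<dots> = (\<Sum>\<kappa>\<in>Cg. \<Sum>\<rho>\<in>Rg. CM x k * act eps' \<kappa> (act eps \<rho> y) l)"
    by (rule sum.cartesian_product[symmetric])
  also have "\<dots> = CM x k * CM (RM y) l"
    by (simp add: gsum_def act_def sum_distrib_left)
  finally show ?thesis .
qed

text \<open>The inner product of \<open>CM (RM v)\<close> with \<open>v\<close> is a positive multiple of that of \<open>RM v\<close> with itself.\<close>

lemma RM_zero:
  assumes inv: "\<And>\<kappa>. \<kappa> \<in> Cg \<Longrightarrow> act eps' \<kappa> v = v" and zero: "CM (RM v) = (\<lambda>_. 0)"
    and supp: "\<And>k. v k \<noteq> 0 \<Longrightarrow> k \<in> MI"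
  shows "RM v k = 0"
proof -
  have "0 = (\<Sum>l\<in>MI. CM (RM v) l * v l)" by (simp add: zero)
  also have "\<dots> = (\<Sum>l\<in>MI. RM v l * CM v l)" by (rule J.adjoint_gsum)
  also have "\<dots> = of_nat (card Cg) * (\<Sum>l\<in>MI. RM v l * v l)"
    by (simp add: J.gsum_invariant[OF inv] sum_distrib_left mult.left_commute)
  finally have "(\<Sum>l\<in>MI. v l * RM v l) = 0" using J.card_young_pos[of col] by (simp add: mult.commute)
  moreover have "(\<Sum>l\<in>MI. RM v l * RM v l) = (\<Sum>l\<in>MI. v l * RM (RM v) l)" by (rule I.adjoint_gsum)
  moreover have "RM (RM v) = (\<lambda>k. of_nat (card Rg) * RM v k)" by (rule I.gsum_invariant[OF I.act_gsum_young])
  moreover have "(\<Sum>l\<in>MI. v l * (of_nat (card Rg) * RM v l)) = of_nat (card Rg) * (\<Sum>l\<in>MI. v l * RM v l)"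
    by (simp add: sum_distrib_left mult.left_commute)
  ultimately have "(\<Sum>l\<in>MI. RM v l * RM v l) = 0" by simp
  \<comment> \<open>A sum of rational squares vanishes only if every square does.\<close>
  then have "\<forall>l\<in>MI. RM v l * RM v l = 0" by (subst (asm) sum_nonneg_eq_0_iff[OF finite_MI]) auto
  moreover have "RM v k = 0" if "k \<notin> MI"
  proof -
    have "v (k \<circ> \<rho>) = 0" if "\<rho> \<in> Rg" for \<rho>
      using supp[of "k \<circ> \<rho>"] PiE_comp_permutes[OF young_permutes[OF that], of k] \<open>k \<notin> MI\<close> by auto
    then show ?thesis by (simp add: gsum_def act_def)
  qed
  ultimately show ?thesis by fastforce
qed

lemma Eta_support: "Eta j k \<noteq> 0 \<Longrightarrow> j \<in> MI \<Longrightarrow> k \<in> MI"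
  using J.xi_support[of N col j k] PiE_comp_permutes[OF young_permutes] by metis

theorem pair_independent:
  assumes zero: "\<And>k l. (\<Sum>i\<in>SST. \<Sum>j\<in>SST. c i j * pair eps S (Xi i) (Eta j) k l) = 0"
    and i: "i \<in> SST" and j: "j \<in> SST"
  shows "c i j = 0"
proof -
  interpret D: tableau_action S eps' eps "\<lambda>x. \<not> Bos x" col row N by (rule dual)
  let ?v = "\<lambda>k. \<Sum>j\<in>SST. c i j * Eta j k"
  have D_SST: "D.SST = SST" by (simp add: SST_def D.SST_def sst_dual)
  have "(\<Sum>i\<in>SST. (\<Sum>j\<in>SST. c i j * CM (RM (Eta j)) l) * CM (Xi i) k) = 0" for k l
  proof -
    have "0 = CM (\<lambda>k. \<Sum>i\<in>SST. 1 * (\<Sum>j\<in>SST. c i j * pair eps S (Xi i) (Eta j) k l)) k"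
      by (simp add: zero gsum_def act_def)
    also have "\<dots> = (\<Sum>i\<in>SST. \<Sum>j\<in>SST. c i j * CM (\<lambda>k. pair eps S (Xi i) (Eta j) k l) k)"
      unfolding gsum_sum by simp
    also have "\<dots> = (\<Sum>i\<in>SST. \<Sum>j\<in>SST. c i j * (CM (Xi i) k * CM (RM (Eta j)) l))"
      by (simp add: CM_pair I.act_xi)
    finally show ?thesis unfolding sum_distrib_right by (simp add: mult.assoc mult.commute mult.left_commute)
  qed
  then have "(\<Sum>j\<in>SST. c i j * CM (RM (Eta j)) l) = 0" for l by (rule CM_Xi_independent[OF _ i])
  then have "CM (RM ?v) = (\<lambda>_. 0)" by (simp add: gsum_sum)
  then have "RM ?v k = 0" for k
  proof (rule RM_zero[rotated 1])
    show "act eps' \<kappa> ?v = ?v" if "\<kappa> \<in> Cg" for \<kappa> unfolding act_sum by (simp add: J.act_xi[OF that])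
    show "k \<in> MI" if "?v k \<noteq> 0" for k
      using that Eta_support SST_MI by (metis (mono_tags, lifting) mult_zero_right sum.neutral)
  qed
  \<comment> \<open>In the dual setting \<open>D.CM\<close> is \<open>RM\<close> and
    \<open>D.Xi\<close> is \<open>Eta\<close>, so independence applies once more.\<close>
  then have "(\<Sum>j\<in>D.SST. c i j * D.CM (Eta j) k) = 0" for k by (simp add: gsum_sum D_SST)
  then show ?thesis by (rule D.CM_Xi_independent) (simp add: D_SST j)
qed

text \<open>As y is alternating under the columns, its column sum is a multiple of y. Moving the
  column permutations to the left factor replaces x by \<open>CM x\<close>.\<close>

lemma pair_CM_zero:
  assumes x: "CM x = (\<lambda>_. 0)" and y: "\<And>\<kappa>. \<kappa> \<in> Cg \<Longrightarrow> act eps' \<kappa> y = y"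
  shows "pair eps S x y k l = 0"
proof -
  have swap: "pair eps S x (act eps' \<kappa> y) k l = pair eps S (act eps' (inv \<kappa>) x) y k l" if "\<kappa> \<in> Cg" for \<kappa>
  proof -
    have \<kappa>: "\<kappa> permutes S" by (rule young_permutes[OF that])
    have "sign (inv \<kappa>) = sign \<kappa>"
      using \<kappa> I.fin by (meson permutation_permutes sign_inverse)
    then have "pair eps S x (act eps' \<kappa> y) k l = of_int (sign \<kappa>) * pair eps S x (act eps \<kappa> y) k l"
      "pair eps S (act eps' (inv \<kappa>) x) y k l = of_int (sign \<kappa>) * pair eps S (act eps (inv \<kappa>) x) y k l"
      by (simp_all add: act_sign[OF \<kappa>] act_sign[OF permutes_inv[OF \<kappa>]] pair_def act_scale
          sum_distrib_left mult.assoc mult.left_commute)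
    then show ?thesis using I.pair_act_right[OF \<kappa>] by simp
  qed
  have "of_nat (card Cg) * pair eps S x y k l = (\<Sum>\<kappa>\<in>Cg. pair eps S x (act eps' \<kappa> y) k l)"
    by (simp add: y)
  also have "\<dots> = (\<Sum>\<kappa>\<in>Cg. pair eps S (act eps' (inv \<kappa>) x) y k l)" by (rule sum.cong) (auto simp: swap)
  also have "\<dots> = (\<Sum>\<kappa>\<in>Cg. 1 * pair eps S (act eps' \<kappa> x) y k l)" by (simp add: sum_young_inv[where F = "\<lambda>\<kappa>. pair eps S (act eps' \<kappa> x) y k l"])
  also have "\<dots> = pair eps S (\<lambda>k. \<Sum>\<kappa>\<in>Cg. 1 * act eps' \<kappa> x k) y k l" by (rule pair_sum_left[symmetric])
  also have "(\<lambda>k. \<Sum>\<kappa>\<in>Cg. 1 * act eps' \<kappa> x k) = (\<lambda>_. 0)" using x by (simp add: gsum_def)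
  finally show ?thesis using J.card_young_pos[of col] by (simp add: pair_def act_def)
qed

text \<open>The coefficients are chosen before j, because the right factor is straightened
  afterwards inside the same sum.\<close>

lemma pair_straighten_left:
  assumes "i \<in> MI"
  shows "\<exists>n :: ('s \<Rightarrow> nat) \<Rightarrow> int. \<forall>j k l.
    pair eps S (Xi i) (Eta j) k l = (\<Sum>s\<in>SST. of_int (n s) * pair eps S (Xi s) (Eta j) k l)"
proof -
  obtain n :: "('s \<Rightarrow> nat) \<Rightarrow> int" where n: "\<forall>k. CM (Xi i) k = (\<Sum>s\<in>SST. of_int (n s) * CM (Xi s) k)"
    using straighten[OF assms] ..
  have "pair eps S (Xi i) (Eta j) k l = (\<Sum>s\<in>SST. of_int (n s) * pair eps S (Xi s) (Eta j) k l)" for j k l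
  proof -
    \<comment> \<open>The difference of the two tensors, written as a sum over the truth values so
      that linearity for sums also covers subtraction.\<close>
    let ?x = "\<lambda>k. \<Sum>b\<in>UNIV. (if b then 1 else - 1) * (if b then Xi i k else (\<Sum>s\<in>SST. of_int (n s) * Xi s k))"
    let ?y = "\<lambda>b k. if b then Xi i k else (\<Sum>s\<in>SST. of_int (n s) * Xi s k)"
    have "CM ?x = (\<lambda>k. \<Sum>b\<in>UNIV. (if b then 1 else - 1) * CM (?y b) k)" by (rule gsum_sum)
    also have "\<dots> = (\<lambda>_. 0)" by (simp add: UNIV_bool gsum_sum n)
    finally have "pair eps S ?x (Eta j) k l = 0" by (rule pair_CM_zero) (rule J.act_xi)
    also have "pair eps S ?x (Eta j) k l = (\<Sum>b\<in>UNIV. (if b then 1 else - 1) * pair eps S (?y b) (Eta j) k l)"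
      by (rule pair_sum_left)
    finally show ?thesis by (simp add: UNIV_bool pair_sum_left)
  qed
  then show ?thesis by blast
qed

text \<open>The sign of \<open>\<pi>\<close> enters once in each factor and cancels.\<close>

lemma pair_dual: "pair eps' S x y k l = pair eps S x y k l"
  unfolding pair_def by (rule sum.cong) (auto simp: act_sign young_permutes sign_sq mult.assoc mult.left_commute)

theorem pair_straighten:
  assumes "i \<in> MI" "j \<in> MI"
  shows "\<exists>n :: ('s \<Rightarrow> nat) \<Rightarrow> ('s \<Rightarrow> nat) \<Rightarrow> int. \<forall>k l. pair eps S (Xi i) (Eta j) k l
    = (\<Sum>s\<in>SST. \<Sum>t\<in>SST. of_int (n s t) * pair eps S (Xi s) (Eta t) k l)"
proof -
  interpret D: tableau_action S eps' eps "\<lambda>x. \<not> Bos x" col row N by (rule dual)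
  have D_SST: "D.SST = SST" by (simp add: SST_def D.SST_def sst_dual)
  have D_Eta: "D.Eta = Xi" by simp
  obtain n :: "('s \<Rightarrow> nat) \<Rightarrow> int" where n: "\<forall>j k l. pair eps S (Xi i) (Eta j) k l
      = (\<Sum>s\<in>SST. of_int (n s) * pair eps S (Xi s) (Eta j) k l)"
    using pair_straighten_left[OF assms(1)] ..
  obtain n' :: "('s \<Rightarrow> nat) \<Rightarrow> int" where "\<forall>i k l. pair eps' S (Eta j) (D.Eta i) k l
      = (\<Sum>s\<in>D.SST. of_int (n' s) * pair eps' S (Eta s) (D.Eta i) k l)"
    using D.pair_straighten_left[OF assms(2)] ..
  then have n': "pair eps S (Xi s) (Eta j) k l = (\<Sum>t\<in>SST. of_int (n' t) * pair eps S (Xi s) (Eta t) k l)" for s k l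
    unfolding pair_dual D_SST D_Eta by (metis (no_types, lifting) pair_commute sum.cong)
  have "pair eps S (Xi i) (Eta j) k l
    = (\<Sum>s\<in>SST. \<Sum>t\<in>SST. of_int (n s * n' t) * pair eps S (Xi s) (Eta t) k l)" for k l
  proof -
    have "pair eps S (Xi i) (Eta j) k l = (\<Sum>s\<in>SST. of_int (n s) * pair eps S (Xi s) (Eta j) k l)"
      using n by blast
    also have "\<dots> = (\<Sum>s\<in>SST. of_int (n s) * (\<Sum>t\<in>SST. of_int (n' t) * pair eps S (Xi s) (Eta t) k l))"
      by (intro sum.cong refl arg_cong2[where f = "(*)"] n')
    finally show ?thesis by (simp add: sum_distrib_left mult.assoc)
  qed
  then show ?thesis by (intro exI[of _ "\<lambda>s t. n s * n' t"]) blast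
qed

end


section \<open>The sign of the action on multiindices\<close>

definition seps :: "nat \<Rightarrow> nat \<Rightarrow> (nat \<Rightarrow> nat) \<Rightarrow> (nat \<Rightarrow> nat) \<Rightarrow> rat"
  where "seps m r k \<pi> = fst (signed_act m r k \<pi>)"

lemma seps_card: "seps m r k \<pi> = (- 1) ^ card {(a, b). a \<in> {1..r} \<and> b \<in> {1..r} \<and> a < b \<and> \<pi> a > \<pi> b
                         \<and> k (\<pi> a) > m \<and> k (\<pi> b) > m}"
  by (simp add: seps_def signed_act_def)

lemma seps_sq: "seps m r k \<pi> * seps m r k \<pi> = 1"
  unfolding seps_card by (simp add: power_mult_distrib[symmetric])

text \<open>The factor of a pair of positions, written so as to be symmetric in the pair.\<close>

definition pair_sign :: "nat \<Rightarrow> (nat \<Rightarrow> nat) \<Rightarrow> (nat \<Rightarrow> nat) \<Rightarrow> nat \<Rightarrow> nat \<Rightarrow> rat"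
  where "pair_sign m k \<pi> a b =
    (if k (\<pi> a) > m \<and> k (\<pi> b) > m \<and> (a < b) \<noteq> (\<pi> a < \<pi> b) then - 1 else 1)"

definition ordered_pairs :: "nat \<Rightarrow> (nat \<times> nat) set"
  where "ordered_pairs r = {(a, b). a \<in> {1..r} \<and> b \<in> {1..r} \<and> a < b}"

lemma finite_ordered_pairs: "finite (ordered_pairs r)"
  by (rule finite_subset[of _ "{1..r} \<times> {1..r}"]) (auto simp: ordered_pairs_def)

lemma seps_prod:
  assumes "\<pi> permutes {1..r}"
  shows "seps m r k \<pi> = (\<Prod>(a, b)\<in>ordered_pairs r. pair_sign m k \<pi> a b)"
proof -
  have inj: "\<pi> a = \<pi> b \<longleftrightarrow> a = b" for a b using permutes_inj[OF assms] by (auto dest: injD)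
  let ?P = "\<lambda>(a, b). k (\<pi> a) > m \<and> k (\<pi> b) > m \<and> (a < b) \<noteq> (\<pi> a < \<pi> b)"
  have "(\<Prod>(a, b)\<in>ordered_pairs r. pair_sign m k \<pi> a b)
      = (\<Prod>x\<in>ordered_pairs r. if ?P x then - 1 else 1)"
    by (rule prod.cong) (simp_all add: pair_sign_def case_prod_unfold)
  also have "\<dots> = (- 1) ^ card {x\<in>ordered_pairs r. ?P x}"
    by (subst prod.inter_filter[OF finite_ordered_pairs, symmetric]) simp
  also have "{x\<in>ordered_pairs r. ?P x} = {(a, b). a \<in> {1..r} \<and> b \<in> {1..r} \<and> a < b \<and> \<pi> a > \<pi> b
                         \<and> k (\<pi> a) > m \<and> k (\<pi> b) > m}"
    using inj by (auto simp: ordered_pairs_def not_less le_less)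
  finally show ?thesis by (simp only: seps_card)
qed

text \<open>The factors are multiplicative: under the composite, a pair contributes its factor under
  \<open>\<sigma>\<close> times that of its image under \<open>\<pi>\<close>. As
  \<open>\<sigma>\<close> permutes the unordered pairs, the images run through all of them.\<close>

lemma seps_comp:
  assumes \<pi>: "\<pi> permutes {1..r}" and \<sigma>: "\<sigma> permutes {1..r}"
  shows "seps m r k (\<pi> \<circ> \<sigma>) = seps m r k \<pi> * seps m r (k \<circ> \<pi>) \<sigma>"
proof -
  have \<pi>\<sigma>: "\<pi> \<circ> \<sigma> permutes {1..r}" by (rule permutes_compose[OF \<sigma> \<pi>])
  have inj: "\<pi> a = \<pi> b \<longleftrightarrow> a = b" for a b using permutes_inj[OF \<pi>] by (auto dest: injD)
  have sym: "pair_sign m k \<pi> a b = pair_sign m k \<pi> b a" for a b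
    using inj[of a b] by (auto simp: pair_sign_def not_less le_less)
  \<comment> \<open>The image of a pair, put back into increasing order.\<close>
  let ?g = "\<lambda>\<tau> (a, b). if \<tau> a < \<tau> b then (\<tau> a, \<tau> b) else (\<tau> b, \<tau> a :: nat)"
  have g_in: "?g \<tau> x \<in> ordered_pairs r" if \<tau>: "\<tau> permutes {1..r}" and x: "x \<in> ordered_pairs r" for \<tau> x
  proof -
    obtain a b where x: "x = (a, b)" "a \<in> {1..r}" "b \<in> {1..r}" "a < b" using x by (auto simp: ordered_pairs_def)
    have "\<tau> a \<in> {1..r}" "\<tau> b \<in> {1..r}" using x permutes_in_image[OF \<tau>] by blast+
    moreover have "\<tau> a \<noteq> \<tau> b" using permutes_inj[OF \<tau>] x by (auto dest: injD)
    ultimately show ?thesis using x by (auto simp: ordered_pairs_def)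
  qed
  have g_inv: "?g \<tau>' (?g \<tau> x) = x" if \<tau>: "\<tau> permutes {1..r}" and x: "x \<in> ordered_pairs r" and inv: "\<And>a. \<tau>' (\<tau> a) = a" for \<tau> \<tau>' x
  proof -
    obtain a b where x: "x = (a, b)" "a < b" using x by (auto simp: ordered_pairs_def)
    moreover have "\<tau> a \<noteq> \<tau> b" using permutes_inj[OF \<tau>] x by (auto dest: injD)
    ultimately show ?thesis using inv by auto
  qed
  have "seps m r k (\<pi> \<circ> \<sigma>) = (\<Prod>(a, b)\<in>ordered_pairs r. pair_sign m k \<pi> (\<sigma> a) (\<sigma> b) * pair_sign m (k \<circ> \<pi>) \<sigma> a b)"
    unfolding seps_prod[OF \<pi>\<sigma>] by (rule prod.cong) (auto simp: pair_sign_def)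
  also have "\<dots> = (\<Prod>(a, b)\<in>ordered_pairs r. pair_sign m k \<pi> (\<sigma> a) (\<sigma> b)) * seps m r (k \<circ> \<pi>) \<sigma>"
    unfolding seps_prod[OF \<sigma>] by (simp add: case_prod_unfold prod.distrib)
  also have "(\<Prod>(a, b)\<in>ordered_pairs r. pair_sign m k \<pi> (\<sigma> a) (\<sigma> b)) = (\<Prod>(a, b)\<in>ordered_pairs r. pair_sign m k \<pi> a b)"
  proof (rule prod.reindex_bij_witness[where i = "?g (inv \<sigma>)" and j = "?g \<sigma>"])
    fix x assume x: "x \<in> ordered_pairs r"
    show "?g \<sigma> x \<in> ordered_pairs r" by (rule g_in[OF \<sigma> x])
    show "?g (inv \<sigma>) x \<in> ordered_pairs r" by (rule g_in[OF permutes_inv[OF \<sigma>] x])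
    show "?g (inv \<sigma>) (?g \<sigma> x) = x" by (rule g_inv[OF \<sigma> x]) (rule permutes_inverses(2)[OF \<sigma>])
    show "?g \<sigma> (?g (inv \<sigma>) x) = x" by (rule g_inv[OF permutes_inv[OF \<sigma>] x]) (rule permutes_inverses(1)[OF \<sigma>])
    show "(case ?g \<sigma> x of (a, b) \<Rightarrow> pair_sign m k \<pi> a b) = (case x of (a, b) \<Rightarrow> pair_sign m k \<pi> (\<sigma> a) (\<sigma> b))"
      using sym by (auto split: prod.splits if_splits)
  qed
  also have "\<dots> = seps m r k \<pi>" by (rule seps_prod[OF \<pi>, symmetric])
  finally show ?thesis .
qed

text \<open>Besides (a, b), the inverted pairs are (a, c) and (c, b) for c strictly between. Each
  odd entry there contributes two of them, so only the pair (a, b) decides the sign.\<close>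

lemma seps_transpose_less:
  assumes ab: "a \<in> {1..r}" "b \<in> {1..r}" "a < b" "k a = k b"
  shows "seps m r k (transpose a b) = (if k a \<le> m then 1 else - 1)"
proof -
  let ?t = "transpose a b"
  let ?I = "{(c, d). c \<in> {1..r} \<and> d \<in> {1..r} \<and> c < d \<and> ?t c > ?t d \<and> k (?t c) > m \<and> k (?t d) > m}"
  have kt: "k (?t c) = k c" for c using ab by (auto simp: transpose_def)
  show ?thesis
  proof (cases "k a \<le> m")
    case True
    have I: "?I = {}" unfolding kt using True ab by (auto simp: transpose_def split: if_splits)
    have "seps m r k ?t = (- 1) ^ card ?I" by (rule seps_card)
    then show ?thesis unfolding I using True by simp
  next
    case False
    let ?X = "{c \<in> {a<..<b}. m < k c}"
    have I: "?I = insert (a, b) (Pair a ` ?X \<union> (\<lambda>c. (c, b)) ` ?X)"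
    proof (intro equalityI subsetI)
      fix x assume "x \<in> ?I"
      then obtain c d where x: "x = (c, d)" "c < d" "?t c > ?t d" "m < k c" "m < k d" unfolding kt by auto
      then show "x \<in> insert (a, b) (Pair a ` ?X \<union> (\<lambda>c. (c, b)) ` ?X)"
        using ab(3) by (auto simp: transpose_def split: if_splits)
    next
      fix x assume x: "x \<in> insert (a, b) (Pair a ` ?X \<union> (\<lambda>c. (c, b)) ` ?X)"
      then consider "x = (a, b)" | c where "x = (a, c)" "a < c" "c < b" "m < k c" | c where "x = (c, b)" "a < c" "c < b" "m < k c" by auto
      then show "x \<in> ?I" unfolding kt using ab False by cases (auto simp: transpose_def)
    qed
    have fin: "finite ?X" by simp
    have "card (Pair a ` ?X \<union> (\<lambda>c. (c, b)) ` ?X) = card (Pair a ` ?X) + card ((\<lambda>c. (c, b)) ` ?X)"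
      by (rule card_Un_disjoint) auto
    then have "card (Pair a ` ?X \<union> (\<lambda>c. (c, b)) ` ?X) = 2 * card ?X"
      by (simp add: card_image inj_on_def)
    moreover have "(a, b) \<notin> Pair a ` ?X \<union> (\<lambda>c. (c, b)) ` ?X" by auto
    ultimately have "card ?I = Suc (2 * card ?X)" unfolding I using fin by simp
    moreover have "seps m r k ?t = (- 1) ^ card ?I" by (rule seps_card)
    ultimately show ?thesis using False by (simp only: power_Suc power_mult) simp
  qed
qed

lemma seps_transpose:
  assumes "a \<in> {1..r}" "b \<in> {1..r}" "a \<noteq> b" "k a = k b"
  shows "seps m r k (transpose a b) = (if k a \<le> m then 1 else - 1)"
  using seps_transpose_less[of a r b k m] seps_transpose_less[of b r a k m] assms
  by (cases "a < b") (auto simp: transpose_commute[of b a])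

lemma seps_adjacent:
  assumes "t \<in> {1..r}" "Suc t \<in> {1..r}"
  shows "seps m r k (transpose t (Suc t)) = (- 1) ^ (parity m (k t) * parity m (k (Suc t)))"
proof -
  let ?t = "transpose t (Suc t)"
  have "{(a, b). a \<in> {1..r} \<and> b \<in> {1..r} \<and> a < b \<and> ?t a > ?t b \<and> k (?t a) > m \<and> k (?t b) > m}
      = (if k t > m \<and> k (Suc t) > m then {(t, Suc t)} else {})"
    using assms by (auto simp: transpose_def split: if_splits)
  then show ?thesis unfolding seps_card by (simp add: parity_def)
qed

lemma signed_action_seps: "signed_action {1..r} (seps m r) (\<lambda>x. x \<le> m)"
  by standard (use seps_comp seps_transpose seps_sq in auto)

lemma signed_action_sign_seps: "signed_action {1..r} (\<lambda>k \<pi>. of_int (sign \<pi>) * seps m r k \<pi>) (\<lambda>x. \<not> x \<le> m)"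
proof
  show "of_int (sign \<pi>) * seps m r k \<pi> * (of_int (sign \<pi>) * seps m r k \<pi>) = 1" for k \<pi>
  proof -
    have 1: "of_int (sign \<pi>) * of_int (sign \<pi>) = (1::rat)" by (simp flip: of_int_mult)
    have "of_int (sign \<pi>) * seps m r k \<pi> * (of_int (sign \<pi>) * seps m r k \<pi>)
        = of_int (sign \<pi>) * of_int (sign \<pi>) * (seps m r k \<pi> * seps m r k \<pi>)" by (simp only: ac_simps)
    then show ?thesis unfolding seps_sq 1 by simp
  qed
next
  fix \<pi> \<sigma> :: "nat \<Rightarrow> nat" and k :: "nat \<Rightarrow> nat"
  assume p: "\<pi> permutes {1..r}" "\<sigma> permutes {1..r}"
  then have "permutation \<pi>" "permutation \<sigma>" by (meson finite_atLeastAtMost permutation_permutes)+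
  then show "of_int (sign (\<pi> \<circ> \<sigma>)) * seps m r k (\<pi> \<circ> \<sigma>)
      = of_int (sign \<pi>) * seps m r k \<pi> * (of_int (sign \<sigma>) * seps m r (k \<circ> \<pi>) \<sigma>)"
    using p by (simp add: sign_compose seps_comp)
next
  fix a b :: nat and k :: "nat \<Rightarrow> nat"
  assume "a \<in> {1..r}" "b \<in> {1..r}" "a \<noteq> b" "k a = k b"
  then show "of_int (sign (transpose a b)) * seps m r k (transpose a b) = (if \<not> k a \<le> m then 1 else - 1)"
    using seps_transpose[of a r b k m] by (simp add: sign_swap_id)
qed simp


section \<open>The superalgebra as a quotient of the free algebra\<close>

alias single = Poly_Mapping.single
alias keys = Poly_Mapping.keys
alias lookup = Poly_Mapping.lookup

lemma poly_mapping_sum_single: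
  fixes f :: "'a \<Rightarrow>\<^sub>0 'b::comm_monoid_add"
  assumes "finite A" "keys f \<subseteq> A"
  shows "f = (\<Sum>w\<in>A. single w (lookup f w))"
proof (rule poly_mapping_eqI)
  fix v
  have "lookup (\<Sum>w\<in>A. single w (lookup f w)) v
      = (\<Sum>w\<in>A. if w = v then lookup f w else 0)"
    unfolding lookup_sum by (rule sum.cong) (simp_all add: lookup_single when_def)
  also have "\<dots> = lookup f v"
    using assms by (auto simp: in_keys_iff)
  finally show "lookup f v = lookup (\<Sum>w\<in>A. single w (lookup f w)) v" ..
qed

lemma Word_plus: "Word xs + Word ys = Word (xs @ ys)"
  by (simp add: plus_word_def)

lemma letters_plus: "letters (v + w) = letters v @ letters w"
  by (simp add: plus_word_def)

lemma letters_zero: "letters 0 = []"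
  by (simp add: zero_word_def)

lemma free_algebra_simps [simp]:
  "carrier (free_algebra S) = {f. \<forall>w \<in> keys f. set (letters w) \<subseteq> S}"
  "f \<otimes>\<^bsub>free_algebra S\<^esub> g = f * g" "f \<oplus>\<^bsub>free_algebra S\<^esub> g = f + g"
  "\<one>\<^bsub>free_algebra S\<^esub> = 1" "\<zero>\<^bsub>free_algebra S\<^esub> = 0"
  by (simp_all add: free_algebra_def)

lemma free_algebra_ring: "ring (free_algebra S)"
proof (rule ringI)
  have add: "f + g \<in> carrier (free_algebra S)" if "f \<in> carrier (free_algebra S)" "g \<in> carrier (free_algebra S)" for f g
    using that keys_add[of f g] by auto
  have mult: "f * g \<in> carrier (free_algebra S)" if "f \<in> carrier (free_algebra S)" "g \<in> carrier (free_algebra S)" for f g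
    using that keys_mult[of f g] by (fastforce simp: letters_plus)
  show "abelian_group (free_algebra S)"
  proof (rule abelian_groupI)
    fix f assume f: "f \<in> carrier (free_algebra S)"
    show "\<exists>g\<in>carrier (free_algebra S). g \<oplus>\<^bsub>free_algebra S\<^esub> f = \<zero>\<^bsub>free_algebra S\<^esub>"
      by (rule bexI[of _ "- f"]) (use f in auto)
  next
    fix f g assume "f \<in> carrier (free_algebra S)" "g \<in> carrier (free_algebra S)"
    then show "f \<oplus>\<^bsub>free_algebra S\<^esub> g \<in> carrier (free_algebra S)" using add by (simp only: free_algebra_simps(3))
  qed (simp_all add: add.assoc add.commute)
  show "monoid (free_algebra S)"
  proof (rule monoidI)
    fix f g assume "f \<in> carrier (free_algebra S)" "g \<in> carrier (free_algebra S)"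
    then show "f \<otimes>\<^bsub>free_algebra S\<^esub> g \<in> carrier (free_algebra S)" using mult by (simp only: free_algebra_simps(2))
  qed (simp_all add: mult.assoc letters_zero)
qed (simp_all add: distrib_left distrib_right)

section \<open>Calculation modulo the supercommutativity ideal\<close>

locale super =
  fixes m n r :: nat
begin

abbreviation "FA \<equiv> free_algebra (generators m n)"
abbreviation "SI \<equiv> supercomm_ideal m n"
abbreviation "SA \<equiv> superalgebra m n"
abbreviation "MI \<equiv> multiindices m n r"

sublocale FA: ring FA by (rule free_algebra_ring)

definition rel :: "nat \<times> nat \<Rightarrow> nat \<times> nat \<Rightarrow> (nat \<times> nat) word \<Rightarrow>\<^sub>0 rat"
  where "rel x y = letter x * letter y - (- 1) ^ (gen_parity m x * gen_parity m y) * (letter y * letter x)"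

lemma single_carrier [simp]: "single w c \<in> carrier FA \<longleftrightarrow> c = 0 \<or> set (letters w) \<subseteq> generators m n"
  by (auto simp: keys_single)

lemma minus_one_power_single: "(- 1) ^ k = (single 0 ((- 1) ^ k) :: 'a::monoid_add \<Rightarrow>\<^sub>0 rat)"
proof (cases "even k")
  case False
  then show ?thesis by (simp add: single_uminus single_one)
qed (simp add: single_one)

lemma rel_single: "rel x y = single (Word [x, y]) 1
    - single (Word [y, x]) ((- 1) ^ (gen_parity m x * gen_parity m y))"
  by (simp add: rel_def letter_def mult_single Word_plus minus_one_power_single)

lemma SI_eq: "SI = Idl\<^bsub>FA\<^esub> {rel x y | x y. x \<in> generators m n \<and> y \<in> generators m n}"
  by (simp add: supercomm_ideal_def rel_def)

lemma rel_carrier: "{rel x y | x y. x \<in> generators m n \<and> y \<in> generators m n} \<subseteq> carrier FA"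
proof clarify
  fix a b c d assume "(a, b) \<in> generators m n" "(c, d) \<in> generators m n"
  then have "single (Word [(a, b), (c, d)]) 1 \<in> carrier FA"
    "- single (Word [(c, d), (a, b)]) ((- 1) ^ (gen_parity m (a, b) * gen_parity m (c, d))) \<in> carrier FA"
    by (auto simp: keys_single)
  then have "single (Word [(a, b), (c, d)]) 1 \<oplus>\<^bsub>FA\<^esub>
    - single (Word [(c, d), (a, b)]) ((- 1) ^ (gen_parity m (a, b) * gen_parity m (c, d))) \<in> carrier FA"
    by (rule FA.a_closed)
  then show "rel (a, b) (c, d) \<in> carrier FA" by (simp add: rel_single)
qed

sublocale SI: ideal SI FA
  unfolding SI_eq by (rule FA.genideal_ideal[OF rel_carrier])

sublocale SA: ring SA
  unfolding superalgebra_def by (rule SI.quotient_is_ring)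

lemma rel_SI: "x \<in> generators m n \<Longrightarrow> y \<in> generators m n \<Longrightarrow> rel x y \<in> SI"
  using FA.genideal_self[OF rel_carrier] unfolding SI_eq by blast

lemma SI_zero: "0 \<in> SI"
  using SI.zero_closed by simp

lemma SI_add: "f \<in> SI \<Longrightarrow> g \<in> SI \<Longrightarrow> f + g \<in> SI"
  using SI.a_closed by simp

lemma SI_mult: "f \<in> SI \<Longrightarrow> u \<in> carrier FA \<Longrightarrow> v \<in> carrier FA \<Longrightarrow> u * f * v \<in> SI"
  using SI.I_l_closed SI.I_r_closed by (metis free_algebra_simps(2))

definition sc :: "rat \<Rightarrow> ((nat \<times> nat) word \<Rightarrow>\<^sub>0 rat) \<Rightarrow> (nat \<times> nat) word \<Rightarrow>\<^sub>0 rat"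
  where "sc c f = single 0 c * f"

lemma sc_single: "sc c (single w d) = single w (c * d)"
  by (simp add: sc_def mult_single)

lemma sc_sc: "sc c (sc d f) = sc (c * d) f"
  by (simp add: sc_def mult_single mult.assoc[symmetric])

lemma sc_one [simp]: "sc 1 f = f"
  by (simp add: sc_def)

lemma sc_diff: "sc c (f - g) = sc c f - sc c g"
  by (simp add: sc_def right_diff_distrib)

lemma sc_add_left: "sc (c + d) f = sc c f + sc d f"
  by (simp add: sc_def single_add distrib_right)

lemma sc_sum: "sc c (\<Sum>a\<in>A. f a) = (\<Sum>a\<in>A. sc c (f a))"
  by (simp add: sc_def sum_distrib_left)

lemma sc_zero_left: "sc 0 f = 0"
  by (simp add: sc_def)

lemma sc_sum_left: "sc (\<Sum>a\<in>A. c a) f = (\<Sum>a\<in>A. sc (c a) f)"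
  by (induction A rule: infinite_finite_induct) (simp_all add: sc_add_left sc_zero_left)

lemma sc_carrier: "f \<in> carrier FA \<Longrightarrow> sc c f \<in> carrier FA"
  using FA.m_closed[of "single 0 c" f] by (simp only: single_carrier letters_zero sc_def free_algebra_simps(2)) simp

lemma SI_sc: "f \<in> SI \<Longrightarrow> sc c f \<in> SI"
  using SI.I_l_closed[of f "single 0 c"] by (simp only: single_carrier letters_zero sc_def free_algebra_simps(2)) simp

lemma SI_diff: "f \<in> SI \<Longrightarrow> g \<in> SI \<Longrightarrow> f - g \<in> SI"
  using SI_add[of f "sc (- 1) g"] SI_sc[of g "- 1"] by (simp add: sc_def single_uminus single_one)

lemma SI_sum: "(\<And>a. a \<in> A \<Longrightarrow> f a \<in> SI) \<Longrightarrow> (\<Sum>a\<in>A. f a) \<in> SI"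
  by (induction A rule: infinite_finite_induct) (auto simp: SI_zero SI_add)

lemma carrier_sum: "(\<And>a. a \<in> A \<Longrightarrow> f a \<in> carrier FA) \<Longrightarrow> (\<Sum>a\<in>A. f a) \<in> carrier FA"
  using FA.a_closed FA.zero_closed by (induction A rule: infinite_finite_induct) (auto simp del: free_algebra_simps(1))

definition cl :: "((nat \<times> nat) word \<Rightarrow>\<^sub>0 rat) \<Rightarrow> ((nat \<times> nat) word \<Rightarrow>\<^sub>0 rat) set"
  where "cl f = SI +>\<^bsub>FA\<^esub> f"

lemma cl_eq: "cl f = {h + f | h. h \<in> SI}"
  by (auto simp: cl_def a_r_coset_def r_coset_def)

lemma cl_eq_iff: "cl f = cl g \<longleftrightarrow> f - g \<in> SI"
proof
  assume "cl f = cl g"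
  moreover have "0 + f \<in> cl f" unfolding cl_eq using SI_zero by blast
  ultimately obtain h where "h \<in> SI" "f = h + g" unfolding cl_eq by auto
  then show "f - g \<in> SI" by simp
next
  assume *: "f - g \<in> SI"
  have "h + f \<in> cl g" if "h \<in> SI" for h
    using SI_add[OF that *] unfolding cl_eq by (metis (mono_tags, lifting) add.assoc diff_add_cancel mem_Collect_eq)
  moreover have "h + g \<in> cl f" if "h \<in> SI" for h
  proof -
    have "h + g = (h - (f - g)) + f" by simp
    then show ?thesis using SI_diff[OF that *] unfolding cl_eq by blast
  qed
  ultimately show "cl f = cl g" unfolding cl_eq by blast
qed

lemma cl_hom: "cl \<in> ring_hom FA SA"
  using SI.rcos_ring_hom unfolding superalgebra_def cl_def by (simp add: cl_def[abs_def])

lemma cl_closed: "f \<in> carrier FA \<Longrightarrow> cl f \<in> carrier SA"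
  by (rule ring_hom_closed[OF cl_hom])

lemma cl_add: "f \<in> carrier FA \<Longrightarrow> g \<in> carrier FA \<Longrightarrow> cl f \<oplus>\<^bsub>SA\<^esub> cl g = cl (f + g)"
  using ring_hom_add[OF cl_hom] by simp

lemma cl_mult: "f \<in> carrier FA \<Longrightarrow> g \<in> carrier FA \<Longrightarrow> cl f \<otimes>\<^bsub>SA\<^esub> cl g = cl (f * g)"
  using ring_hom_mult[OF cl_hom] by simp

lemma cl_one: "\<one>\<^bsub>SA\<^esub> = cl 1"
  using ring_hom_one[OF cl_hom] by simp

lemma cl_zero: "\<zero>\<^bsub>SA\<^esub> = cl 0"
  by (auto simp: cl_eq superalgebra_def FactRing_def)

lemma cl_sum:
  assumes "finite A" "\<And>a. a \<in> A \<Longrightarrow> f a \<in> carrier FA"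
  shows "(\<Oplus>\<^bsub>SA\<^esub>a\<in>A. cl (f a)) = cl (\<Sum>a\<in>A. f a)"
  using assms
proof (induction A rule: finite_induct)
  case (insert a A)
  then have "(\<Oplus>\<^bsub>SA\<^esub>a\<in>insert a A. cl (f a)) = cl (f a) \<oplus>\<^bsub>SA\<^esub> (\<Oplus>\<^bsub>SA\<^esub>a\<in>A. cl (f a))"
    by (intro SA.finsum_insert) (use cl_closed in blast)+
  then show ?case using insert carrier_sum[of A f] by (simp add: cl_add del: free_algebra_simps(1))
qed (simp add: cl_zero)

lemma scale_cl: "f \<in> carrier FA \<Longrightarrow> scale_super m n c (cl f) = cl (sc c f)"
  unfolding scale_super_def cl_def[symmetric] sc_def
  by (rule cl_mult) (simp_all only: single_carrier letters_zero, simp_all)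


subsection \<open>The words of degree \<open>r\<close>\<close>

text \<open>\<chi> is the class of this word with the coefficient \<open>eps0\<close>
  (\<open>chi_cl\<close>), so relations among the \<chi> can be studied on words.\<close>

definition wd :: "(nat \<Rightarrow> nat) \<Rightarrow> (nat \<Rightarrow> nat) \<Rightarrow> (nat \<times> nat) word"
  where "wd i j = Word (map (\<lambda>t. (i t, j t)) [1..<r + 1])"

definition eps0 :: "(nat \<Rightarrow> nat) \<Rightarrow> (nat \<Rightarrow> nat) \<Rightarrow> rat"
  where "eps0 i j = (- 1) ^ (\<Sum>t = 1..r. parity m (i t) * (\<Sum>u = t + 1..r. parity m (i u) + parity m (j u)))"

lemma eps0_sq: "eps0 i j * eps0 i j = 1"
  unfolding eps0_def by (simp add: power_mult_distrib[symmetric])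

lemma wd_inj:
  assumes "i \<in> MI" "j \<in> MI" "i' \<in> MI" "j' \<in> MI" "wd i j = wd i' j'"
  shows "i = i' \<and> j = j'"
proof -
  have "i t = i' t \<and> j t = j' t" if "t \<in> {1..r}" for t
    using assms(5) that by (auto simp: wd_def simp del: upt_Suc)
  then show ?thesis using assms(1-4) unfolding multiindices_def by (metis PiE_ext)
qed

lemma MI_generators: "i \<in> MI \<Longrightarrow> j \<in> MI \<Longrightarrow> set (letters (wd i j)) \<subseteq> generators m n"
  by (auto simp: wd_def generators_def multiindices_def PiE_iff)

lemma finite_MI: "finite MI"
  unfolding multiindices_def by (intro finite_PiE) auto

lemma MI_comp: "\<pi> permutes {1..r} \<Longrightarrow> i \<circ> \<pi> \<in> MI \<longleftrightarrow> i \<in> MI"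
  unfolding multiindices_def by (rule PiE_comp_permutes)

lemma chi_cl:
  assumes "i \<in> MI" "j \<in> MI"
  shows "chi m n r i j = cl (single (wd i j) (eps0 i j))"
proof -
  have gens: "(i t, j t) \<in> generators m n" if "t \<in> {1..r}" for t
    using assms that by (auto simp: generators_def multiindices_def PiE_iff)
  have foldr: "foldr (\<lambda>t x. gen m n (i t) (j t) \<otimes>\<^bsub>SA\<^esub> x) ts \<one>\<^bsub>SA\<^esub>
      = cl (single (Word (map (\<lambda>t. (i t, j t)) ts)) 1)" if "set ts \<subseteq> {1..r}" for ts
    using that
  proof (induction ts)
    case Nil
    then show ?case by (simp add: cl_one zero_word_def[symmetric])
  next
    case (Cons t ts)
    have "set (map (\<lambda>t. (i t, j t)) ts) \<subseteq> generators m n" using Cons.prems gens by auto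
    then have "single (Word (map (\<lambda>t. (i t, j t)) ts)) 1 \<in> carrier FA"
      by (simp only: single_carrier word.sel) simp
    moreover have "letter (i t, j t) \<in> carrier FA"
      unfolding letter_def using gens[of t] Cons.prems by (simp only: single_carrier word.sel) simp
    ultimately have "cl (letter (i t, j t)) \<otimes>\<^bsub>SA\<^esub> cl (single (Word (map (\<lambda>t. (i t, j t)) ts)) 1)
      = cl (letter (i t, j t) * single (Word (map (\<lambda>t. (i t, j t)) ts)) 1)"
      by (intro cl_mult)
    then show ?case using Cons by (simp add: gen_def cl_def[symmetric] letter_def mult_single Word_plus)
  qed
  have "foldr (\<lambda>t x. gen m n (i t) (j t) \<otimes>\<^bsub>SA\<^esub> x) [1..<r + 1] \<one>\<^bsub>SA\<^esub> = cl (single (wd i j) 1)"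
    unfolding wd_def by (rule foldr) auto
  then have "chi m n r i j = scale_super m n (eps0 i j) (cl (single (wd i j) 1))"
    unfolding chi_def eps0_def by simp
  also have "\<dots> = cl (sc (eps0 i j) (single (wd i j) 1))"
    using MI_generators[OF assms] by (intro scale_cl) (simp only: single_carrier, simp)
  finally show ?thesis by (simp add: sc_single)
qed

section \<open>Invariance of \<chi> under the simultaneous signed action\<close>

lemma sum_pairs: "(\<Sum>t = 1..r. f t * (\<Sum>u = t + 1..r. g u :: nat)) = (\<Sum>(a, b)\<in>ordered_pairs r. f a * g b)"
proof -
  have "(\<Sum>t = 1..r. f t * (\<Sum>u = t + 1..r. g u)) = (\<Sum>(a, b)\<in>Sigma {1..r} (\<lambda>t. {t + 1..r}). f a * g b)"
    by (subst sum.Sigma[symmetric]) (auto simp: sum_distrib_left)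
  also have "Sigma {1..r} (\<lambda>t. {t + 1..r}) = ordered_pairs r" by (auto simp: ordered_pairs_def)
  finally show ?thesis .
qed

text \<open>An adjacent transposition permutes the ordered pairs other than (t, Suc t), so only that
  one term of the exponent changes.\<close>

lemma sum_pairs_swap:
  fixes f g :: "nat \<Rightarrow> nat"
  assumes t: "t \<in> {1..r}" "Suc t \<in> {1..r}"
  defines "s \<equiv> transpose t (Suc t)"
  shows "(\<Sum>(a, b)\<in>ordered_pairs r. f a * g b) + f (Suc t) * g t
    = (\<Sum>(a, b)\<in>ordered_pairs r. f (s a) * g (s b)) + f t * g (Suc t)"
proof -
  let ?D = "ordered_pairs r - {(t, Suc t)}"
  have tin: "(t, Suc t) \<in> ordered_pairs r" using t by (auto simp: ordered_pairs_def)
  have ss: "s (s a) = a" for a by (simp add: s_def)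
  have in_D: "(s a, s b) \<in> ?D" if "(a, b) \<in> ?D" for a b
    using that t unfolding ordered_pairs_def s_def by (auto simp: transpose_def)
  have "(\<Sum>(a, b)\<in>?D. f a * g b) = (\<Sum>(a, b)\<in>?D. f (s a) * g (s b))"
    by (rule sum.reindex_bij_witness[where i = "\<lambda>(a, b). (s a, s b)" and j = "\<lambda>(a, b). (s a, s b)"])
      (use ss in_D in auto)
  then show ?thesis
    using sum.remove[OF finite_ordered_pairs tin, of "\<lambda>(a, b). f a * g b"]
      sum.remove[OF finite_ordered_pairs tin, of "\<lambda>(a, b). f (s a) * g (s b)"]
    by (simp add: s_def)
qed

text \<open>The signs in the definition of \<open>\<chi>\<close> are made so that \<open>\<chi>\<close> is invariant under the signed action.\<close>

lemma eps0_adjacent: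
  assumes t: "t \<in> {1..r}" "Suc t \<in> {1..r}"
  defines "s \<equiv> transpose t (Suc t)"
  shows "eps0 i j * (- 1) ^ (gen_parity m (i t, j t) * gen_parity m (i (Suc t), j (Suc t)))
    = seps m r i s * seps m r j s * eps0 (i \<circ> s) (j \<circ> s)"
proof -
  let ?f = "\<lambda>a. parity m (i a)" and ?g = "\<lambda>a. parity m (i a) + parity m (j a)"
  have "eps0 i j * (- 1) ^ (?f (Suc t) * ?g t) = eps0 (i \<circ> s) (j \<circ> s) * (- 1) ^ (?f t * ?g (Suc t))"
    using sum_pairs_swap[OF t, of ?f ?g] unfolding eps0_def sum_pairs s_def
    by (simp add: power_add[symmetric] del: power_add)
  then have "eps0 i j * (- 1) ^ (?f (Suc t) * ?g t) * (- 1) ^ (?f (Suc t) * ?g t)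
      = eps0 (i \<circ> s) (j \<circ> s) * (- 1) ^ (?f t * ?g (Suc t)) * (- 1) ^ (?f (Suc t) * ?g t)" by simp
  moreover have "(- 1) ^ k * (- 1) ^ k = (1 :: rat)" for k by (simp add: power_mult_distrib[symmetric])
  ultimately have e: "eps0 i j = eps0 (i \<circ> s) (j \<circ> s) * ((- 1) ^ (?f t * ?g (Suc t)) * (- 1) ^ (?f (Suc t) * ?g t))"
    by (simp add: mult.assoc)
  \<comment> \<open>Here a, b are the parities of i and j at t, and a', b' those at Suc t. The mixed
    terms have even coefficients; a a' and b b' remain, the exponents of the two signs
    \<open>seps\<close>.\<close>
  have sgn: "(- 1) ^ (a * (a' + b')) * (- 1) ^ (a' * (a + b)) * (- 1) ^ ((a + b) * (a' + b'))
      = ((- 1) ^ (a * a') * (- 1) ^ (b * b') :: rat)" for a b a' b' :: nat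
  proof -
    have "a * (a' + b') + a' * (a + b) + (a + b) * (a' + b') = a * a' + b * b' + 2 * (a * a' + a * b' + a' * b)"
      by (simp add: algebra_simps)
    then have "(- 1 :: rat) ^ (a * (a' + b') + a' * (a + b) + (a + b) * (a' + b'))
        = (- 1) ^ (a * a' + b * b' + 2 * (a * a' + a * b' + a' * b))" by (rule arg_cong)
    then show ?thesis by (simp only: power_add power_mult) simp
  qed
  have "eps0 i j * (- 1) ^ (?g t * ?g (Suc t))
      = eps0 (i \<circ> s) (j \<circ> s) * ((- 1) ^ (?f t * ?g (Suc t)) * (- 1) ^ (?f (Suc t) * ?g t) * (- 1) ^ (?g t * ?g (Suc t)))"
    by (subst e) (simp only: mult.assoc)
  then show ?thesis
    unfolding sgn unfolding s_def seps_adjacent[OF t] gen_parity_def fst_conv snd_conv by (simp only: mult.commute)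
qed

text \<open>The identity between \<chi> and its signed translate, lifted to representatives in the
  free algebra. Quantifying over all i and j makes it stable under composition of
  permutations.\<close>

definition chi_invariant :: "(nat \<Rightarrow> nat) \<Rightarrow> bool"
  where "chi_invariant \<pi> \<longleftrightarrow> \<pi> permutes {1..r} \<and> (\<forall>i\<in>MI. \<forall>j\<in>MI. single (wd i j) (eps0 i j)
    - single (wd (i \<circ> \<pi>) (j \<circ> \<pi>)) (seps m r i \<pi> * seps m r j \<pi> * eps0 (i \<circ> \<pi>) (j \<circ> \<pi>)) \<in> SI)"

lemma wd_split:
  assumes t: "t \<in> {1..r}" "Suc t \<in> {1..r}"
  defines "s \<equiv> transpose t (Suc t)"
  obtains us vs where "length us = t - 1"
    "wd i j = Word us + Word [(i t, j t), (i (Suc t), j (Suc t))] + Word vs"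
    "wd (i \<circ> s) (j \<circ> s) = Word us + Word [(i (Suc t), j (Suc t)), (i t, j t)] + Word vs"
proof
  have "[1..<r + 1] = [1..<t] @ [t..<r + 1]" using t upt_add_eq_append[of 1 t "r + 1 - t"] by simp
  also have "[t..<r + 1] = t # Suc t # [Suc (Suc t)..<r + 1]" using t by (simp add: upt_rec[of t] upt_rec[of "Suc t"])
  finally have split: "[1..<r + 1] = [1..<t] @ [t, Suc t] @ [Suc (Suc t)..<r + 1]" by simp
  let ?us = "map (\<lambda>t. (i t, j t)) [1..<t]" and ?vs = "map (\<lambda>t. (i t, j t)) [Suc (Suc t)..<r + 1]"
  show "length ?us = t - 1" by simp
  show "wd i j = Word ?us + Word [(i t, j t), (i (Suc t), j (Suc t))] + Word ?vs"
    unfolding wd_def split Word_plus by simp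
  have "map (\<lambda>t. ((i \<circ> s) t, (j \<circ> s) t)) [1..<t] = ?us" "map (\<lambda>t. ((i \<circ> s) t, (j \<circ> s) t)) [Suc (Suc t)..<r + 1] = ?vs"
    by (auto simp: s_def transpose_def)
  then show "wd (i \<circ> s) (j \<circ> s) = Word ?us + Word [(i (Suc t), j (Suc t)), (i t, j t)] + Word ?vs"
    unfolding wd_def split Word_plus by (simp add: s_def)
qed

lemma sandwich_rel:
  "single u c * rel x y * single v d
    = single (u + Word [x, y] + v) (c * d)
      - single (u + Word [y, x] + v) (c * (- 1) ^ (gen_parity m x * gen_parity m y) * d)"
  by (simp add: rel_single left_diff_distrib right_diff_distrib mult_single)

text \<open>The difference is one defining relation between neighbouring letters, multiplied by
  words on both sides and by \<open>eps0 i j\<close>; the signs match by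
  \<open>eps0_adjacent\<close>.\<close>

lemma chi_invariant_adjacent:
  assumes t: "t \<in> {1..r}" "Suc t \<in> {1..r}"
  shows "chi_invariant (transpose t (Suc t))"
proof -
  let ?s = "transpose t (Suc t)"
  have "single (wd i j) (eps0 i j)
    - single (wd (i \<circ> ?s) (j \<circ> ?s)) (seps m r i ?s * seps m r j ?s * eps0 (i \<circ> ?s) (j \<circ> ?s)) \<in> SI"
    if ij: "i \<in> MI" "j \<in> MI" for i j
  proof -
    let ?x = "(i t, j t)" and ?y = "(i (Suc t), j (Suc t))"
    obtain us vs where w: "wd i j = Word us + Word [?x, ?y] + Word vs"
      "wd (i \<circ> ?s) (j \<circ> ?s) = Word us + Word [?y, ?x] + Word vs"
      by (rule wd_split[OF t])
    have "set us \<subseteq> generators m n" "set vs \<subseteq> generators m n" "?x \<in> generators m n" "?y \<in> generators m n"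
      using MI_generators[OF ij] unfolding w by (auto simp: letters_plus)
    then have "single (Word us) (eps0 i j) * rel ?x ?y * single (Word vs) 1 \<in> SI"
      by (intro SI_mult rel_SI) (simp_all only: single_carrier word.sel, simp_all)
    then show ?thesis unfolding sandwich_rel w mult_1_right eps0_adjacent[OF t] .
  qed
  moreover have "?s permutes {1..r}" using t by (rule permutes_swap_id)
  ultimately show ?thesis by (simp add: chi_invariant_def)
qed

lemma chi_invariant_comp:
  assumes \<pi>: "chi_invariant \<pi>" and \<sigma>: "chi_invariant \<sigma>"
  shows "chi_invariant (\<pi> \<circ> \<sigma>)"
proof -
  have p: "\<pi> permutes {1..r}" "\<sigma> permutes {1..r}" using assms by (auto simp: chi_invariant_def)
  have "single (wd i j) (eps0 i j) - single (wd (i \<circ> (\<pi> \<circ> \<sigma>)) (j \<circ> (\<pi> \<circ> \<sigma>)))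
      (seps m r i (\<pi> \<circ> \<sigma>) * seps m r j (\<pi> \<circ> \<sigma>) * eps0 (i \<circ> (\<pi> \<circ> \<sigma>)) (j \<circ> (\<pi> \<circ> \<sigma>))) \<in> SI"
    if ij: "i \<in> MI" "j \<in> MI" for i j
  proof -
    let ?c = "seps m r i \<pi> * seps m r j \<pi>" and ?i = "i \<circ> \<pi>" and ?j = "j \<circ> \<pi>"
    have 1: "single (wd i j) (eps0 i j) - single (wd ?i ?j) (?c * eps0 ?i ?j) \<in> SI"
      using \<pi> ij by (auto simp: chi_invariant_def)
    have "?i \<in> MI" "?j \<in> MI" using ij MI_comp[OF p(1)] by blast+
    then have "single (wd ?i ?j) (eps0 ?i ?j)
      - single (wd (?i \<circ> \<sigma>) (?j \<circ> \<sigma>)) (seps m r ?i \<sigma> * seps m r ?j \<sigma> * eps0 (?i \<circ> \<sigma>) (?j \<circ> \<sigma>)) \<in> SI"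
      using \<sigma> unfolding chi_invariant_def by blast
    from SI_add[OF 1 SI_sc[OF this, of ?c]] show ?thesis
      by (simp add: sc_diff sc_single seps_comp[OF p] o_assoc mult.assoc mult.left_commute)
  qed
  then show ?thesis using permutes_compose[OF p(2,1)] by (simp add: chi_invariant_def)
qed

lemma chi_invariant_transpose:
  assumes "a \<in> {1..r}" "a + Suc d \<in> {1..r}"
  shows "chi_invariant (transpose a (a + Suc d))"
  using assms
proof (induction d)
  case 0
  then show ?case using chi_invariant_adjacent[of a] by simp
next
  case (Suc d)
  let ?b = "a + Suc d"
  have "chi_invariant (transpose ?b (Suc ?b))" using Suc.prems by (intro chi_invariant_adjacent) auto
  moreover have "chi_invariant (transpose a ?b)" using Suc by auto
  ultimately have "chi_invariant (transpose ?b (Suc ?b) \<circ> transpose a ?b \<circ> transpose ?b (Suc ?b))"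
    by (intro chi_invariant_comp)
  also have "transpose ?b (Suc ?b) \<circ> transpose a ?b \<circ> transpose ?b (Suc ?b) = transpose a (a + Suc (Suc d))"
    by (auto simp: fun_eq_iff transpose_def)
  finally show ?case .
qed

lemma chi_invariant_id: "chi_invariant id"
proof -
  have "seps m r i id = 1" for i by (rule signed_action.eps_id[OF signed_action_seps])
  then show ?thesis by (simp add: chi_invariant_def SI_zero permutes_id)
qed

lemma chi_invariant_permutes:
  assumes "\<pi> permutes {1..r}"
  shows "chi_invariant \<pi>"
  using assms finite_atLeastAtMost
proof (induction rule: permutes_induct)
  case (swap a b p)
  have "chi_invariant (transpose a b)" if "a \<in> {1..r}" "b \<in> {1..r}" "a < b" for a b
  proof -
    obtain d where "b = a + Suc d" using \<open>a < b\<close> less_imp_Suc_add by auto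
    then show ?thesis using chi_invariant_transpose that by blast
  qed
  from this[of a b] this[of b a] have "chi_invariant (transpose a b)"
    using swap by (cases "a < b") (auto simp: transpose_commute[of b a])
  then show ?case using swap chi_invariant_comp by blast
qed (rule chi_invariant_id)

end


context signed_action
begin

lemma act_inv_delta:
  assumes "\<pi> permutes S"
  shows "act eps (inv \<pi>) (delta i) = (\<lambda>k. eps i \<pi> * delta (i \<circ> \<pi>) k)"
proof -
  have 1: "i \<circ> \<pi> \<circ> inv \<pi> = i" using permutes_inv_o(1)[OF assms] by (simp add: o_assoc[symmetric])
  have "eps (i \<circ> \<pi>) (inv \<pi>) = eps i \<pi>" using eps_inv[OF assms, of "i \<circ> \<pi>"] 1 by simp
  then show ?thesis using act_delta[OF permutes_inv[OF assms], of "i \<circ> \<pi>"] 1 by simp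
qed

end

section \<open>Functionals that detect zero in the superalgebra\<close>

context super
begin

sublocale A: signed_action "{1..r}" "seps m r" "\<lambda>x. x \<le> m"
  by (rule signed_action_seps)

abbreviation pr where "pr i j \<equiv> pair (seps m r) {1..r} (delta i) (delta j)"

text \<open>The linear functional \<open>L _ k l\<close> on the free algebra takes the value of the pairing on \<open>\<chi>\<close>; it vanishes on
  words of length other than \<open>r\<close>.\<close>

definition L :: "((nat \<times> nat) word \<Rightarrow>\<^sub>0 rat) \<Rightarrow> (nat \<Rightarrow> nat) \<Rightarrow> (nat \<Rightarrow> nat) \<Rightarrow> rat"
  where "L f k l = (\<Sum>i\<in>MI. \<Sum>j\<in>MI. lookup f (wd i j) * (eps0 i j * pr i j k l))"

lemma L_zero: "L 0 k l = 0"
  by (simp add: L_def)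

lemma L_add: "L (f + g) k l = L f k l + L g k l"
  by (simp add: L_def lookup_add distrib_right sum.distrib)

lemma L_diff: "L (f - g) k l = L f k l - L g k l"
  by (simp add: L_def lookup_minus left_diff_distrib sum_subtractf)

lemma L_sum: "L (\<Sum>a\<in>A. f a) k l = (\<Sum>a\<in>A. L (f a) k l)"
  by (induction A rule: infinite_finite_induct) (auto simp: L_zero L_add)

lemma L_single:
  assumes "i \<in> MI" "j \<in> MI"
  shows "L (single (wd i j) c) k l = c * (eps0 i j * pr i j k l)"
proof -
  have lk: "lookup (single (wd i j) c) (wd i' j') = (if i' = i \<and> j' = j then c else 0)"
    if "i' \<in> MI" "j' \<in> MI" for i' j'
    using wd_inj[OF assms that] by (auto simp: lookup_single when_def)
  have "L (single (wd i j) c) k l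
      = (\<Sum>i'\<in>MI. \<Sum>j'\<in>MI. if i' = i then if j' = j then c * (eps0 i j * pr i j k l) else 0 else 0)"
    unfolding L_def by (intro sum.cong refl) (auto simp: lk)
  also have "\<dots> = (\<Sum>i'\<in>MI. if i' = i then \<Sum>j'\<in>MI. if j' = j then c * (eps0 i j * pr i j k l) else 0 else 0)"
    by (intro sum.cong refl) auto
  also have "\<dots> = c * (eps0 i j * pr i j k l)" using assms finite_MI by simp
  finally show ?thesis .
qed

lemma L_single_other:
  assumes "\<And>i j. i \<in> MI \<Longrightarrow> j \<in> MI \<Longrightarrow> w \<noteq> wd i j"
  shows "L (single w c) k l = 0"
  unfolding L_def using assms by (intro sum.neutral ballI) (simp add: lookup_single when_def)

lemma pr_act:
  assumes "\<pi> permutes {1..r}"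
  shows "pr i j k l = seps m r i \<pi> * seps m r j \<pi> * pr (i \<circ> \<pi>) (j \<circ> \<pi>) k l"
proof -
  have "pr (i \<circ> \<pi>) (j \<circ> \<pi>) k l = pair (seps m r) {1..r} (\<lambda>k. seps m r i \<pi> * delta i k) (\<lambda>k. seps m r j \<pi> * delta j k) k l"
    using A.pair_act[OF assms] A.act_delta[OF assms] by metis
  also have "\<dots> = seps m r i \<pi> * seps m r j \<pi> * pr i j k l"
    by (simp add: pair_def act_scale sum_distrib_left mult.assoc mult.left_commute)
  finally have "seps m r i \<pi> * seps m r j \<pi> * pr (i \<circ> \<pi>) (j \<circ> \<pi>) k l
      = (seps m r i \<pi> * seps m r i \<pi>) * (seps m r j \<pi> * seps m r j \<pi>) * pr i j k l" by (simp only: ac_simps)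
  then show ?thesis by (simp add: seps_sq)
qed

text \<open>Exchanging neighbouring letters is an adjacent transposition of both multiindices. Its
  signs in \<open>pr\<close> and in \<open>eps0\<close> combine to the sign of the defining
  relation.\<close>

lemma L_swap_wd:
  assumes ij: "i \<in> MI" "j \<in> MI" and w: "u + Word [x, y] + v = wd i j"
  shows "L (single (u + Word [x, y] + v) c) k l
    = L (single (u + Word [y, x] + v) ((- 1) ^ (gen_parity m x * gen_parity m y) * c)) k l"
proof -
  obtain us0 vs0 where uv: "u = Word us0" "v = Word vs0" by (metis word.exhaust)
  define t where "t = Suc (length us0)"
  have "length (us0 @ [x, y] @ vs0) = length (letters (wd i j))" using w uv by (metis Word_plus append.assoc word.sel)
  then have t: "t \<in> {1..r}" "Suc t \<in> {1..r}" by (auto simp: t_def wd_def simp del: upt_Suc)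
  let ?s = "transpose t (Suc t)"
  obtain us vs where us: "length us = t - 1"
    "wd i j = Word us + Word [(i t, j t), (i (Suc t), j (Suc t))] + Word vs"
    "wd (i \<circ> ?s) (j \<circ> ?s) = Word us + Word [(i (Suc t), j (Suc t)), (i t, j t)] + Word vs"
    by (rule wd_split[OF t])
  have "us0 @ [x, y] @ vs0 = us @ [(i t, j t), (i (Suc t), j (Suc t))] @ vs"
    using w us(2) by (simp add: uv Word_plus)
  then have eq: "us0 = us" "x = (i t, j t)" "y = (i (Suc t), j (Suc t))" "vs0 = vs"
    using us(1) by (auto simp: append_eq_append_conv t_def)
  have p: "?s permutes {1..r}" by (rule permutes_swap_id[OF t])
  have MI': "i \<circ> ?s \<in> MI" "j \<circ> ?s \<in> MI" using ij MI_comp[OF p] by blast+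
  let ?g = "(- 1) ^ (gen_parity m x * gen_parity m y) :: rat" and ?q = "seps m r i ?s * seps m r j ?s"
  have gg: "?g * ?g = 1" by (simp add: power_mult_distrib[symmetric])
  have qq: "?q * ?q = 1" using seps_sq[of m r i ?s] seps_sq[of m r j ?s] by (simp add: mult.assoc mult.left_commute)
  have e: "eps0 i j * ?g = ?q * eps0 (i \<circ> ?s) (j \<circ> ?s)" using eps0_adjacent[OF t, of i j] by (simp add: eq)
  have "eps0 i j * ?q = (eps0 i j * ?g) * ?g * ?q" using gg by (simp add: mult.assoc)
  also have "\<dots> = ?g * eps0 (i \<circ> ?s) (j \<circ> ?s) * (?q * ?q)" unfolding e by (simp only: ac_simps)
  finally have e': "eps0 i j * ?q = ?g * eps0 (i \<circ> ?s) (j \<circ> ?s)" unfolding qq by simp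
  have "L (single (wd i j) c) k l = c * (eps0 i j * ?q * pr (i \<circ> ?s) (j \<circ> ?s) k l)"
    unfolding L_single[OF ij] pr_act[OF p, of i j] by (simp only: ac_simps)
  also have "\<dots> = L (single (wd (i \<circ> ?s) (j \<circ> ?s)) (?g * c)) k l"
    unfolding L_single[OF MI'] e' by (simp only: ac_simps)
  finally show ?thesis unfolding us(2,3) uv eq .
qed

lemma L_rel: "L (single u c * rel x y * single v d) k l = 0"
proof -
  let ?p = "u + Word [x, y] + v" and ?p' = "u + Word [y, x] + v"
  let ?g = "(- 1) ^ (gen_parity m x * gen_parity m y) :: rat"
  have gg: "?g * ?g = 1" by (simp add: power_mult_distrib[symmetric])
  have "L (single ?p (c * d)) k l = L (single ?p' (c * ?g * d)) k l"
  proof (cases "\<exists>i\<in>MI. \<exists>j\<in>MI. ?p = wd i j")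
    case True
    then obtain i j where ij: "i \<in> MI" "j \<in> MI" "?p = wd i j" by blast
    show ?thesis using L_swap_wd[OF ij, of "c * d"] by (simp only: ac_simps)
  next
    case no: False
    show ?thesis
    proof (cases "\<exists>i\<in>MI. \<exists>j\<in>MI. ?p' = wd i j")
      case True
      then obtain i j where ij: "i \<in> MI" "j \<in> MI" "?p' = wd i j" by blast
      have "L (single ?p' (c * ?g * d)) k l = L (single ?p (?g * (c * ?g * d))) k l"
        using L_swap_wd[OF ij, of "c * ?g * d"] by (simp only: mult.commute)
      also have "?g * (c * ?g * d) = (?g * ?g) * (c * d)" by (simp only: ac_simps)
      finally show ?thesis unfolding gg by simp
    next
      case False
      have "L (single ?p (c * d)) k l = 0" by (rule L_single_other) (use no in blast)
      moreover have "L (single ?p' (c * ?g * d)) k l = 0" by (rule L_single_other) (use False in blast)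
      ultimately show ?thesis by simp
    qed
  qed
  then show ?thesis unfolding sandwich_rel L_diff by simp
qed

text \<open>A kernel of linear functionals need not be an ideal. J collects the elements all of
  whose multiples by words on both sides are killed; it is an ideal by construction, and
  \<open>L_rel\<close> puts the defining relations into it.\<close>

lemma L_SI:
  assumes "f \<in> SI"
  shows "L f k l = 0"
proof -
  define J where "J = {f \<in> carrier FA. \<forall>u c v d k l. L (single u c * f * single v d) k l = 0}"
  have J_carrier: "f \<in> carrier FA" if "f \<in> J" for f
    using that by (simp only: J_def mem_Collect_eq)
  have J_L: "L (single u c * f * single v d) k l = 0" if "f \<in> J" for f u c v d k l
    using that by (simp only: J_def mem_Collect_eq)
  have "ideal J FA"
  proof (rule idealI[OF FA.ring_axioms])
    have "subgroup J (add_monoid FA)"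
    proof (rule group.subgroupI)
      show "group (add_monoid FA)" by (rule FA.a_group)
      show "J \<subseteq> carrier (add_monoid FA)" by (auto simp: J_def)
      have "0 \<in> J" by (simp add: J_def L_zero)
      then show "J \<noteq> {}" by blast
      show "f \<otimes>\<^bsub>add_monoid FA\<^esub> g \<in> J" if "f \<in> J" "g \<in> J" for f g
      proof -
        have "f + g \<in> carrier FA" using FA.a_closed[OF J_carrier J_carrier, OF that] by (simp only: free_algebra_simps(3))
        moreover have "L (single u c * (f + g) * single v d) k l = 0" for u c v d k l
          using J_L[OF that(1)] J_L[OF that(2)] by (simp only: distrib_left distrib_right L_add)
        ultimately show ?thesis unfolding J_def by simp
      qed
      show "m_inv (add_monoid FA) f \<in> J" if "f \<in> J" for f
      proof -
        have fc: "f \<in> carrier FA" by (rule J_carrier[OF that])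
        have mf: "- f \<in> carrier FA" using fc by auto
        have "\<ominus>\<^bsub>FA\<^esub> f = - f"
          by (rule FA.minus_equality[OF _ fc mf]) simp
        moreover have "L (single u c * - f * single v d) k l = 0" for u c v d k l
        proof -
          have "single u c * - f * single v d = 0 - single u c * f * single v d"
            by simp
          then show ?thesis by (simp only: L_diff L_zero J_L[OF that])
        qed
        ultimately show ?thesis using mf by (simp only: J_def a_inv_def[symmetric] mem_Collect_eq) simp
      qed
    qed
    then show "subgroup J (add_monoid FA)" .
    fix f a assume f: "f \<in> J" and a: "a \<in> carrier FA"
    have fc: "f \<in> carrier FA" by (rule J_carrier[OF f])
    have af: "a = (\<Sum>w\<in>keys a. single w (lookup a w))"
      by (rule poly_mapping_sum_single) auto
    show "a \<otimes>\<^bsub>FA\<^esub> f \<in> J"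
    proof -
      have "L (single u c * (a * f) * single v d) k l = 0" for u c v d k l
      proof -
        have "single u c * (a * f) * single v d
          = (\<Sum>w\<in>keys a. single (u + w) (c * lookup a w) * f * single v d)"
          by (subst af) (simp add: sum_distrib_left sum_distrib_right mult_single mult.assoc[symmetric])
        then show ?thesis by (simp only: L_sum J_L[OF f] sum.neutral_const)
      qed
      then show ?thesis using FA.m_closed[OF a fc] by (simp only: J_def mem_Collect_eq free_algebra_simps(2)) simp
    qed
    show "f \<otimes>\<^bsub>FA\<^esub> a \<in> J"
    proof -
      have "L (single u c * (f * a) * single v d) k l = 0" for u c v d k l
      proof -
        have "single u c * (f * a) * single v d
          = (\<Sum>w\<in>keys a. single u c * f * single (w + v) (lookup a w * d))"
          by (subst af) (simp add: sum_distrib_left sum_distrib_right mult_single mult.assoc)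
        then show ?thesis by (simp only: L_sum J_L[OF f] sum.neutral_const)
      qed
      then show ?thesis using FA.m_closed[OF fc a] by (simp only: J_def mem_Collect_eq free_algebra_simps(2)) simp
    qed
  qed
  moreover have "{rel x y | x y. x \<in> generators m n \<and> y \<in> generators m n} \<subseteq> J"
    using rel_carrier L_rel unfolding J_def by blast
  ultimately have "SI \<subseteq> J" unfolding SI_eq by (rule FA.genideal_minimal)
  then have "L (single 0 1 * f * single 0 1) k l = 0" using assms by (intro J_L) blast
  then show ?thesis by simp
qed

abbreviation "WD \<equiv> (\<lambda>(i, j). wd i j) ` (MI \<times> MI)"

lemma WD_carrier: "keys f \<subseteq> WD \<Longrightarrow> f \<in> carrier FA"
  using MI_generators by fastforce

lemma sum_WD:
  assumes "keys f \<subseteq> WD"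
  shows "f = (\<Sum>i\<in>MI. \<Sum>j\<in>MI. single (wd i j) (lookup f (wd i j)))"
proof -
  have "inj_on (\<lambda>(i, j). wd i j) (MI \<times> MI)" using wd_inj by (auto intro!: inj_onI)
  then have "(\<Sum>w\<in>WD. single w (lookup f w))
      = (\<Sum>(i, j)\<in>MI \<times> MI. single (wd i j) (lookup f (wd i j)))"
    by (subst sum.reindex) (auto simp: case_prod_unfold)
  then show ?thesis
    using poly_mapping_sum_single[OF _ assms] finite_MI by (simp add: sum.cartesian_product)
qed

abbreviation "mchi i j \<equiv> single (wd i j) (eps0 i j)"
abbreviation "U \<equiv> young {1..r} (\<lambda>_. ())"

text \<open>The invariance of \<chi> is summed over all permutations; \<open>pr i j k l\<close>
  counts, with signs, how often (k, l) arises from (i, j).\<close>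

lemma mono_average:
  assumes ij: "i \<in> MI" "j \<in> MI"
  shows "sc (of_nat (card U)) (mchi i j) - (\<Sum>k\<in>MI. \<Sum>l\<in>MI. sc (pr i j k l) (mchi k l)) \<in> SI"
proof -
  let ?q = "\<lambda>\<pi>. seps m r i \<pi> * seps m r j \<pi>"
  have pr: "pr i j k l = (\<Sum>\<pi>\<in>U. ?q \<pi> * (delta (i \<circ> \<pi>) k * delta (j \<circ> \<pi>) l))" for k l
  proof -
    have "pr i j k l = (\<Sum>\<pi>\<in>U. act (seps m r) (inv \<pi>) (delta i) k * act (seps m r) (inv \<pi>) (delta j) l)"
      unfolding pair_def by (rule sum_young_inv[symmetric])
    also have "\<dots> = (\<Sum>\<pi>\<in>U. ?q \<pi> * (delta (i \<circ> \<pi>) k * delta (j \<circ> \<pi>) l))"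
      by (intro sum.cong refl) (simp add: A.act_inv_delta[OF young_permutes] mult.assoc mult.left_commute)
    finally show ?thesis .
  qed
  have dl: "(\<Sum>k\<in>MI. \<Sum>l\<in>MI. sc (c * (delta a k * delta b l)) (mchi k l)) = sc c (mchi a b)"
    if "a \<in> MI" "b \<in> MI" for a b c
  proof -
    have "(\<Sum>k\<in>MI. \<Sum>l\<in>MI. sc (c * (delta a k * delta b l)) (mchi k l))
      = (\<Sum>k\<in>MI. \<Sum>l\<in>MI. if k = a then if l = b then sc c (mchi a b) else 0 else 0)"
      by (intro sum.cong refl) (simp add: delta_def sc_zero_left)
    also have "\<dots> = (\<Sum>k\<in>MI. if k = a then \<Sum>l\<in>MI. if l = b then sc c (mchi a b) else 0 else 0)"
      by (intro sum.cong refl) auto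
    finally show ?thesis using that finite_MI by simp
  qed
  have "(\<Sum>k\<in>MI. \<Sum>l\<in>MI. sc (pr i j k l) (mchi k l))
      = (\<Sum>k\<in>MI. \<Sum>l\<in>MI. \<Sum>\<pi>\<in>U. sc (?q \<pi> * (delta (i \<circ> \<pi>) k * delta (j \<circ> \<pi>) l)) (mchi k l))"
    unfolding pr sc_sum_left ..
  also have "\<dots> = (\<Sum>k\<in>MI. \<Sum>\<pi>\<in>U. \<Sum>l\<in>MI. sc (?q \<pi> * (delta (i \<circ> \<pi>) k * delta (j \<circ> \<pi>) l)) (mchi k l))"
    by (intro sum.cong refl sum.swap)
  also have "\<dots> = (\<Sum>\<pi>\<in>U. \<Sum>k\<in>MI. \<Sum>l\<in>MI. sc (?q \<pi> * (delta (i \<circ> \<pi>) k * delta (j \<circ> \<pi>) l)) (mchi k l))"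
    by (rule sum.swap)
  also have "\<dots> = (\<Sum>\<pi>\<in>U. sc (?q \<pi>) (mchi (i \<circ> \<pi>) (j \<circ> \<pi>)))"
    by (intro sum.cong refl dl) (use ij MI_comp[OF young_permutes] in blast)+
  finally have eq: "(\<Sum>k\<in>MI. \<Sum>l\<in>MI. sc (pr i j k l) (mchi k l)) = (\<Sum>\<pi>\<in>U. sc (?q \<pi>) (mchi (i \<circ> \<pi>) (j \<circ> \<pi>)))" .
  have "sc (of_nat (card U)) (mchi i j) = (\<Sum>\<pi>\<in>U. sc 1 (mchi i j))"
    unfolding sc_sum_left[symmetric] by simp
  then have "sc (of_nat (card U)) (mchi i j) - (\<Sum>\<pi>\<in>U. sc (?q \<pi>) (mchi (i \<circ> \<pi>) (j \<circ> \<pi>)))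
      = (\<Sum>\<pi>\<in>U. mchi i j - sc (?q \<pi>) (mchi (i \<circ> \<pi>) (j \<circ> \<pi>)))"
    by (simp add: sum_subtractf)
  also have "\<dots> \<in> SI"
  proof (rule SI_sum)
    fix \<pi> assume "\<pi> \<in> U"
    then have "chi_invariant \<pi>" by (intro chi_invariant_permutes young_permutes)
    then show "mchi i j - sc (?q \<pi>) (mchi (i \<circ> \<pi>) (j \<circ> \<pi>)) \<in> SI"
      using ij unfolding chi_invariant_def sc_single by blast
  qed
  finally show ?thesis unfolding eq .
qed

text \<open>By \<open>mono_average\<close>, r! times f is congruent to the combination of the
  representatives of \<chi> with coefficients \<open>L f k l\<close>. If these vanish, division by
  r! puts f into the ideal.\<close>

theorem SI_iff_L:
  assumes f: "keys f \<subseteq> WD"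
  shows "f \<in> SI \<longleftrightarrow> (\<forall>k l. L f k l = 0)"
proof
  assume zero: "\<forall>k l. L f k l = 0"
  define c where "c i j = lookup f (wd i j) * eps0 i j" for i j
  have f_eq: "f = (\<Sum>i\<in>MI. \<Sum>j\<in>MI. sc (c i j) (mchi i j))"
    by (subst sum_WD[OF f]) (simp add: sc_single c_def mult.assoc eps0_sq)
  let ?N = "rat_of_nat (card U)"
  have "(\<Sum>i\<in>MI. \<Sum>j\<in>MI. sc (c i j) (\<Sum>k\<in>MI. \<Sum>l\<in>MI. sc (pr i j k l) (mchi k l)))
      = (\<Sum>i\<in>MI. \<Sum>j\<in>MI. \<Sum>k\<in>MI. \<Sum>l\<in>MI. sc (c i j * pr i j k l) (mchi k l))"
    by (simp add: sc_sum sc_sc)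
  also have "\<dots> = (\<Sum>i\<in>MI. \<Sum>k\<in>MI. \<Sum>j\<in>MI. \<Sum>l\<in>MI. sc (c i j * pr i j k l) (mchi k l))"
    by (intro sum.cong refl sum.swap)
  also have "\<dots> = (\<Sum>k\<in>MI. \<Sum>i\<in>MI. \<Sum>j\<in>MI. \<Sum>l\<in>MI. sc (c i j * pr i j k l) (mchi k l))"
    by (rule sum.swap)
  also have "\<dots> = (\<Sum>k\<in>MI. \<Sum>i\<in>MI. \<Sum>l\<in>MI. \<Sum>j\<in>MI. sc (c i j * pr i j k l) (mchi k l))"
    by (intro sum.cong refl sum.swap)
  also have "\<dots> = (\<Sum>k\<in>MI. \<Sum>l\<in>MI. \<Sum>i\<in>MI. \<Sum>j\<in>MI. sc (c i j * pr i j k l) (mchi k l))"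
    by (intro sum.cong refl sum.swap)
  also have "\<dots> = (\<Sum>k\<in>MI. \<Sum>l\<in>MI. sc (L f k l) (mchi k l))"
  proof (intro sum.cong refl)
    fix k l
    show "(\<Sum>i\<in>MI. \<Sum>j\<in>MI. sc (c i j * pr i j k l) (mchi k l)) = sc (L f k l) (mchi k l)"
      unfolding L_def sc_sum_left by (simp add: c_def mult.assoc)
  qed
  also have "\<dots> = 0" by (simp add: zero sc_def)
  finally have eq: "(\<Sum>i\<in>MI. \<Sum>j\<in>MI. sc (c i j) (\<Sum>k\<in>MI. \<Sum>l\<in>MI. sc (pr i j k l) (mchi k l))) = 0" .
  have "(\<Sum>i\<in>MI. \<Sum>j\<in>MI. sc (c i j) (sc ?N (mchi i j) - (\<Sum>k\<in>MI. \<Sum>l\<in>MI. sc (pr i j k l) (mchi k l)))) \<in> SI"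
    by (intro SI_sum SI_sc mono_average)
  then have "(\<Sum>i\<in>MI. \<Sum>j\<in>MI. sc (c i j) (sc ?N (mchi i j))) \<in> SI"
    unfolding sc_diff sum_subtractf eq by simp
  also have "(\<Sum>i\<in>MI. \<Sum>j\<in>MI. sc (c i j) (sc ?N (mchi i j))) = sc ?N f"
    by (subst f_eq) (simp add: sc_sum sc_sc mult.commute)
  finally have "sc (1 / ?N) (sc ?N f) \<in> SI" by (rule SI_sc)
  then show "f \<in> SI" using A.card_young_pos[of "\<lambda>_. ()"] by (simp add: sc_sc)
qed (simp add: L_SI)

end


section \<open>Modified symmetrizers\<close>

text \<open>Otherwise \<open>{1..r}\<close> is rewritten to \<open>{Suc 0..r}\<close>, which no longer matches the locale instances.\<close>

declare One_nat_def [simp del]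

context signed_action
begin

lemma gsum_delta: "gsum eps (young S g) (delta i) = (\<lambda>k. \<Sum>\<pi>\<in>young S g. eps i \<pi> * delta (i \<circ> \<pi>) k)"
proof
  fix k
  have "gsum eps (young S g) (delta i) k = (\<Sum>\<pi>\<in>young S g. act eps (inv \<pi>) (delta i) k)"
    unfolding gsum_def by (rule sum_young_inv[symmetric])
  also have "\<dots> = (\<Sum>\<pi>\<in>young S g. eps i \<pi> * delta (i \<circ> \<pi>) k)"
    by (intro sum.cong refl) (simp add: act_inv_delta[OF young_permutes])
  finally show "gsum eps (young S g) (delta i) k = (\<Sum>\<pi>\<in>young S g. eps i \<pi> * delta (i \<circ> \<pi>) k)" .
qed

end

context super
begin

lemma lookup_sc: "lookup (sc c f) w = c * lookup f w"
proof -
  have f: "f = (\<Sum>v\<in>keys f. single v (lookup f v))"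
    by (rule poly_mapping_sum_single) auto
  have "lookup (sc c f) w
      = (\<Sum>v\<in>keys f. c * lookup (single v (lookup f v)) w)"
    by (subst f) (simp add: sc_sum sc_single lookup_sum lookup_single when_def if_distrib[of "(*) c"] cong: if_cong)
  also have "\<dots> = c * lookup (\<Sum>v\<in>keys f. single v (lookup f v)) w"
    by (simp add: lookup_sum sum_distrib_left)
  also have "\<dots> = c * lookup f w" by (simp only: f[symmetric])
  finally show ?thesis .
qed

lemma L_sc: "L (sc c f) k l = c * L f k l"
  by (simp add: L_def lookup_sc sum_distrib_left mult.assoc)

lemma keys_sc: "keys (sc c f) \<subseteq> keys f"
  by (auto simp: in_keys_iff lookup_sc)

lemma keys_sum_WD: "(\<And>a. a \<in> A \<Longrightarrow> keys (f a) \<subseteq> WD) \<Longrightarrow> keys (\<Sum>a\<in>A. f a) \<subseteq> WD"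
proof (induction A rule: infinite_finite_induct)
  case (insert a A)
  then show ?case using keys_add[of "f a" "sum f A"] by (simp del: image_split_eq_Sigma) blast
qed simp_all

lemma keys_diff_WD: "keys f \<subseteq> WD \<Longrightarrow> keys g \<subseteq> WD \<Longrightarrow> keys (f - g) \<subseteq> WD"
  using keys_diff[of f g] by blast

lemma keys_mchi: "i \<in> MI \<Longrightarrow> j \<in> MI \<Longrightarrow> keys (mchi i j) \<subseteq> WD"
  by (auto simp: keys_single)

lemma L_mchi: "i \<in> MI \<Longrightarrow> j \<in> MI \<Longrightarrow> L (mchi i j) k l = pr i j k l"
  by (simp add: L_single mult.assoc[symmetric] eps0_sq)

end

section \<open>From boxes to positions: the given tableau as a tableau action\<close>

locale super_tableau = super +
  fixes lam :: "nat \<Rightarrow> nat" and T :: "nat \<times> nat \<Rightarrow> nat"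
  assumes partition: "is_partition lam r" and tableau: "basic_tableau lam r T"
begin

abbreviation "D \<equiv> diagram lam"
abbreviation "S \<equiv> {1..r}"

text \<open>Tensors are indexed by positions, so rows and columns are read off through the inverse
  of T.\<close>

definition tinv where "tinv = inv_into D T"
definition row where "row a = fst (tinv a)"
definition col where "col a = snd (tinv a)"

abbreviation jeps where "jeps \<equiv> \<lambda>k \<pi>. of_int (sign \<pi>) * seps m r k \<pi>"

lemma T_bij: "bij_betw T D S"
  using tableau by (simp add: basic_tableau_def)

lemma T_in: "x \<in> D \<Longrightarrow> T x \<in> S"
  using T_bij by (rule bij_betwE[rule_format])

lemma tinv_T: "x \<in> D \<Longrightarrow> tinv (T x) = x"
  unfolding tinv_def using T_bij by (auto simp: bij_betw_def)

lemma tinv_in: "a \<in> S \<Longrightarrow> tinv a \<in> D"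
  unfolding tinv_def using T_bij by (metis bij_betw_def inv_into_into)

lemma T_tinv: "a \<in> S \<Longrightarrow> T (tinv a) = a"
  unfolding tinv_def using T_bij by (metis bij_betw_def f_inv_into_f)

lemma row_T: "(s, d) \<in> D \<Longrightarrow> row (T (s, d)) = s" "(s, d) \<in> D \<Longrightarrow> col (T (s, d)) = d"
  by (simp_all add: row_def col_def tinv_T)

lemma T_row_col: "a \<in> S \<Longrightarrow> T (row a, col a) = a" "a \<in> S \<Longrightarrow> (row a, col a) \<in> D"
  using T_tinv tinv_in by (simp_all add: row_def col_def)

lemma lam_antimono:
  assumes "1 \<le> s" "s \<le> s'"
  shows "lam s' \<le> lam s"
  using assms(2,1)
proof (induction rule: dec_induct)
  case (step k)
  then have "1 \<le> k" by simp
  then have "lam (k + 1) \<le> lam k" using partition unfolding is_partition_def by blast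
  then show ?case using step by (simp add: Suc_eq_plus1)
qed simp

text \<open>A block is mapped onto itself as soon as no position leaves it, by injectivity and
  finiteness. The label g serves for rows and columns alike.\<close>

lemma group_young:
  "{\<pi>. \<pi> permutes S \<and> (\<forall>c. \<pi> ` T ` {x \<in> D. g x = c} = T ` {x \<in> D. g x = c})} = young S (\<lambda>a. g (tinv a))"
proof (intro equalityI subsetI)
  fix \<pi> assume "\<pi> \<in> {\<pi>. \<pi> permutes S \<and> (\<forall>c. \<pi> ` T ` {x \<in> D. g x = c} = T ` {x \<in> D. g x = c})}"
  then have \<pi>: "\<pi> permutes S" "\<And>c. \<pi> ` T ` {x \<in> D. g x = c} = T ` {x \<in> D. g x = c}" by auto
  have "g (tinv (\<pi> a)) = g (tinv a)" if a: "a \<in> S" for a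
  proof -
    have "a \<in> T ` {x \<in> D. g x = g (tinv a)}" using T_tinv[OF a] tinv_in[OF a] by (intro image_eqI[of _ _ "tinv a"]) auto
    then have "\<pi> a \<in> T ` {x \<in> D. g x = g (tinv a)}" using \<pi>(2)[of "g (tinv a)"] by blast
    then show ?thesis using tinv_T by auto
  qed
  then show "\<pi> \<in> young S (\<lambda>a. g (tinv a))" using \<pi>(1) by (simp add: young_def)
next
  fix \<pi> assume \<pi>: "\<pi> \<in> young S (\<lambda>a. g (tinv a))"
  have "\<pi> ` T ` {x \<in> D. g x = c} = T ` {x \<in> D. g x = c}" for c
  proof (rule endo_inj_surj)
    have "finite D" using T_bij bij_betw_finite by blast
    then show "finite (T ` {x \<in> D. g x = c})" by simp
    show "\<pi> ` T ` {x \<in> D. g x = c} \<subseteq> T ` {x \<in> D. g x = c}"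
    proof clarify
      fix s d assume x: "(s, d) \<in> D" "c = g (s, d)"
      let ?x = "tinv (\<pi> (T (s, d)))"
      have in_S: "\<pi> (T (s, d)) \<in> S" by (rule young_in[OF \<pi> T_in[OF x(1)]])
      have "g ?x = g (s, d)" using young_apply[OF \<pi> T_in[OF x(1)]] tinv_T[OF x(1)] by simp
      then show "\<pi> (T (s, d)) \<in> T ` {x \<in> D. g x = g (s, d)}"
        using T_tinv[OF in_S] tinv_in[OF in_S] by (intro image_eqI[of _ _ ?x]) auto
    qed
    show "inj_on \<pi> (T ` {x \<in> D. g x = c})" by (rule permutes_inj_on[OF young_permutes[OF \<pi>]])
  qed
  then show "\<pi> \<in> {\<pi>. \<pi> permutes S \<and> (\<forall>c. \<pi> ` T ` {x \<in> D. g x = c} = T ` {x \<in> D. g x = c})}"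
    using young_permutes[OF \<pi>] by simp
qed

lemma row_group_young: "row_group lam r T = young S row"
  unfolding row_group_def row_def[abs_def] by (rule group_young)

lemma column_group_young: "column_group lam r T = young S col"
  unfolding column_group_def col_def[abs_def] by (rule group_young)

sublocale TA: tableau_action S "seps m r" jeps "\<lambda>x. x \<le> m" row col "m + n"
proof (intro tableau_action.intro tableau_action_axioms.intro signed_action_seps signed_action_sign_seps refl)
  show "a = b" if "a \<in> S" "b \<in> S" "row a = row b" "col a = col b" for a b
    using that T_row_col(1) by metis
  show "\<exists>b\<in>S. row b = s \<and> col b = d" if "a \<in> S" "1 \<le> s" "s \<le> row a" "1 \<le> d" "d \<le> col a" for a s d
  proof -
    have "col a \<le> lam (row a)" using T_row_col(2)[OF that(1)] by (simp add: diagram_def)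
    then have "(s, d) \<in> D" using that lam_antimono[OF that(2,3)] by (simp add: diagram_def)
    then show ?thesis using T_in row_T by blast
  qed
  show "1 \<le> row a" "1 \<le> col a" if "a \<in> S" for a using T_row_col(2)[OF that] by (auto simp: diagram_def)
qed

lemma MI_eq: "TA.MI = MI"
  by (simp add: multiindices_def)

lemma semistandard_iff: "semistandard m lam T i \<longleftrightarrow> sst (\<lambda>x. x \<le> m) S row col i"
proof
  assume *: "semistandard m lam T i"
  have "i a \<le> i b \<and> (i a = i b \<longrightarrow> \<not> i a \<le> m)" if ab: "a \<in> S" "b \<in> S" "col a = col b" "row a < row b" for a b
  proof -
    have "(row a, col a) \<in> D" "(row b, col a) \<in> D" "T (row a, col a) = a" "T (row b, col a) = b"
      using T_row_col[OF ab(1)] T_row_col[OF ab(2)] ab(3) by auto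
    then show ?thesis using * ab(4) unfolding semistandard_def by (metis not_le)
  qed
  moreover have "i a \<le> i b \<and> (i a = i b \<longrightarrow> i a \<le> m)" if ab: "a \<in> S" "b \<in> S" "row a = row b" "col a < col b" for a b
  proof -
    have "(row a, col a) \<in> D" "(row a, col b) \<in> D" "T (row a, col a) = a" "T (row a, col b) = b"
      using T_row_col[OF ab(1)] T_row_col[OF ab(2)] ab(3) by auto
    then show ?thesis using * ab(4) unfolding semistandard_def by metis
  qed
  ultimately show "sst (\<lambda>x. x \<le> m) S row col i" unfolding sst_def by blast
next
  assume *: "sst (\<lambda>x. x \<le> m) S row col i"
  have 1: "i (T (s, d)) \<le> i (T (s', d)) \<and> (i (T (s, d)) = i (T (s', d)) \<longrightarrow> m < i (T (s, d)))"
    if x: "(s, d) \<in> D" "(s', d) \<in> D" "s < s'" for s s' d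
    using * T_in[OF x(1)] T_in[OF x(2)] row_T[OF x(1)] row_T[OF x(2)] x(3) unfolding sst_def by (metis not_le)
  have 2: "i (T (s, d)) \<le> i (T (s, d')) \<and> (i (T (s, d)) = i (T (s, d')) \<longrightarrow> i (T (s, d)) \<le> m)"
    if x: "(s, d) \<in> D" "(s, d') \<in> D" "d < d'" for s d d'
    using * T_in[OF x(1)] T_in[OF x(2)] row_T[OF x(1)] row_T[OF x(2)] x(3) unfolding sst_def by metis
  show "semistandard m lam T i" unfolding semistandard_def using 1 2 by blast
qed

lemma SST_iff: "i \<in> TA.SST \<longleftrightarrow> i \<in> MI \<and> semistandard m lam T i"
  unfolding TA.SST_def MI_eq semistandard_iff mem_Collect_eq ..

lemma card_box: "card {x \<in> D. g x = c \<and> i (T x) = a} = card {b \<in> S. g (tinv b) = c \<and> i b = a}"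
proof (rule bij_betw_same_card)
  show "bij_betw T {x \<in> D. g x = c \<and> i (T x) = a} {b \<in> S. g (tinv b) = c \<and> i b = a}"
    unfolding bij_betw_def
  proof (intro conjI equalityI subsetI)
    show "inj_on T {x \<in> D. g x = c \<and> i (T x) = a}"
      by (rule inj_on_subset[OF bij_betw_imp_inj_on[OF T_bij]]) auto
    fix b assume "b \<in> T ` {x \<in> D. g x = c \<and> i (T x) = a}"
    then show "b \<in> {b \<in> S. g (tinv b) = c \<and> i b = a}" using T_in tinv_T by auto
  next
    fix b assume b: "b \<in> {b \<in> S. g (tinv b) = c \<and> i b = a}"
    then show "b \<in> T ` {x \<in> D. g x = c \<and> i (T x) = a}"
      using T_tinv[of b] tinv_in[of b] by (intro image_eqI[of _ _ "tinv b"]) auto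
  qed
qed

lemma tinv_image: "tinv ` S = D"
  using tinv_in T_in tinv_T by (auto simp: image_iff) (metis T_in atLeastAtMost_iff tinv_T)

lemma row_factor_eq: "row_factor m lam T i = rfac (\<lambda>x. x \<le> m) S (m + n) row i"
proof -
  have "{x \<in> {1..m + n}. x \<le> m} = {1..m}" by auto
  moreover have "row ` S = fst ` D" unfolding row_def[abs_def] tinv_image[symmetric] by (simp add: image_image)
  ultimately show ?thesis
    unfolding row_factor_def rfac_def row_mult_def card_box by (simp add: row_def)
qed

lemma column_factor_eq: "column_factor m n lam T i = rfac (\<lambda>x. \<not> x \<le> m) S (m + n) col i"
proof -
  have "{x \<in> {1..m + n}. \<not> x \<le> m} = {m + 1..m + n}" by auto
  moreover have "col ` S = snd ` D" unfolding col_def[abs_def] tinv_image[symmetric] by (simp add: image_image)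
  ultimately show ?thesis
    unfolding column_factor_def rfac_def column_mult_def card_box by (simp add: col_def)
qed

section \<open>Representatives of the modified symmetrizers and their pairings\<close>

definition rc where "rc i j = rat_of_nat (row_factor m lam T i) * of_nat (column_factor m n lam T j)"

text \<open>Lies in the free algebra, where the functionals L can be evaluated.\<close>

definition msym where
  "msym i j = sc (1 / rc i j) (\<Sum>\<rho>\<in>TA.Rg. \<Sum>\<kappa>\<in>TA.Cg.
     sc (of_int (sign \<kappa>)) (sc (seps m r i \<rho> * seps m r j \<kappa>) (mchi (i \<circ> \<rho>) (j \<circ> \<kappa>))))"

lemma young_MI: "i \<in> MI \<Longrightarrow> \<pi> \<in> young S g \<Longrightarrow> i \<circ> \<pi> \<in> MI"
  using MI_comp[OF young_permutes] by blast

lemma keys_msym: "i \<in> MI \<Longrightarrow> j \<in> MI \<Longrightarrow> keys (msym i j) \<subseteq> WD"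
  unfolding msym_def
  by (intro order_trans[OF keys_sc] keys_sum_WD) (rule keys_mchi; rule young_MI; assumption)

lemma modified_symmetrizer_cl:
  assumes ij: "i \<in> MI" "j \<in> MI"
  shows "modified_symmetrizer m n r lam T i j = cl (msym i j)"
proof -
  let ?t = "\<lambda>\<rho> \<kappa>. sc (of_int (sign \<kappa>)) (sc (seps m r i \<rho> * seps m r j \<kappa>) (mchi (i \<circ> \<rho>) (j \<circ> \<kappa>)))"
  have fin: "finite (young S g)" for g :: "nat \<Rightarrow> nat" by (rule finite_young) simp
  have tc: "?t \<rho> \<kappa> \<in> carrier FA" if "\<rho> \<in> TA.Rg" "\<kappa> \<in> TA.Cg" for \<rho> \<kappa>
    by (intro sc_carrier WD_carrier keys_mchi young_MI[OF ij(1) that(1)] young_MI[OF ij(2) that(2)])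
  have term_cl: "scale_super m n (of_int (sign \<kappa>)) (signed_chi m n r (signed_act m r i \<rho>) (signed_act m r j \<kappa>)) = cl (?t \<rho> \<kappa>)"
    if "\<rho> \<in> TA.Rg" "\<kappa> \<in> TA.Cg" for \<rho> \<kappa>
  proof -
    have MI': "i \<circ> \<rho> \<in> MI" "j \<circ> \<kappa> \<in> MI" using young_MI ij that by blast+
    have c: "mchi (i \<circ> \<rho>) (j \<circ> \<kappa>) \<in> carrier FA" by (rule WD_carrier[OF keys_mchi[OF MI']])
    have "signed_chi m n r (signed_act m r i \<rho>) (signed_act m r j \<kappa>)
        = scale_super m n (seps m r i \<rho> * seps m r j \<kappa>) (chi m n r (i \<circ> \<rho>) (j \<circ> \<kappa>))"
      by (simp add: signed_chi_def seps_def) (simp add: signed_act_def)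
    also have "\<dots> = cl (sc (seps m r i \<rho> * seps m r j \<kappa>) (mchi (i \<circ> \<rho>) (j \<circ> \<kappa>)))"
      unfolding chi_cl[OF MI'] by (rule scale_cl[OF c])
    finally show ?thesis by (simp only: scale_cl[OF sc_carrier[OF c]])
  qed
  have "symmetrizer m n r lam T i j = (\<Oplus>\<^bsub>SA\<^esub>\<rho>\<in>TA.Rg. cl (\<Sum>\<kappa>\<in>TA.Cg. ?t \<rho> \<kappa>))"
    unfolding symmetrizer_def row_group_young column_group_young
  proof (rule SA.finsum_cong'[OF refl])
    show "(\<lambda>\<rho>. cl (\<Sum>\<kappa>\<in>TA.Cg. ?t \<rho> \<kappa>)) \<in> TA.Rg \<rightarrow> carrier SA"
      by (intro Pi_I cl_closed carrier_sum tc)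
    fix \<rho> assume \<rho>: "\<rho> \<in> TA.Rg"
    have "(\<Oplus>\<^bsub>SA\<^esub>\<kappa>\<in>TA.Cg. scale_super m n (of_int (sign \<kappa>)) (signed_chi m n r (signed_act m r i \<rho>) (signed_act m r j \<kappa>)))
        = (\<Oplus>\<^bsub>SA\<^esub>\<kappa>\<in>TA.Cg. cl (?t \<rho> \<kappa>))"
    proof (rule SA.finsum_cong'[OF refl])
      show "(\<lambda>\<kappa>. cl (?t \<rho> \<kappa>)) \<in> TA.Cg \<rightarrow> carrier SA" by (intro Pi_I cl_closed tc[OF \<rho>])
    qed (rule term_cl[OF \<rho>])
    also have "\<dots> = cl (\<Sum>\<kappa>\<in>TA.Cg. ?t \<rho> \<kappa>)" by (rule cl_sum[OF fin tc[OF \<rho>]])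
    finally show "(\<Oplus>\<^bsub>SA\<^esub>\<kappa>\<in>TA.Cg. scale_super m n (of_int (sign \<kappa>)) (signed_chi m n r (signed_act m r i \<rho>) (signed_act m r j \<kappa>)))
      = cl (\<Sum>\<kappa>\<in>TA.Cg. ?t \<rho> \<kappa>)" .
  qed
  also have "\<dots> = cl (\<Sum>\<rho>\<in>TA.Rg. \<Sum>\<kappa>\<in>TA.Cg. ?t \<rho> \<kappa>)" by (intro cl_sum fin carrier_sum tc)
  finally show ?thesis
    unfolding modified_symmetrizer_def msym_def rc_def by (simp only:) (intro scale_cl carrier_sum tc)
qed

text \<open>Bilinearity: the two tensors expand into signed deltas along the row and column orbits,
  and L sends a representative of \<chi> to the pairing of its deltas.\<close>

lemma L_msym:
  assumes ij: "i \<in> MI" "j \<in> MI"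
  shows "L (msym i j) k l = pair (seps m r) S (TA.Xi i) (TA.Eta j) k l"
proof -
  have "L (msym i j) k l = 1 / rc i j * (\<Sum>\<rho>\<in>TA.Rg. \<Sum>\<kappa>\<in>TA.Cg. L (sc (of_int (sign \<kappa>)) (sc (seps m r i \<rho> * seps m r j \<kappa>) (mchi (i \<circ> \<rho>) (j \<circ> \<kappa>)))) k l)"
    unfolding msym_def L_sc[of "1 / rc i j"] L_sum ..
  also have "\<dots> = 1 / rc i j * (\<Sum>\<rho>\<in>TA.Rg. \<Sum>\<kappa>\<in>TA.Cg. of_int (sign \<kappa>) * (seps m r i \<rho> * seps m r j \<kappa> * pr (i \<circ> \<rho>) (j \<circ> \<kappa>) k l))"
  proof -
    have "L (sc (of_int (sign \<kappa>)) (sc (seps m r i \<rho> * seps m r j \<kappa>) (mchi (i \<circ> \<rho>) (j \<circ> \<kappa>)))) k l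
        = of_int (sign \<kappa>) * (seps m r i \<rho> * seps m r j \<kappa> * pr (i \<circ> \<rho>) (j \<circ> \<kappa>) k l)"
      if "\<rho> \<in> TA.Rg" "\<kappa> \<in> TA.Cg" for \<rho> \<kappa>
      unfolding L_sc by (simp only: L_mchi[OF young_MI[OF ij(1) that(1)] young_MI[OF ij(2) that(2)]])
    then show ?thesis by simp
  qed
  finally have lhs: "L (msym i j) k l = 1 / rc i j * (\<Sum>\<rho>\<in>TA.Rg. \<Sum>\<kappa>\<in>TA.Cg. of_int (sign \<kappa>) * (seps m r i \<rho> * seps m r j \<kappa> * pr (i \<circ> \<rho>) (j \<circ> \<kappa>) k l))" .
  let ?a = "1 / rat_of_nat (row_factor m lam T i)" and ?b = "1 / rat_of_nat (column_factor m n lam T j)"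
  have Xi: "TA.Xi i = (\<lambda>k. \<Sum>\<rho>\<in>TA.Rg. (?a * seps m r i \<rho>) * delta (i \<circ> \<rho>) k)"
    unfolding xi_def row_factor_eq[symmetric] A.gsum_delta by (simp add: sum_divide_distrib)
  have Eta: "TA.Eta j = (\<lambda>k. \<Sum>\<kappa>\<in>TA.Cg. (?b * (of_int (sign \<kappa>) * seps m r j \<kappa>)) * delta (j \<circ> \<kappa>) k)"
    unfolding xi_def column_factor_eq[symmetric] TA.J.gsum_delta by (simp add: sum_divide_distrib)
  have "pair (seps m r) S (TA.Xi i) (TA.Eta j) k l
      = (\<Sum>\<rho>\<in>TA.Rg. (?a * seps m r i \<rho>) * pair (seps m r) S (TA.Eta j) (delta (i \<circ> \<rho>)) l k)"
    unfolding Xi pair_sum_left by (simp only: pair_commute[of _ _ "delta _" "TA.Eta j"])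
  also have "\<dots> = (\<Sum>\<rho>\<in>TA.Rg. (?a * seps m r i \<rho>) * (\<Sum>\<kappa>\<in>TA.Cg. (?b * (of_int (sign \<kappa>) * seps m r j \<kappa>)) * pr (i \<circ> \<rho>) (j \<circ> \<kappa>) k l))"
    unfolding Eta pair_sum_left by (subst pair_commute) (rule refl)
  also have "\<dots> = 1 / rc i j * (\<Sum>\<rho>\<in>TA.Rg. \<Sum>\<kappa>\<in>TA.Cg. of_int (sign \<kappa>) * (seps m r i \<rho> * seps m r j \<kappa> * pr (i \<circ> \<rho>) (j \<circ> \<kappa>) k l))"
    by (simp add: rc_def sum_distrib_left mult.assoc mult.left_commute)
  finally show ?thesis using lhs by simp
qed


section \<open>The lattice spanned by the modified symmetrizers\<close>

definition X where "X = TA.SST \<times> TA.SST"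

definition base where "base p = cl (msym (fst p) (snd p))"

definition tot :: "((nat \<Rightarrow> nat) \<times> (nat \<Rightarrow> nat) \<Rightarrow> int) \<Rightarrow> (nat \<times> nat) word \<Rightarrow>\<^sub>0 rat"
  where "tot c = (\<Sum>p\<in>X. sc (of_int (c p)) (msym (fst p) (snd p)))"

abbreviation "G \<equiv> A_int m n r lam T"

lemma finite_X: "finite X"
  using TA.finite_SST by (simp add: X_def)

lemma X_MI: "p \<in> X \<Longrightarrow> fst p \<in> MI \<and> snd p \<in> MI"
  by (auto simp: X_def SST_iff)

lemma keys_tot: "keys (tot c) \<subseteq> WD"
  unfolding tot_def by (intro keys_sum_WD order_trans[OF keys_sc] keys_msym) (use X_MI in auto)

lemma tot_carrier: "tot c \<in> carrier FA"
  by (rule WD_carrier[OF keys_tot])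

lemma msym_carrier: "i \<in> MI \<Longrightarrow> j \<in> MI \<Longrightarrow> msym i j \<in> carrier FA"
  by (rule WD_carrier[OF keys_msym])

lemma L_tot: "L (tot c) k l
  = (\<Sum>i\<in>TA.SST. \<Sum>j\<in>TA.SST. of_int (c (i, j)) * pair (seps m r) S (TA.Xi i) (TA.Eta j) k l)"
proof -
  have "L (tot c) k l = (\<Sum>p\<in>X. of_int (c p) * pair (seps m r) S (TA.Xi (fst p)) (TA.Eta (snd p)) k l)"
    unfolding tot_def L_sum L_sc by (rule sum.cong[OF refl]) (use X_MI L_msym in simp)
  then show ?thesis by (simp add: X_def sum.cartesian_product case_prod_unfold)
qed

lemma tot_add: "tot c + tot d = tot (\<lambda>p. c p + d p)"
  by (simp add: tot_def sc_add_left sum.distrib)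

lemma tot_zero: "tot (\<lambda>_. 0) = 0"
  by (simp add: tot_def sc_zero_left)

text \<open>Equal classes agree under all functionals L, and the semistandard pairings are
  independent.\<close>

lemma tot_unique:
  assumes "cl (tot c) = cl (tot d)" "p \<in> X"
  shows "c p = d p"
proof -
  have "tot c - tot d \<in> SI" using assms(1) by (simp add: cl_eq_iff)
  then have "L (tot c) k l = L (tot d) k l" for k l using L_SI[of "tot c - tot d"] by (simp add: L_diff)
  then have "(\<Sum>i\<in>TA.SST. \<Sum>j\<in>TA.SST. (of_int (c (i, j)) - of_int (d (i, j))) * pair (seps m r) S (TA.Xi i) (TA.Eta j) k l) = 0" for k l
    unfolding L_tot by (simp add: left_diff_distrib sum_subtractf)
  then have "rat_of_int (c (i, j)) - of_int (d (i, j)) = 0" if "i \<in> TA.SST" "j \<in> TA.SST" for i j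
    using that by (rule TA.pair_independent)
  then show ?thesis using assms(2) by (auto simp: X_def)
qed

text \<open>Straightening of the pairing is an identity under all functionals L;
  \<open>SI_iff_L\<close> lifts it to the superalgebra.\<close>

lemma msym_tot:
  assumes ij: "i \<in> MI" "j \<in> MI"
  shows "\<exists>c. cl (msym i j) = cl (tot c)"
proof -
  obtain c :: "(nat \<Rightarrow> nat) \<Rightarrow> (nat \<Rightarrow> nat) \<Rightarrow> int"
    where c: "\<forall>k l. pair (seps m r) S (TA.Xi i) (TA.Eta j) k l
      = (\<Sum>s\<in>TA.SST. \<Sum>t\<in>TA.SST. of_int (c s t) * pair (seps m r) S (TA.Xi s) (TA.Eta t) k l)"
    using TA.pair_straighten[OF ij[folded MI_eq]] ..
  have "L (msym i j - tot (\<lambda>(s, t). c s t)) k l = 0" for k l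
    unfolding L_diff L_tot L_msym[OF ij] c[rule_format] by simp
  moreover have "keys (msym i j - tot (\<lambda>(s, t). c s t)) \<subseteq> WD"
    by (intro keys_diff_WD keys_msym keys_tot ij)
  ultimately have "msym i j - tot (\<lambda>(s, t). c s t) \<in> SI" using SI_iff_L by blast
  then show ?thesis using cl_eq_iff by blast
qed

section \<open>The lattice as a free abelian group\<close>

abbreviation "gensA \<equiv> {modified_symmetrizer m n r lam T i j | i j. i \<in> MI \<and> j \<in> MI}"

lemma gensA_eq: "gensA = {cl (msym i j) | i j. i \<in> MI \<and> j \<in> MI}"
  using modified_symmetrizer_cl by metis

lemma gensA_carrier: "gensA \<subseteq> carrier (add_monoid SA)"
  unfolding gensA_eq using cl_closed[OF msym_carrier] by auto

lemma G_carrier: "carrier G = generate (add_monoid SA) gensA"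
  by (simp add: A_int_def)

lemma G_mult: "x \<otimes>\<^bsub>G\<^esub> y = x \<oplus>\<^bsub>SA\<^esub> y"
  by (simp add: A_int_def)

lemma G_subgroup: "subgroup (carrier G) (add_monoid SA)"
  unfolding G_carrier by (rule group.generate_is_subgroup[OF SA.a_group gensA_carrier])

lemma cl_uminus: "f \<in> carrier FA \<Longrightarrow> \<ominus>\<^bsub>SA\<^esub> cl f = cl (sc (- 1) f)"
proof (rule SA.minus_equality)
  assume f: "f \<in> carrier FA"
  have "sc (- 1) f + f = 0" using sc_add_left[of "- 1" 1 f] by (simp add: sc_zero_left)
  then show "cl (sc (- 1) f) \<oplus>\<^bsub>SA\<^esub> cl f = \<zero>\<^bsub>SA\<^esub>" using f by (simp add: cl_add sc_carrier cl_zero del: free_algebra_simps(1))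
qed (auto intro!: cl_closed sc_carrier simp del: free_algebra_simps(1))

text \<open>The subgroup W is arbitrary so that it can be both the lattice (\<open>G_tot\<close>)
  and the subgroup generated by the semistandard elements (\<open>G_gen\<close>).\<close>

lemma cl_tot_in:
  assumes W: "subgroup W (add_monoid SA)" and base: "base ` X \<subseteq> W"
  shows "cl (tot c) \<in> W"
proof -
  have add: "cl (f + g) \<in> W" if "cl f \<in> W" "cl g \<in> W" "f \<in> carrier FA" "g \<in> carrier FA" for f g
    using subgroup.m_closed[OF W that(1,2)] cl_add[OF that(3,4)] by simp
  have neg: "cl (sc (- 1) f) \<in> W" if "cl f \<in> W" "f \<in> carrier FA" for f
    using subgroup.m_inv_closed[OF W that(1)] cl_uminus[OF that(2)] by (simp add: a_inv_def)
  have zero: "cl 0 \<in> W" using subgroup.one_closed[OF W] by (simp add: cl_zero)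
  have mult: "cl (sc (of_int z) f) \<in> W" if f: "cl f \<in> W" "f \<in> carrier FA" for z f
  proof (induction z rule: int_induct[where k = 0])
    case base
    then show ?case using zero by (simp add: sc_zero_left)
  next
    case (step1 z)
    then show ?case using add[OF step1(2) f(1) sc_carrier[OF f(2)] f(2)] by (simp add: sc_add_left)
  next
    case (step2 z)
    have "sc (of_int (z - 1)) f = sc (of_int z) f + sc (- 1) f" by (simp flip: sc_add_left)
    then show ?case using add[OF step2(2) neg[OF f] sc_carrier[OF f(2)] sc_carrier[OF f(2)]] by simp
  qed
  have "cl (\<Sum>p\<in>Y. sc (of_int (c p)) (msym (fst p) (snd p))) \<in> W" if "finite Y" "Y \<subseteq> X" for Y
    using that
  proof (induction Y rule: finite_induct)
    case (insert p Y)
    have p: "p \<in> X" "Y \<subseteq> X" using insert.prems by auto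
    have pc: "msym (fst p) (snd p) \<in> carrier FA" using X_MI[OF p(1)] msym_carrier by blast
    have "cl (sc (of_int (c p)) (msym (fst p) (snd p))) \<in> W"
      using base p(1) by (intro mult pc) (auto simp: base_def)
    moreover have "(\<Sum>p\<in>Y. sc (of_int (c p)) (msym (fst p) (snd p))) \<in> carrier FA"
      using p(2) X_MI by (intro carrier_sum sc_carrier msym_carrier) auto
    ultimately have "cl (sc (of_int (c p)) (msym (fst p) (snd p)) + (\<Sum>p\<in>Y. sc (of_int (c p)) (msym (fst p) (snd p)))) \<in> W"
      using insert.IH[OF p(2)] pc by (intro add sc_carrier)
    then show ?case using insert.hyps by simp
  qed (simp add: zero)
  then show ?thesis unfolding tot_def using finite_X by blast
qed

lemma base_G: "p \<in> X \<Longrightarrow> base p \<in> carrier G"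
  unfolding G_carrier gensA_eq base_def using X_MI[of p] by (intro generate.incl) blast

lemma G_tot: "carrier G = range (\<lambda>c. cl (tot c))"
proof (intro equalityI subsetI)
  fix x assume "x \<in> carrier G"
  then have "x \<in> generate (add_monoid SA) {cl (msym i j) | i j. i \<in> MI \<and> j \<in> MI}" unfolding G_carrier gensA_eq .
  then show "x \<in> range (\<lambda>c. cl (tot c))"
  proof (induction rule: generate.induct)
    case one
    have "\<one>\<^bsub>add_monoid SA\<^esub> = cl (tot (\<lambda>_. 0))" by (simp add: cl_zero tot_zero)
    then show ?case by blast
  next
    case (incl x)
    then show ?case using msym_tot by blast
  next
    case (inv x)
    then obtain c where c: "x = cl (tot c)" using msym_tot by blast
    have "m_inv (add_monoid SA) x = \<ominus>\<^bsub>SA\<^esub> x" by (simp add: a_inv_def)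
    also have "\<dots> = cl (sc (- 1) (tot c))" unfolding c by (rule cl_uminus[OF tot_carrier])
    also have "sc (- 1) (tot c) = tot (\<lambda>p. - c p)" by (simp add: tot_def sc_sum sc_sc)
    finally show ?case by blast
  next
    case (eng x y)
    then obtain c d where "x = cl (tot c)" "y = cl (tot d)" by blast
    then have "x \<otimes>\<^bsub>add_monoid SA\<^esub> y = cl (tot (\<lambda>p. c p + d p))" by (simp add: cl_add[OF tot_carrier tot_carrier] tot_add)
    then show ?case by blast
  qed
next
  fix x assume "x \<in> range (\<lambda>c. cl (tot c))"
  then show "x \<in> carrier G" using cl_tot_in[OF G_subgroup] base_G by blast
qed

text \<open>The values on X do not depend on the choice, by \<open>tot_unique\<close>.\<close>

definition coord where "coord x = (SOME c. x = cl (tot c))"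

lemma coord_tot: "p \<in> X \<Longrightarrow> coord (cl (tot c)) p = c p"
proof -
  assume p: "p \<in> X"
  have "cl (tot c) = cl (tot (coord (cl (tot c))))" unfolding coord_def
    by (rule someI[where P = "\<lambda>d. cl (tot c) = cl (tot d)"]) (rule refl)
  then show ?thesis using tot_unique[OF _ p] by metis
qed

lemma G_comm_group: "comm_group G"
proof (rule group.group_comm_groupI)
  have "G = (add_monoid SA)\<lparr>carrier := carrier G\<rparr>" by (simp add: A_int_def)
  then show "group G" using group.subgroup_imp_group[OF SA.a_group G_subgroup] by simp
  fix x y assume "x \<in> carrier G" "y \<in> carrier G"
  then show "x \<otimes>\<^bsub>G\<^esub> y = y \<otimes>\<^bsub>G\<^esub> x"
    using subgroup.subset[OF G_subgroup] SA.a_comm unfolding G_mult by auto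
qed

lemma base_tot: "p \<in> X \<Longrightarrow> base p = cl (tot (\<lambda>s. if s = p then 1 else 0))"
proof -
  assume p: "p \<in> X"
  have "tot (\<lambda>s. if s = p then 1 else 0) = (\<Sum>s\<in>X. if s = p then msym (fst p) (snd p) else 0)"
    unfolding tot_def by (rule sum.cong) (auto simp: sc_zero_left)
  then show ?thesis using p finite_X by (simp add: base_def)
qed

lemma G_gen: "carrier G = generate G (base ` X)"
proof -
  have sub: "base ` X \<subseteq> carrier G" using base_G by blast
  have eq: "generate G (base ` X) = generate (add_monoid SA) (base ` X)"
    using group.generate_consistent[OF SA.a_group sub G_subgroup] by (simp add: A_int_def)
  have "subgroup (generate (add_monoid SA) (base ` X)) (add_monoid SA)"
    using sub subgroup.subset[OF G_subgroup] by (intro group.generate_is_subgroup[OF SA.a_group]) blast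
  then have "carrier G \<subseteq> generate (add_monoid SA) (base ` X)"
    unfolding G_tot using cl_tot_in generate.incl[of _ "base ` X" "add_monoid SA"] by blast
  moreover have "generate (add_monoid SA) (base ` X) \<subseteq> carrier G"
    by (rule group.generate_subgroup_incl[OF SA.a_group sub G_subgroup])
  ultimately show ?thesis unfolding eq by blast
qed

lemma coord_mult: "x \<in> carrier G \<Longrightarrow> y \<in> carrier G \<Longrightarrow> p \<in> X \<Longrightarrow> coord (x \<otimes>\<^bsub>G\<^esub> y) p = coord x p + coord y p"
proof -
  assume xy: "x \<in> carrier G" "y \<in> carrier G" and p: "p \<in> X"
  obtain c where c: "x = cl (tot c)" using xy(1) unfolding G_tot by blast
  obtain d where d: "y = cl (tot d)" using xy(2) unfolding G_tot by blast
  show ?thesis unfolding G_mult c d by (simp only: cl_add[OF tot_carrier tot_carrier] tot_add coord_tot[OF p])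
qed

lemma coord_base: "p \<in> X \<Longrightarrow> s \<in> X \<Longrightarrow> coord (base p) s = (if p = s then 1 else 0)"
  by (simp add: base_tot coord_tot)

end


section \<open>The semistandard basis\<close>

theorem mainTheorem4:
  fixes m n r p :: nat
    and lam :: "nat \<Rightarrow> nat"
    and T :: "nat \<times> nat \<Rightarrow> nat"
    and K :: "('k, 'd) ring_scheme"
  assumes "hook_partition m n r lam"
    and "basic_tableau lam r T"
    and "field K" and "characteristic K = p" and "p > 2"
  defines "SS \<equiv> {(i, j). i \<in> multiindices m n r \<and> j \<in> multiindices m n r \<and>
                          semistandard m lam T i \<and> semistandard m lam T j}"
    and "v \<equiv> (\<lambda>(i, j). pure_tensor (A_int m n r lam T) K
                          (modified_symmetrizer m n r lam T i j) \<one>\<^bsub>K\<^esub>)"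
  shows "vectorspace K (tensor_module (A_int m n r lam T) K)
    \<and> inj_on v SS
    \<and> vectorspace.basis K (tensor_module (A_int m n r lam T) K) (v ` SS)"
proof -
  note SS_eq = SS_def and v_eq = v_def
  interpret super_tableau m n r lam T
    using assms(1,2) by (simp add: super_tableau_def hook_partition_def)
  \<comment> \<open>Independence supplies the coordinates and straightening the generation, so the
    lattice is free on the semistandard modified symmetrizers.\<close>
  interpret free_tensor "A_int m n r lam T" K X base coord
    by (intro free_tensor.intro free_tensor_axioms.intro G_comm_group assms(3) finite_X base_G coord_mult coord_base G_gen)
  have SS: "SS = X"
    unfolding SS_eq X_def by (auto simp: SST_iff)
  have v: "v p = pure_tensor (A_int m n r lam T) K (base p) \<one>\<^bsub>K\<^esub>" if "p \<in> X" for p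
    using X_MI[OF that] by (simp add: v_eq base_def case_prod_unfold modified_symmetrizer_cl)
  have "inj_on v SS" "v ` SS = (\<lambda>p. pure_tensor (A_int m n r lam T) K (base p) \<one>\<^bsub>K\<^esub>) ` X"
    using pure_tensor_basis(1) v unfolding SS by (simp_all cong: inj_on_cong)
  then show ?thesis using M_vectorspace pure_tensor_basis(2) by simp
qed

end
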